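(* Let $I=[0,\gamma)$ with $0<\gamma\le\infty$, let $\varphi$ be a nondegenerate Orlicz function and let $w$ be a weight function on $I$. Then the order-continuous subspace $(\Lambda_{\varphi,w})_a$ is an M-ideal in the Orlicz-Lorentz space $\Lambda_{\varphi,w}$ equipped with the Luxemburg norm.
   Context: All Banach spaces are real. An Orlicz function is a convex function $\varphi:[0,\infty)\to[0,\infty)$ with $\varphi(0)=0$, not identically zero; it is nondegenerate if $\varphi(u)>0$ for all $u>0$. A weight function is a decreasing (i.e. non-increasing), positive, locally integrable function $w$ on $I=[0,\gamma)$ with $W(t)=\int_0^t w<\infty$ for $t\in[0,\gamma)$; if $\gamma=\infty$ it is assumed that $\int_0^\infty w=\infty$. For measurable $f$ on $I$ (Lebesgue measure $m$), $d_f(\lambda)=m\{t:|f(t)|>\lambda\}$ and $f^*(t)=\inf\{\lambda>0:d_f(\lambda)\le t\}$. Put $\rho_{\varphi,w}(f)=\int_I\varphi(f^* )w$. Then $\Lambda_{\varphi,w}=\{f:\rho_{\varphi,w}(kf)<\infty\text{ for some }k>0\}$ with the Luxemburg norm $\|f\|_{\varphi,w}=\inf\{\epsilon>0:\rho_{\varphi,w}(f/\epsilon)\le 1\}$. For a Banach function lattice $X$, $X_a$ is the closed subspace of order-continuous elements: $f\in X$ such that $\|f_n\|_X\downarrow 0$ for every sequence of measurable functions with $0\le f_n\le|f|$ and $f_n\downarrow 0$ a.e. A closed subspace $Y$ of a Banach space $X$ is an M-ideal in $X$ if its annihilator $Y^\perp\subset X^*$ is the range of a bounded projection $P:X^*\to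 X^*$ such that $\|F\|=\|P(F)\|+\|F-P(F)\|$ for all $F\in X^*$. *)

theory Defs
  imports "HOL-Analysis.Analysis"
begin

section \<open>Measurable functions modulo equality almost everywhere\<close>

text \<open>
  The type \<open>L0\<close> consists of the a.e.-classes of Lebesgue measurable functions on the whole line,
  so that it does not depend on the interval \<open>I = [0, \<gamma>)\<close>.  A function on \<open>I\<close> is represented by
  its extension by \<open>0\<close> to the line, i.e. the classes of functions on \<open>I\<close> are identified with the
  classes in \<open>L0\<close> that vanish a.e. outside \<open>I\<close>.
\<close>

definition ae_equal :: "(real \<Rightarrow> real) \<Rightarrow> (real \<Rightarrow> real) \<Rightarrow> bool" where
  "ae_equal f g \<longleftrightarrow> f \<in> borel_measurable lebesgue \<and> g \<in> borel_measurable lebesgue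
     \<and> (AE t in lebesgue. f t = g t)"

lemma part_equivp_ae_equal: "part_equivp ae_equal"
proof (rule part_equivpI)
  show "\<exists>f. ae_equal f f"
    by (rule exI[of _ "\<lambda>_. 0"]) (simp add: ae_equal_def)
  show "symp ae_equal"
    by (auto simp: ae_equal_def eq_commute intro!: sympI)
  show "transp ae_equal"
    by (rule transpI) (auto simp: ae_equal_def elim: eventually_elim2)
qed

quotient_type L0 = "real \<Rightarrow> real" / partial: ae_equal
  morphisms L0_rep L0_class
  by (rule part_equivp_ae_equal)

instantiation L0 :: real_vector
begin

lift_definition zero_L0 :: L0 is "\<lambda>_. 0"
  by (simp add: ae_equal_def)

lift_definition plus_L0 :: "L0 \<Rightarrow> L0 \<Rightarrow> L0" is "\<lambda>f g t. f t + g t"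
  by (auto simp: ae_equal_def elim: eventually_elim2)

lift_definition uminus_L0 :: "L0 \<Rightarrow> L0" is "\<lambda>f t. - f t"
  by (auto simp: ae_equal_def)

lift_definition minus_L0 :: "L0 \<Rightarrow> L0 \<Rightarrow> L0" is "\<lambda>f g t. f t - g t"
  by (auto simp: ae_equal_def elim: eventually_elim2)

lift_definition scaleR_L0 :: "real \<Rightarrow> L0 \<Rightarrow> L0" is "\<lambda>c f t. c * f t"
  by (auto simp: ae_equal_def elim: eventually_mono)

instance
  by standard (transfer; simp add: ae_equal_def algebra_simps)+

end

instantiation L0 :: "{order, abs}"
begin

lift_definition less_eq_L0 :: "L0 \<Rightarrow> L0 \<Rightarrow> bool" is "\<lambda>f g. AE t in lebesgue. f t \<le> g t"
  by (rule eventually_subst) (auto simp: ae_equal_def elim: eventually_elim2)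

definition less_L0 :: "L0 \<Rightarrow> L0 \<Rightarrow> bool" where
  "less_L0 f g \<longleftrightarrow> f \<le> g \<and> \<not> g \<le> f"

lift_definition abs_L0 :: "L0 \<Rightarrow> L0" is "\<lambda>f t. \<bar>f t\<bar>"
  by (auto simp: ae_equal_def elim: eventually_mono)

instance
proof
  fix f g h :: L0
  show "f < g \<longleftrightarrow> f \<le> g \<and> \<not> g \<le> f"
    by (rule less_L0_def)
  show "f \<le> f"
    by transfer simp
  show "f \<le> g \<Longrightarrow> g \<le> h \<Longrightarrow> f \<le> h"
    by transfer (auto elim: eventually_elim2)
  show "f \<le> g \<Longrightarrow> g \<le> f \<Longrightarrow> f = g"
    by transfer (auto simp: ae_equal_def elim: eventually_elim2)
qed

end

lift_definition ae_tendsto_zero :: "(nat \<Rightarrow> L0) \<Rightarrow> bool"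
  is "\<lambda>f. AE t in lebesgue. (\<lambda>n. f n t) \<longlonglongrightarrow> 0"
proof -
  fix f g :: "nat \<Rightarrow> real \<Rightarrow> real"
  assume "\<And>n. ae_equal (f n) (g n)"
  then have "AE t in lebesgue. \<forall>n. f n t = g n t"
    by (auto simp: ae_equal_def AE_all_countable)
  then have "AE t in lebesgue. ((\<lambda>n. f n t) \<longlonglongrightarrow> 0) = ((\<lambda>n. g n t) \<longlonglongrightarrow> 0)"
    by eventually_elim simp
  then show "(AE t in lebesgue. (\<lambda>n. f n t) \<longlonglongrightarrow> 0) = (AE t in lebesgue. (\<lambda>n. g n t) \<longlonglongrightarrow> 0)"
    by (rule eventually_subst)
qed

lift_definition ae_vanishes_outside :: "real set \<Rightarrow> L0 \<Rightarrow> bool"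
  is "\<lambda>A f. AE t in lebesgue. t \<notin> A \<longrightarrow> f t = 0"
  by (rule eventually_subst) (auto simp: ae_equal_def elim: eventually_mono)


section \<open>M-ideals\<close>

text \<open>
  A Banach space is given by a linear subspace \<open>X\<close> of a real vector space together with a
  function \<open>N\<close> whose values matter only on \<open>X\<close>.  Functionals on \<open>X\<close> are represented by functions
  that are \<open>0\<close> outside \<open>X\<close>, so that equality of functionals is equality of functions.
\<close>

definition banach_on :: "'a::real_vector set \<Rightarrow> ('a \<Rightarrow> real) \<Rightarrow> bool" where
  "banach_on X N \<longleftrightarrow>
     subspace X
     \<and> (\<forall>x\<in>X. 0 \<le> N x \<and> (N x = 0 \<longleftrightarrow> x = 0))
     \<and> (\<forall>x\<in>X. \<forall>c. N (c *\<^sub>R x) = \<bar>c\<bar> * N x)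
     \<and> (\<forall>x\<in>X. \<forall>y\<in>X. N (x + y) \<le> N x + N y)
     \<and> (\<forall>u. (\<forall>n::nat. u n \<in> X)
          \<and> (\<forall>e>0. \<exists>k. \<forall>m\<ge>k. \<forall>n\<ge>k. N (u m - u n) < e)
          \<longrightarrow> (\<exists>x\<in>X. (\<lambda>n. N (u n - x)) \<longlonglongrightarrow> 0))"

definition closed_subspace_on :: "'a::real_vector set \<Rightarrow> ('a \<Rightarrow> real) \<Rightarrow> 'a set \<Rightarrow> bool" where
  "closed_subspace_on X N Y \<longleftrightarrow>
     subspace Y \<and> Y \<subseteq> X
     \<and> (\<forall>u. \<forall>x\<in>X. (\<forall>n::nat. u n \<in> Y) \<and> (\<lambda>n. N (u n - x)) \<longlonglongrightarrow> 0 \<longrightarrow> x \<in> Y)"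

definition dual_on :: "'a::real_vector set \<Rightarrow> ('a \<Rightarrow> real) \<Rightarrow> ('a \<Rightarrow> real) set" where
  "dual_on X N =
     {F. (\<forall>x\<in>X. \<forall>y\<in>X. F (x + y) = F x + F y)
       \<and> (\<forall>x\<in>X. \<forall>c. F (c *\<^sub>R x) = c * F x)
       \<and> (\<exists>C. \<forall>x\<in>X. \<bar>F x\<bar> \<le> C * N x)
       \<and> (\<forall>x. x \<notin> X \<longrightarrow> F x = 0)}"

definition dual_norm_on :: "'a::real_vector set \<Rightarrow> ('a \<Rightarrow> real) \<Rightarrow> ('a \<Rightarrow> real) \<Rightarrow> real" where
  "dual_norm_on X N F = (SUP x\<in>{x\<in>X. N x \<le> 1}. \<bar>F x\<bar>)"

definition annihilator_on ::
    "'a::real_vector set \<Rightarrow> ('a \<Rightarrow> real) \<Rightarrow> 'a set \<Rightarrow> ('a \<Rightarrow> real) set" where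
  "annihilator_on X N Y = {F \<in> dual_on X N. \<forall>y\<in>Y. F y = 0}"

definition bounded_projection_on ::
    "'a::real_vector set \<Rightarrow> ('a \<Rightarrow> real) \<Rightarrow> (('a \<Rightarrow> real) \<Rightarrow> ('a \<Rightarrow> real)) \<Rightarrow> bool" where
  "bounded_projection_on X N P \<longleftrightarrow>
     (\<forall>F\<in>dual_on X N. P F \<in> dual_on X N \<and> P (P F) = P F)
     \<and> (\<forall>F\<in>dual_on X N. \<forall>G\<in>dual_on X N. P (\<lambda>x. F x + G x) = (\<lambda>x. P F x + P G x))
     \<and> (\<forall>F\<in>dual_on X N. \<forall>c. P (\<lambda>x. c * F x) = (\<lambda>x. c * P F x))
     \<and> (\<exists>C. \<forall>F\<in>dual_on X N. dual_norm_on X N (P F) \<le> C * dual_norm_on X N F)"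

definition M_ideal :: "'a::real_vector set \<Rightarrow> ('a \<Rightarrow> real) \<Rightarrow> 'a set \<Rightarrow> bool" where
  "M_ideal X N Y \<longleftrightarrow>
     banach_on X N \<and> closed_subspace_on X N Y
     \<and> (\<exists>P. bounded_projection_on X N P
          \<and> P ` dual_on X N = annihilator_on X N Y
          \<and> (\<forall>F\<in>dual_on X N. dual_norm_on X N F =
                dual_norm_on X N (P F) + dual_norm_on X N (\<lambda>x. F x - P F x)))"

definition order_continuous_part :: "L0 set \<Rightarrow> (L0 \<Rightarrow> real) \<Rightarrow> L0 set" where
  "order_continuous_part X N =
     {f\<in>X. \<forall>g. (\<forall>n. 0 \<le> g n \<and> g n \<le> \<bar>f\<bar>) \<and> decseq g \<and> ae_tendsto_zero g
           \<longrightarrow> decseq (\<lambda>n. N (g n)) \<and> (\<lambda>n. N (g n)) \<longlonglongrightarrow> 0}"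


section \<open>Orlicz-Lorentz spaces\<close>

definition orlicz_function :: "(real \<Rightarrow> real) \<Rightarrow> bool" where
  "orlicz_function \<phi> \<longleftrightarrow>
     convex_on {0..} \<phi> \<and> (\<forall>u\<ge>0. 0 \<le> \<phi> u) \<and> \<phi> 0 = 0 \<and> (\<exists>u\<ge>0. \<phi> u \<noteq> 0)"

definition nondegenerate :: "(real \<Rightarrow> real) \<Rightarrow> bool" where
  "nondegenerate \<phi> \<longleftrightarrow> (\<forall>u>0. 0 < \<phi> u)"

definition half_open_interval :: "ereal \<Rightarrow> real set" where
  "half_open_interval \<gamma> = {t. 0 \<le> t \<and> ereal t < \<gamma>}"

text \<open>
  Nothing is required of the value of \<open>w\<close> at the null set \<open>{0}\<close>: a real-valued function that is
  decreasing on all of \<open>[0, \<gamma>)\<close> is bounded, which would exclude weights such as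
  \<open>t powr (-1/2)\<close>.
\<close>

definition weight_function :: "ereal \<Rightarrow> (real \<Rightarrow> real) \<Rightarrow> bool" where
  "weight_function \<gamma> w \<longleftrightarrow>
     (\<forall>s t. 0 < s \<and> s \<le> t \<and> ereal t < \<gamma> \<longrightarrow> w t \<le> w s)
     \<and> (\<forall>t. 0 < t \<and> ereal t < \<gamma> \<longrightarrow> 0 < w t)
     \<and> (\<forall>t\<in>half_open_interval \<gamma>. set_integrable lebesgue {0..t} w)
     \<and> (\<gamma> = \<infinity> \<longrightarrow> (\<integral>\<^sup>+t\<in>{0..}. ennreal (w t) \<partial>lebesgue) = \<infinity>)"

lift_definition distribution :: "ereal \<Rightarrow> L0 \<Rightarrow> real \<Rightarrow> ennreal"
  is "\<lambda>\<gamma> f l. emeasure lebesgue {t \<in> half_open_interval \<gamma>. l < \<bar>f t\<bar>}"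
proof -
  fix \<gamma> :: ereal and f g :: "real \<Rightarrow> real"
  assume fg: "ae_equal f g"
  have "half_open_interval \<gamma> = {0..} \<inter> ereal -` {..<\<gamma>}"
    by (auto simp: half_open_interval_def)
  moreover have "ereal -` {..<\<gamma>} \<in> sets borel"
    by (simp add: open_ereal_vimage)
  ultimately have [measurable]: "half_open_interval \<gamma> \<in> sets lebesgue"
    by auto
  have [measurable]: "f \<in> borel_measurable lebesgue" "g \<in> borel_measurable lebesgue"
    using fg by (simp_all add: ae_equal_def)
  have "{t \<in> half_open_interval \<gamma>. l < \<bar>h t\<bar>} \<in> sets lebesgue"
    if [measurable]: "h \<in> borel_measurable lebesgue" for h and l :: real
  proof -
    have "{t \<in> space lebesgue. t \<in> half_open_interval \<gamma> \<and> l < \<bar>h t\<bar>} \<in> sets lebesgue"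
      by measurable
    then show ?thesis
      by simp
  qed
  then show "(\<lambda>l. emeasure lebesgue {t \<in> half_open_interval \<gamma>. l < \<bar>f t\<bar>}) =
      (\<lambda>l. emeasure lebesgue {t \<in> half_open_interval \<gamma>. l < \<bar>g t\<bar>})"
    using fg by (intro ext emeasure_eq_AE) (auto simp: ae_equal_def elim: eventually_mono)
qed

text \<open>The infimum of the empty set is \<open>\<infinity>\<close>.\<close>

definition rearrangement :: "ereal \<Rightarrow> L0 \<Rightarrow> real \<Rightarrow> ennreal" where
  "rearrangement \<gamma> f t = Inf {ennreal l | l. 0 < l \<and> distribution \<gamma> f l \<le> ennreal t}"

text \<open>The extension of an Orlicz function by \<open>\<phi>(\<infinity>) = \<infinity> = lim \<phi>(u)\<close> as \<open>u\<close> tends to \<open>\<infinity>\<close>.\<close>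

definition extend_infinity :: "(real \<Rightarrow> real) \<Rightarrow> ennreal \<Rightarrow> ennreal" where
  "extend_infinity \<phi> u = (if u = \<infinity> then \<infinity> else ennreal (\<phi> (enn2real u)))"

definition modular :: "ereal \<Rightarrow> (real \<Rightarrow> real) \<Rightarrow> (real \<Rightarrow> real) \<Rightarrow> L0 \<Rightarrow> ennreal" where
  "modular \<gamma> \<phi> w f =
     (\<integral>\<^sup>+t\<in>half_open_interval \<gamma>. extend_infinity \<phi> (rearrangement \<gamma> f t) * ennreal (w t) \<partial>lebesgue)"

definition orlicz_lorentz :: "ereal \<Rightarrow> (real \<Rightarrow> real) \<Rightarrow> (real \<Rightarrow> real) \<Rightarrow> L0 set" where
  "orlicz_lorentz \<gamma> \<phi> w =
     {f. ae_vanishes_outside (half_open_interval \<gamma>) f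
       \<and> (\<exists>k>0. modular \<gamma> \<phi> w (k *\<^sub>R f) < \<infinity>)}"

definition luxemburg_norm :: "ereal \<Rightarrow> (real \<Rightarrow> real) \<Rightarrow> (real \<Rightarrow> real) \<Rightarrow> L0 \<Rightarrow> real" where
  "luxemburg_norm \<gamma> \<phi> w f = Inf {\<epsilon>. 0 < \<epsilon> \<and> modular \<gamma> \<phi> w (f /\<^sub>R \<epsilon>) \<le> 1}"

end

theory Submission
  imports Defs
begin

text \<open>
  The modular is \<open>\<rho>(f) = \<integral> W(m{\<phi>|f| > \<lambda>}) d\<lambda>\<close> with \<open>W(m) = \<integral>\<^sub>0\<^sup>m w\<close>. Slicing the decreasing weight into
  indicators of initial intervals turns this into an integral of \<open>K\<close>-functionals between \<open>L\<^sub>1\<close> and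
  \<open>L\<^sub>\<infinity>\<close>, so \<open>h \<mapsto> \<integral> h* w\<close> is subadditive on nonnegative functions. Hence \<open>\<rho>\<close> is convex, and
  subadditive on disjointly supported functions.

  For \<open>g\<close> in the space let \<open>B\<^sub>n\<close> be the set where \<open>0 < |g| < 1/(n+1)\<close> or \<open>|g| > n+1\<close>. Off \<open>B\<^sub>n\<close> the
  function \<open>g\<close> is order-continuous, and \<open>\<rho>(g 1\<^bsub>B\<^sub>n\<^esub>) \<rightarrow> 0\<close>. A functional \<open>F\<close> splits as \<open>F\<^sub>c + F\<^sub>s\<close>
  with \<open>F\<^sub>c(g) = lim F(g - g 1\<^bsub>B\<^sub>n\<^esub>)\<close>, and \<open>F\<^sub>s\<close> annihilates the order-continuous part. If \<open>f\<close> is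
  order-continuous with \<open>\<rho>(f) < 1\<close> and \<open>\<rho>(g) \<le> 1\<close>, then \<open>f - f 1\<^bsub>B\<^sub>n\<^esub> + g 1\<^bsub>B\<^sub>n\<^esub>\<close> is eventually in the
  unit ball and \<open>F\<close> of it tends to \<open>F\<^sub>c(f) + F\<^sub>s(g)\<close>; therefore \<open>\<parallel>F\<^sub>c\<parallel> + \<parallel>F\<^sub>s\<parallel> \<le> \<parallel>F\<parallel>\<close>.
\<close>

section \<open>Layer cake formula and truncated distribution integrals\<close>

text \<open>No growth condition is imposed on \<open>\<phi>\<close>, so modular convergence is
  weaker than norm convergence, and the tails of an element of the space need not become small in
  norm. Two steps get around this. First, \<open>N f < 1\<close> gives
  \<open>\<rho> f \<le> 1\<close>, which gives \<open>N f \<le> 1\<close>; so an element of modular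
  strictly below 1 leaves room in the unit ball for a disjoint piece of small modular, whatever the
  norm of that piece. Second, the limit defining the order-continuous part of a functional cannot
  come from norm convergence of the truncations. It comes from order: the supremum of
  \<open>F\<close> over the order-continuous elements of an order interval is finite, and an almost
  maximal element leaves little to gain on far tails. No representation of functionals by integrals
  is required. Distribution functions are preferred to rearrangements because limits of functions
  then become limits of sets. Everything from the norm onwards rests on a short list of properties
  of the modular, collected in the locale \<open>modular_function_space\<close>.\<close>

lemma sigma_finite_lebesgue: "sigma_finite_measure (lebesgue :: 'a::euclidean_space measure)"
proof
  obtain A :: "'a set set" where A: "countable A" "A \<subseteq> sets lborel" "\<Union>A = space lborel"
      "\<forall>a\<in>A. emeasure lborel a \<noteq> \<infinity>"
    using lborel.sigma_finite_countable by blast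
  then show "\<exists>A::'a set set. countable A \<and> A \<subseteq> sets lebesgue \<and> \<Union>A = space lebesgue
      \<and> (\<forall>a\<in>A. emeasure lebesgue a \<noteq> \<infinity>)"
    by (intro exI[of _ A]) (auto simp: emeasure_completion subset_iff intro!: sets_completionI_sets)
qed

lemma emeasure_ennreal_less: "emeasure lborel {l. 0 \<le> l \<and> ennreal l < u} = u"
proof (cases u)
  case (real r)
  then have "{l. 0 \<le> l \<and> ennreal l < u} = {0..<r}"
    by (auto simp: ennreal_less_iff)
  then show ?thesis
    using real by simp
next
  case top
  have "{l. 0 \<le> l \<and> ennreal l < u} = {0..}"
    using top by auto
  moreover have "emeasure lborel {0::real..} = top"
  proof (rule ccontr)
    assume "emeasure lborel {0::real..} \<noteq> top"
    then obtain n :: nat where "emeasure lborel {0::real..} < of_nat n"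
      using ennreal_Ex_less_of_nat by (metis top.not_eq_extremum)
    moreover have "of_nat n = emeasure lborel {0::real..n}"
      by (simp add: ennreal_of_nat_eq_real_of_nat)
    moreover have "emeasure lborel {0::real..n} \<le> emeasure lborel {0::real..}"
      by (intro emeasure_mono) auto
    ultimately show False
      by simp
  qed
  ultimately show ?thesis
    using top by simp
qed

lemma nn_integral_layer_cake:
  fixes f :: "'a \<Rightarrow> ennreal"
  assumes "sigma_finite_measure M" and [measurable]: "f \<in> borel_measurable M"
  shows "(\<integral>\<^sup>+x. f x \<partial>M) = (\<integral>\<^sup>+l\<in>{0..}. emeasure M {x\<in>space M. ennreal l < f x} \<partial>lborel)"
proof -
  interpret M: sigma_finite_measure M by fact
  interpret pair_sigma_finite lborel M ..
  have "(\<integral>\<^sup>+x. f x \<partial>M) = (\<integral>\<^sup>+x. (\<integral>\<^sup>+l. indicator {l. 0 \<le> l \<and> ennreal l < f x} l \<partial>lborel) \<partial>M)"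
    by (intro nn_integral_cong, subst nn_integral_indicator) (auto simp: emeasure_ennreal_less)
  also have "\<dots> = (\<integral>\<^sup>+x. (\<integral>\<^sup>+l. (if 0 \<le> l \<and> ennreal l < f x then 1 else 0) \<partial>lborel) \<partial>M)"
    by (intro nn_integral_cong) (auto simp: indicator_def)
  also have "\<dots> = (\<integral>\<^sup>+l. (\<integral>\<^sup>+x. (if 0 \<le> l \<and> ennreal l < f x then 1 else 0) \<partial>M) \<partial>lborel)"
    by (rule Fubini') measurable
  also have "\<dots> = (\<integral>\<^sup>+l\<in>{0..}. emeasure M {x\<in>space M. ennreal l < f x} \<partial>lborel)"
  proof (intro nn_integral_cong)
    fix l :: real
    have "(\<integral>\<^sup>+x. (if 0 \<le> l \<and> ennreal l < f x then 1 else 0) \<partial>M)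
        = (\<integral>\<^sup>+x. indicator {0..} l * indicator {x\<in>space M. ennreal l < f x} x \<partial>M)"
      by (intro nn_integral_cong) (auto simp: indicator_def)
    then show "(\<integral>\<^sup>+x. (if 0 \<le> l \<and> ennreal l < f x then 1 else 0) \<partial>M)
        = emeasure M {x\<in>space M. ennreal l < f x} * indicator {0..} l"
      by (simp add: nn_integral_cmult mult.commute)
  qed
  finally show ?thesis .
qed

text \<open>Superlevel sets of a decreasing function on the line are intervals. This supplies
  measurability in the level variable for distribution functions and for what is built from
  them.\<close>

lemma measurable_ennreal_antimono [measurable (raw)]:
  fixes f :: "real \<Rightarrow> ennreal"
  assumes "antimono f"
  shows "f \<in> borel_measurable borel"
proof (rule borel_measurableI_greater)
  fix y
  have "is_interval {x. y < f x}"
    unfolding is_interval_1 using assms by (blast dest: antimonoD intro: less_le_trans)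
  then show "{x \<in> space borel. y < f x} \<in> sets borel"
    using real_interval_borel_measurable by simp
qed

section \<open>Distribution functions and the K-functional between L1 and L-infinity\<close>

definition distr_fun :: "'a measure \<Rightarrow> ('a \<Rightarrow> real) \<Rightarrow> real \<Rightarrow> ennreal" where
  "distr_fun M h l = emeasure M {x\<in>space M. l < h x}"

text \<open>The \<open>K\<close>-functional of \<open>h\<close> between \<open>L\<^sub>1\<close> and \<open>L\<^sub>\<infinity>\<close>, i.e. the integral of the decreasing
  rearrangement of \<open>h\<close> over \<open>[0, s)\<close>.\<close>

definition K_functional :: "'a measure \<Rightarrow> ennreal \<Rightarrow> ('a \<Rightarrow> real) \<Rightarrow> ennreal" where
  "K_functional M s h = (\<integral>\<^sup>+l\<in>{0..}. min s (distr_fun M h l) \<partial>lborel)"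

lemma antimono_distr_fun:
  assumes [measurable]: "h \<in> borel_measurable M"
  shows "antimono (distr_fun M h)"
  unfolding distr_fun_def by (intro antimonoI emeasure_mono) (auto, measurable)

lemma measurable_distr_fun [measurable (raw)]:
  assumes "h \<in> borel_measurable M"
  shows "distr_fun M h \<in> borel_measurable borel"
  by (rule measurable_ennreal_antimono[OF antimono_distr_fun[OF assms]])

text \<open>Layer cake formula for the positive part of \<open>h - a\<close>: \<open>ennreal\<close>
  sends negative numbers to 0, so no explicit truncation appears.\<close>

lemma nn_integral_distr_fun_shift:
  assumes "sigma_finite_measure M" and [measurable]: "h \<in> borel_measurable M"
  shows "(\<integral>\<^sup>+l\<in>{a..}. distr_fun M h l \<partial>lborel) = (\<integral>\<^sup>+x. ennreal (h x - a) \<partial>M)"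
proof -
  have "(\<integral>\<^sup>+l\<in>{a..}. distr_fun M h l \<partial>lborel) =
      (\<integral>\<^sup>+l. distr_fun M h (a + 1 * l) * indicator {a..} (a + 1 * l) \<partial>lborel)"
    by (subst nn_integral_real_affine[where c=1 and t=a]) (auto intro!: measurable_distr_fun)
  also have "\<dots> = (\<integral>\<^sup>+l\<in>{0..}. emeasure M {x\<in>space M. ennreal l < ennreal (h x - a)} \<partial>lborel)"
    by (intro nn_integral_cong)
      (auto simp: indicator_def distr_fun_def ennreal_less_iff algebra_simps
         intro!: arg_cong[where f="emeasure M"])
  also have "\<dots> = (\<integral>\<^sup>+x. ennreal (h x - a) \<partial>M)"
    by (rule nn_integral_layer_cake[symmetric, OF assms(1)]) measurable
  finally show ?thesis .
qed

lemma nn_integral_const_interval: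
  assumes "0 \<le> a"
  shows "(\<integral>\<^sup>+l\<in>{0..<a}. s \<partial>lborel) = s * ennreal a"
  using assms by (subst nn_integral_cmult_indicator) auto

text \<open>Cutting \<open>h\<close> at height \<open>a\<close> leaves a part bounded by
  \<open>a\<close>, charged \<open>s * a\<close>, and the excess above \<open>a\<close>, charged its
  integral. In the integrand the minimum is bounded by \<open>s\<close> below the level
  \<open>a\<close> and by the distribution function above it.\<close>

lemma K_functional_le:
  assumes "sigma_finite_measure M" and [measurable]: "h \<in> borel_measurable M" and "0 \<le> a"
  shows "K_functional M s h \<le> s * ennreal a + (\<integral>\<^sup>+x. ennreal (h x - a) \<partial>M)"
proof -
  have [measurable]: "distr_fun M h \<in> borel_measurable borel"
    by (rule measurable_distr_fun) fact
  have "K_functional M s h \<le> (\<integral>\<^sup>+l. s * indicator {0..<a} l + distr_fun M h l * indicator {a..} l \<partial>lborel)"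
    unfolding K_functional_def by (intro nn_integral_mono) (auto simp: indicator_def)
  also have "\<dots> = s * ennreal a + (\<integral>\<^sup>+x. ennreal (h x - a) \<partial>M)"
    using assms
    by (simp add: nn_integral_add nn_integral_distr_fun_shift nn_integral_const_interval)
  finally show ?thesis .
qed

text \<open>The optimal height is the first level at which the distribution function drops to
  \<open>s\<close>, i.e. the decreasing rearrangement of \<open>h\<close> at \<open>s\<close>: below
  it the minimum equals \<open>s\<close>, above it the distribution function.\<close>

lemma K_functional_attained:
  assumes "sigma_finite_measure M" and [measurable]: "h \<in> borel_measurable M"
    and "s \<noteq> 0" "K_functional M s h \<noteq> \<infinity>"
  obtains a where "0 \<le> a" "s * ennreal a + (\<integral>\<^sup>+x. ennreal (h x - a) \<partial>M) \<le> K_functional M s h"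
proof -
  have [measurable]: "distr_fun M h \<in> borel_measurable borel"
    by (rule measurable_distr_fun) fact
  define A where "A = {l. 0 \<le> l \<and> distr_fun M h l \<le> s}"
  \<comment> \<open>If the distribution function stayed above \<open>s\<close> at all levels, the
    integrand would be the nonzero constant \<open>s\<close> on a half-line and the K-functional
    infinite.\<close>
  have "A \<noteq> {}"
  proof
    assume "A = {}"
    have lt: "s < distr_fun M h l" if "0 \<le> l" for l
    proof (rule ccontr)
      assume "\<not> s < distr_fun M h l"
      then have "l \<in> A"
        using that by (simp add: A_def)
      then show False
        using \<open>A = {}\<close> by simp
    qed
    have "K_functional M s h = (\<integral>\<^sup>+l. s * indicator {0::real..} l \<partial>lborel)"
      unfolding K_functional_def
      by (intro nn_integral_cong) (auto simp: indicator_def min_def dest: lt)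
    also have "\<dots> = s * emeasure lborel {l::real. 0 \<le> l \<and> ennreal l < top}"
      by (subst nn_integral_cmult_indicator) (auto simp: atLeast_def)
    also have "\<dots> = \<infinity>"
      using \<open>s \<noteq> 0\<close> by (simp only: emeasure_ennreal_less) (simp add: ennreal_mult_top)
    finally show False
      using assms by simp
  qed
  define a where "a = Inf A"
  have bdd: "bdd_below A"
    by (auto simp: A_def intro: bdd_belowI[of _ 0])
  have "0 \<le> a"
    unfolding a_def using \<open>A \<noteq> {}\<close> by (intro cInf_greatest) (auto simp: A_def)
  have small: "s < distr_fun M h l" if "0 \<le> l" "l < a" for l
    using that cInf_lower[OF _ bdd, of l] unfolding a_def A_def by force
  have large: "distr_fun M h l \<le> s" if "a < l" for l
  proof -
    obtain k where "k \<in> A" "k < l"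
      using \<open>a < l\<close> cInf_less_iff[OF \<open>A \<noteq> {}\<close> bdd, of l] unfolding a_def by blast
    then show ?thesis
      using antimonoD[OF antimono_distr_fun[OF assms(2)], of k l] by (auto simp: A_def)
  qed
  have "s * ennreal a + (\<integral>\<^sup>+x. ennreal (h x - a) \<partial>M)
      = (\<integral>\<^sup>+l. s * indicator {0..<a} l + distr_fun M h l * indicator {a..} l \<partial>lborel)"
    using assms \<open>0 \<le> a\<close>
    by (simp add: nn_integral_add nn_integral_distr_fun_shift nn_integral_const_interval)
  also have "\<dots> \<le> K_functional M s h"
    unfolding K_functional_def
  proof (rule nn_integral_mono_AE)
    \<comment> \<open>Neither \<open>small\<close> nor \<open>large\<close> speaks about the level
      \<open>a\<close> itself, which is a null set.\<close>
    have "AE l in lborel. l \<noteq> a"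
      by (rule AE_lborel_singleton)
    then show "AE l in lborel. s * indicator {0..<a} l + distr_fun M h l * indicator {a..} l
        \<le> min s (distr_fun M h l) * indicator {0..} l"
    proof eventually_elim
      fix l assume "l \<noteq> a"
      then show "s * indicator {0..<a} l + distr_fun M h l * indicator {a..} l
        \<le> min s (distr_fun M h l) * indicator {0..} l"
        using \<open>0 \<le> a\<close> small[of l] large[of l]
        by (cases "l < a") (auto simp: indicator_def min_def not_less)
    qed
  qed
  finally show ?thesis
    using that \<open>0 \<le> a\<close> by blast
qed

text \<open>Cut \<open>h1\<close> and \<open>h2\<close> at their optimal heights and
  \<open>h\<close> at the sum of these: the excess of \<open>h\<close> over the sum is at most the
  sum of the two excesses. In the remaining cases, where \<open>K_functional_attained\<close>
  provides no height, the inequality is trivial.\<close>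

lemma K_functional_subadditive:
  assumes M: "sigma_finite_measure M"
    and meas: "h \<in> borel_measurable M" "h1 \<in> borel_measurable M" "h2 \<in> borel_measurable M"
    and le: "\<And>x. x \<in> space M \<Longrightarrow> h x \<le> h1 x + h2 x"
  shows "K_functional M s h \<le> K_functional M s h1 + K_functional M s h2"
proof (cases "s = 0 \<or> K_functional M s h1 = \<infinity> \<or> K_functional M s h2 = \<infinity>")
  case True
  moreover have "K_functional M 0 h = 0"
    by (simp add: K_functional_def)
  ultimately show ?thesis
    by auto
next
  case False
  obtain a1 where a1: "0 \<le> a1"
      "s * ennreal a1 + (\<integral>\<^sup>+x. ennreal (h1 x - a1) \<partial>M) \<le> K_functional M s h1"
    using False K_functional_attained[OF M meas(2), of s] by blast
  obtain a2 where a2: "0 \<le> a2"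
      "s * ennreal a2 + (\<integral>\<^sup>+x. ennreal (h2 x - a2) \<partial>M) \<le> K_functional M s h2"
    using False K_functional_attained[OF M meas(3), of s] by blast
  note [measurable] = meas
  have "K_functional M s h \<le> s * ennreal (a1 + a2) + (\<integral>\<^sup>+x. ennreal (h x - (a1 + a2)) \<partial>M)"
    using a1 a2 by (intro K_functional_le[OF M meas(1)]) auto
  also have "(\<integral>\<^sup>+x. ennreal (h x - (a1 + a2)) \<partial>M)
      \<le> (\<integral>\<^sup>+x. ennreal (h1 x - a1) + ennreal (h2 x - a2) \<partial>M)"
  proof (intro nn_integral_mono)
    fix x assume "x \<in> space M"
    then have "ennreal (h x - (a1 + a2)) \<le> ennreal (max 0 (h1 x - a1) + max 0 (h2 x - a2))"
      using le[of x] by (intro ennreal_leI) auto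
    also have "\<dots> = ennreal (h1 x - a1) + ennreal (h2 x - a2)"
      by (subst ennreal_plus) (auto simp: max_def ennreal_neg)
    finally show "ennreal (h x - (a1 + a2)) \<le> ennreal (h1 x - a1) + ennreal (h2 x - a2)" .
  qed
  also have "\<dots> = (\<integral>\<^sup>+x. ennreal (h1 x - a1) \<partial>M) + (\<integral>\<^sup>+x. ennreal (h2 x - a2) \<partial>M)"
    by (rule nn_integral_add) measurable
  also have "s * ennreal (a1 + a2) + \<dots>
      = (s * ennreal a1 + (\<integral>\<^sup>+x. ennreal (h1 x - a1) \<partial>M)) + (s * ennreal a2 + (\<integral>\<^sup>+x. ennreal (h2 x - a2) \<partial>M))"
    using a1 a2 by (simp add: algebra_simps)
  also have "\<dots> \<le> K_functional M s h1 + K_functional M s h2"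
    by (intro add_mono a1 a2)
  finally show ?thesis
    by (simp add: add_left_mono)
qed

section \<open>Integrals of decreasing rearrangements against a weight\<close>

lemma emeasure_le_liminf:
  assumes [measurable]: "A \<in> sets M" "\<And>n::nat. B n \<in> sets M"
    and "AE x in M. x \<in> A \<longrightarrow> eventually (\<lambda>n. x \<in> B n) sequentially"
  shows "emeasure M A \<le> liminf (\<lambda>n. emeasure M (B n))"
proof -
  have "emeasure M A = (\<integral>\<^sup>+x. indicator A x \<partial>M)"
    by simp
  also have "\<dots> \<le> (\<integral>\<^sup>+x. liminf (\<lambda>n. indicator (B n) x) \<partial>M)"
  proof (rule nn_integral_mono_AE)
    show "AE x in M. indicator A x \<le> liminf (\<lambda>n. indicator (B n) x :: ennreal)"
      using assms(3)
    proof eventually_elim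
      fix x
      assume x: "x \<in> A \<longrightarrow> eventually (\<lambda>n. x \<in> B n) sequentially"
      show "indicator A x \<le> liminf (\<lambda>n. indicator (B n) x :: ennreal)"
      proof (cases "x \<in> A")
        case True
        then have "1 \<le> liminf (\<lambda>n. indicator (B n) x :: ennreal)"
          using x by (intro Liminf_bounded) (auto elim: eventually_mono)
        then show ?thesis
          using True by simp
      qed auto
    qed
  qed
  also have "\<dots> \<le> liminf (\<lambda>n. (\<integral>\<^sup>+x. indicator (B n) x \<partial>M))"
    by (rule nn_integral_liminf) measurable
  finally show ?thesis
    by simp
qed

lemma emeasure_tendsto_zero:
  assumes [measurable]: "A \<in> sets M" "\<And>n::nat. B n \<in> sets M"
    and "emeasure M A < \<infinity>"
    and "\<And>n. AE x in M. x \<in> B n \<longrightarrow> x \<in> A"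
    and "AE x in M. eventually (\<lambda>n. x \<notin> B n) sequentially"
  shows "(\<lambda>n. emeasure M (B n)) \<longlonglongrightarrow> 0"
proof -
  have "(\<lambda>n. \<integral>\<^sup>+x. indicator (B n) x \<partial>M) \<longlonglongrightarrow> (\<integral>\<^sup>+x. 0 \<partial>M)"
  proof (rule nn_integral_dominated_convergence[where w="indicator A"])
    show "AE x in M. (\<lambda>n. indicator (B n) x :: ennreal) \<longlonglongrightarrow> 0"
      using assms(5) by eventually_elim (rule tendsto_eventually, auto elim: eventually_mono)
    show "AE x in M. indicator (B n) x \<le> (indicator A x :: ennreal)" for n
      using assms(4)[of n] by eventually_elim (auto simp: indicator_def)
  qed (use assms(3) in auto)
  then show ?thesis
    by simp
qed

lemma distr_fun_mono_AE:
  assumes [measurable]: "h \<in> borel_measurable M" "g \<in> borel_measurable M"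
    and "AE x in M. h x \<le> g x"
  shows "distr_fun M h l \<le> distr_fun M g l"
  unfolding distr_fun_def using assms(3) by (intro emeasure_mono_AE) (auto elim!: eventually_mono)

lemma ennreal_mult_le_1_iff:
  assumes "0 < l"
  shows "ennreal l * x \<le> 1 \<longleftrightarrow> x \<le> ennreal (1 / l)"
proof (cases x)
  case (real r)
  then show ?thesis
    using assms by (simp add: ennreal_mult[symmetric] ennreal_le_1 ennreal_le_iff field_simps)
next
  case top
  then show ?thesis
    using assms by (simp add: ennreal_mult_top top_unique)
qed

section \<open>The weight, its primitive and the weighted integral of a rearrangement\<close>

locale lorentz_weight =
  fixes \<gamma> :: ereal and w :: "real \<Rightarrow> real"
  assumes \<gamma>_pos: "0 < \<gamma>" and weight: "weight_function \<gamma> w"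
begin

text \<open>The endpoint 0 is left out because \<open>weight_function\<close> puts no condition on
  \<open>w 0\<close>; as a null set it affects neither integrals nor distribution functions.\<close>

definition J :: "real set" where
  "J = {t. 0 < t \<and> ereal t < \<gamma>}"

abbreviation L :: "real measure" where
  "L \<equiv> lebesgue_on J"

text \<open>The primitive of the weight. Its argument is extended because distribution functions can
  be infinite; arguments beyond the length of the interval give the total mass.\<close>

definition W :: "ennreal \<Rightarrow> ennreal" where
  "W m = (\<integral>\<^sup>+t. ennreal (w t) * indicator {t. ennreal t < m} t \<partial>L)"

text \<open>Equal to the integral of \<open>h* w\<close>.\<close>

definition lorentz :: "(real \<Rightarrow> real) \<Rightarrow> ennreal" where
  "lorentz h = (\<integral>\<^sup>+l\<in>{0..}. W (distr_fun L h l) \<partial>lborel)"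

lemma J_cases:
  obtains "\<gamma> = \<infinity>" "J = {0<..}" | g where "0 < g" "\<gamma> = ereal g" "J = {0<..<g}"
proof (cases \<gamma>)
  case (real g)
  then have "J = {0<..<g}"
    unfolding J_def by auto
  then show ?thesis
    using that(2) real \<gamma>_pos by simp
next
  case PInf
  then have "J = {0<..}"
    unfolding J_def by auto
  then show ?thesis
    using that(1) PInf by simp
qed (use \<gamma>_pos in auto)

lemma J_borel: "J \<in> sets borel"
  by (rule J_cases) auto

lemma J_sets [measurable, simp]: "J \<in> sets lebesgue"
  using J_borel by simp

lemma space_L [simp]: "space L = J"
  by simp

lemma sets_L: "A \<in> sets lebesgue \<Longrightarrow> A \<subseteq> J \<Longrightarrow> A \<in> sets L"
  by (auto simp: sets_restrict_space_iff)

lemma J_sets_L [measurable, simp]: "J \<in> sets L"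
  by (rule sets_L) auto

lemma emeasure_L: "A \<subseteq> J \<Longrightarrow> emeasure L A = emeasure lebesgue A"
  by (rule emeasure_restrict_space) auto

lemma sigma_finite_L: "sigma_finite_measure L"
  by (rule sigma_finite_measure_restrict_space[OF sigma_finite_lebesgue]) simp

lemma w_decreasing: "s \<in> J \<Longrightarrow> t \<in> J \<Longrightarrow> s \<le> t \<Longrightarrow> w t \<le> w s"
  using weight by (auto simp: weight_function_def J_def)

lemma w_pos: "t \<in> J \<Longrightarrow> 0 < w t"
  using weight by (auto simp: weight_function_def J_def)

lemma J_downward: "t \<in> J \<Longrightarrow> 0 < s \<Longrightarrow> s \<le> t \<Longrightarrow> s \<in> J"
  by (rule J_cases) auto

lemma w_measurable [measurable]: "(\<lambda>t. ennreal (w t)) \<in> borel_measurable L"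
proof (rule borel_measurableI_greater)
  fix y
  have "is_interval {x \<in> J. y < ennreal (w x)}"
    unfolding is_interval_1
  proof (intro ballI allI impI)
    fix a b x
    assume a: "a \<in> {x \<in> J. y < ennreal (w x)}" and b: "b \<in> {x \<in> J. y < ennreal (w x)}"
      and x: "a \<le> x \<and> x \<le> b"
    have "x \<in> J"
      using a b x J_downward[of b x] by (auto simp: J_def)
    moreover have "ennreal (w b) \<le> ennreal (w x)"
      using b x \<open>x \<in> J\<close> by (intro ennreal_leI w_decreasing) auto
    ultimately show "x \<in> {x \<in> J. y < ennreal (w x)}"
      using b by auto
  qed
  then have "{x \<in> J. y < ennreal (w x)} \<in> sets lebesgue"
    using real_interval_borel_measurable by simp
  then show "{x \<in> space L. y < ennreal (w x)} \<in> sets L"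
    by (intro sets_L) auto
qed

lemma id_measurable_L [measurable]: "(\<lambda>t. t) \<in> borel_measurable L"
  by (intro measurable_restrict_space1 measurable_completion) simp

lemma initial_measurable [measurable]: "{t \<in> J. ennreal t < m} \<in> sets L"
  using measurable_sets[OF measurable_compose[OF id_measurable_L measurable_ennreal], of "{..<m}"]
  by (simp add: vimage_def Int_def conj_commute)

lemma emeasure_initial_segment:
  assumes "m \<le> emeasure L J"
  shows "emeasure L {t \<in> J. ennreal t < m} = m"
proof (cases m)
  case (real r)
  have "{t \<in> J. ennreal t < m} = {0<..<r}"
  proof (rule J_cases)
    assume "J = {0<..}"
    then show ?thesis
      unfolding real using ennreal_less_iff[of _ r] by auto
  next
    fix g assume g: "0 < g" "\<gamma> = ereal g" "J = {0<..<g}"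
    have "emeasure L J = ennreal g"
      by (subst emeasure_L) (use g in auto)
    then have "r \<le> g"
      using assms real g by (simp add: ennreal_le_iff)
    then show ?thesis
      using real g by (auto simp: ennreal_less_iff)
  qed
  moreover have "emeasure L {t \<in> J. ennreal t < m} = emeasure lebesgue {t \<in> J. ennreal t < m}"
    by (rule emeasure_L) auto
  ultimately show ?thesis
    using real by simp
next
  case top
  then have "{t \<in> J. ennreal t < m} = J"
    by auto
  then show ?thesis
    using assms top by (simp add: top_unique)
qed

lemma W_eq_emeasure: "W m = emeasure (density L (\<lambda>t. ennreal (w t))) {t \<in> J. ennreal t < m}"
  unfolding W_def
  by (subst emeasure_density) (auto intro!: nn_integral_cong simp: indicator_def)

lemma mono_W: "m \<le> m' \<Longrightarrow> W m \<le> W m'"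
  unfolding W_def by (intro nn_integral_mono) (auto simp: indicator_def)

lemma measurable_W_distr_fun [measurable (raw)]:
  assumes "h \<in> borel_measurable L"
  shows "(\<lambda>l. W (distr_fun L h l)) \<in> borel_measurable borel"
  by (intro measurable_ennreal_antimono antimonoI mono_W antimonoD[OF antimono_distr_fun[OF assms]])

lemma distr_fun_le: "distr_fun L h l \<le> emeasure L J"
  unfolding distr_fun_def by (intro emeasure_mono) (auto intro: sets_L)

text \<open>Since \<open>w\<close> decreases, both \<open>{t \<in> J. ennreal t < m}\<close> and the
  superlevel sets of \<open>w\<close> are initial segments. One therefore contains the other, and
  their intersection has the smaller of the two measures. This is how monotonicity of the weight
  produces the minimum in \<open>K_functional\<close>.\<close>

lemma W_layer_cake:
  assumes "m \<le> emeasure L J"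
  shows "W m = (\<integral>\<^sup>+c\<in>{0..}. min m (distr_fun L w c) \<partial>lborel)"
proof -
  have "W m = (\<integral>\<^sup>+t. ennreal (w t) * indicator {t \<in> J. ennreal t < m} t \<partial>L)"
    unfolding W_def by (intro nn_integral_cong) (auto simp: indicator_def)
  also have "\<dots> = (\<integral>\<^sup>+c\<in>{0..}. emeasure L {t \<in> space L. ennreal c < ennreal (w t) * indicator {t \<in> J. ennreal t < m} t} \<partial>lborel)"
    by (intro nn_integral_layer_cake[OF sigma_finite_L] borel_measurable_times_ennreal w_measurable borel_measurable_indicator initial_measurable)
  also have "\<dots> = (\<integral>\<^sup>+c\<in>{0..}. min m (distr_fun L w c) \<partial>lborel)"
  proof (intro nn_integral_cong)
    fix c :: real
    show "emeasure L {t \<in> space L. ennreal c < ennreal (w t) * indicator {t \<in> J. ennreal t < m} t}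
        * indicator {0..} c = min m (distr_fun L w c) * indicator {0..} c"
    proof (cases "0 \<le> c")
      case True
      let ?A = "{t \<in> J. ennreal t < m}" and ?B = "{t \<in> J. ennreal c < ennreal (w t)}"
      have B: "?B \<in> sets L"
        using measurable_sets[OF w_measurable, of "{ennreal c<..}"] by (auto simp: vimage_def Int_def conj_commute)
      have eq: "{t \<in> space L. ennreal c < ennreal (w t) * indicator ?A t} = ?A \<inter> ?B"
        by (auto simp: indicator_def split: if_splits)
      have B_eq: "distr_fun L w c = emeasure L ?B"
        using True by (auto simp: distr_fun_def ennreal_less_iff)
      have "?A \<subseteq> ?B \<or> ?B \<subseteq> ?A"
      proof (rule ccontr)
        assume "\<not> (?A \<subseteq> ?B \<or> ?B \<subseteq> ?A)"
        then obtain a b where ab: "a \<in> ?A" "a \<notin> ?B" "b \<in> ?B" "b \<notin> ?A"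
          by blast
        show False
        proof (cases "a \<le> b")
          case True
          then have "ennreal (w b) \<le> ennreal (w a)"
            using ab by (intro ennreal_leI w_decreasing) auto
          then show False
            using ab by auto
        next
          case False
          then have "ennreal b \<le> ennreal a"
            by (intro ennreal_leI) auto
          then show False
            using ab by auto
        qed
      qed
      then have "emeasure L (?A \<inter> ?B) = min (emeasure L ?A) (emeasure L ?B)"
      proof
        assume "?A \<subseteq> ?B"
        then show ?thesis
          using emeasure_mono[of ?A ?B L] B by (simp add: Int_absorb2 min_absorb1)
      next
        assume "?B \<subseteq> ?A"
        then show ?thesis
          using emeasure_mono[of ?B ?A L] initial_measurable by (simp add: Int_absorb1 min_absorb2)
      qed
      then show ?thesis
        unfolding eq B_eq emeasure_initial_segment[OF assms] by simp
    qed simp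
  qed
  finally show ?thesis .
qed

lemma w_measurable_real [measurable]: "w \<in> borel_measurable L"
proof -
  have "(\<lambda>t. enn2real (ennreal (w t))) \<in> borel_measurable L"
    by measurable
  also have "?this \<longleftrightarrow> ?thesis"
    using w_pos by (intro measurable_cong) (auto simp: less_imp_le)
  finally show ?thesis .
qed

text \<open>Fubini exchanges the level \<open>l\<close> of \<open>h\<close> and the height
  \<open>c\<close> of the weight. Each slice of the weight then contributes one K-functional, and
  \<open>lorentz_add\<close> integrates the subadditivity of these.\<close>

lemma lorentz_eq_K_functional:
  assumes [measurable]: "h \<in> borel_measurable L"
  shows "lorentz h = (\<integral>\<^sup>+c\<in>{0..}. K_functional L (distr_fun L w c) h \<partial>lborel)"
proof -
  have [measurable]: "distr_fun L h \<in> borel_measurable borel" "distr_fun L w \<in> borel_measurable borel"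
    by (intro measurable_distr_fun assms w_measurable_real)+
  have "lorentz h = (\<integral>\<^sup>+l. (\<integral>\<^sup>+c. min (distr_fun L h l) (distr_fun L w c) * indicator {0..} c * indicator {0..} l \<partial>lborel) \<partial>lborel)"
    unfolding lorentz_def
    by (intro nn_integral_cong) (simp add: W_layer_cake distr_fun_le nn_integral_multc)
  also have "\<dots> = (\<integral>\<^sup>+c. (\<integral>\<^sup>+l. min (distr_fun L h l) (distr_fun L w c) * indicator {0..} c * indicator {0..} l \<partial>lborel) \<partial>lborel)"
    by (rule lborel_pair.Fubini') measurable
  also have "\<dots> = (\<integral>\<^sup>+c\<in>{0..}. K_functional L (distr_fun L w c) h \<partial>lborel)"
  proof (intro nn_integral_cong)
    fix c :: real
    have "(\<integral>\<^sup>+l. min (distr_fun L h l) (distr_fun L w c) * indicator {0..} c * indicator {0..} l \<partial>lborel)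
       = (\<integral>\<^sup>+l. min (distr_fun L w c) (distr_fun L h l) * indicator {0..} l * indicator {0..} c \<partial>lborel)"
      by (intro nn_integral_cong) (simp add: min.commute mult_ac)
    then show "(\<integral>\<^sup>+l. min (distr_fun L h l) (distr_fun L w c) * indicator {0..} c * indicator {0..} l \<partial>lborel)
       = K_functional L (distr_fun L w c) h * indicator {0..} c"
      unfolding K_functional_def by (subst (asm) nn_integral_multc) auto
  qed
  finally show ?thesis .
qed

lemma measurable_K_functional_L [measurable]:
  assumes [measurable]: "h \<in> borel_measurable L"
  shows "(\<lambda>c. K_functional L (distr_fun L w c) h) \<in> borel_measurable borel"
  unfolding K_functional_def
  by (intro measurable_ennreal_antimono antimonoI nn_integral_mono mult_right_mono min.mono
      antimonoD[OF antimono_distr_fun]) auto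

lemma lorentz_mono_AE:
  assumes "h \<in> borel_measurable L" "g \<in> borel_measurable L" "AE x in L. h x \<le> g x"
  shows "lorentz h \<le> lorentz g"
  unfolding lorentz_def
  by (intro nn_integral_mono mult_right_mono mono_W distr_fun_mono_AE assms) auto

lemma lorentz_add:
  assumes [measurable]: "h \<in> borel_measurable L" "g \<in> borel_measurable L"
  shows "lorentz (\<lambda>x. h x + g x) \<le> lorentz h + lorentz g"
proof -
  have "lorentz (\<lambda>x. h x + g x) \<le> (\<integral>\<^sup>+c. K_functional L (distr_fun L w c) h * indicator {0..} c
      + K_functional L (distr_fun L w c) g * indicator {0..} c \<partial>lborel)"
    by (subst lorentz_eq_K_functional, measurable, intro nn_integral_mono)
      (auto simp: indicator_def intro!: K_functional_subadditive[OF sigma_finite_L])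
  also have "\<dots> = lorentz h + lorentz g"
    by (subst nn_integral_add) (auto simp: lorentz_eq_K_functional)
  finally show ?thesis .
qed

lemma lorentz_cmult:
  assumes [measurable]: "h \<in> borel_measurable L" and "0 < a"
  shows "lorentz (\<lambda>x. a * h x) = ennreal a * lorentz h"
proof -
  have "lorentz (\<lambda>x. a * h x) =
      ennreal \<bar>a\<bar> * (\<integral>\<^sup>+l. W (distr_fun L (\<lambda>x. a * h x) (0 + a * l)) * indicator {0..} (0 + a * l) \<partial>lborel)"
    unfolding lorentz_def using assms by (intro nn_integral_real_affine) auto
  also have "(\<integral>\<^sup>+l. W (distr_fun L (\<lambda>x. a * h x) (0 + a * l)) * indicator {0..} (0 + a * l) \<partial>lborel) = lorentz h"
    unfolding lorentz_def distr_fun_def using assms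
    by (intro nn_integral_cong) (auto simp: indicator_def zero_le_mult_iff)
  finally show ?thesis
    using assms by simp
qed

text \<open>Lower semicontinuity of \<open>W\<close>: a point \<open>t\<close> below
  \<open>m\<close> is below \<open>M n\<close> for all large \<open>n\<close>, so Fatou applies to
  initial segments under the measure with density \<open>w\<close>.\<close>

lemma W_liminf:
  assumes "m \<le> liminf M"
  shows "W m \<le> liminf (\<lambda>n. W (M n))"
  unfolding W_eq_emeasure
proof (rule emeasure_le_liminf)
  show "AE x in density L (\<lambda>t. ennreal (w t)). x \<in> {t \<in> J. ennreal t < m} \<longrightarrow>
      (\<forall>\<^sub>F n in sequentially. x \<in> {t \<in> J. ennreal t < M n})"
    by (auto intro!: AE_I2 dest!: less_LiminfD[OF less_le_trans[OF _ assms]])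
qed auto

text \<open>Fatou is used three times: for the superlevel sets, which is possible because their
  inequality is strict, for \<open>W\<close>, and for the integral over the levels.\<close>

lemma lorentz_Fatou:
  assumes [measurable]: "h \<in> borel_measurable L" "\<And>n. g n \<in> borel_measurable L"
    and lim: "AE x in L. (\<lambda>n. g n x) \<longlonglongrightarrow> h x"
  shows "lorentz h \<le> liminf (\<lambda>n. lorentz (g n))"
proof -
  have distr: "distr_fun L h l \<le> liminf (\<lambda>n. distr_fun L (g n) l)" for l
    unfolding distr_fun_def
  proof (rule emeasure_le_liminf)
    show "AE x in L. x \<in> {x \<in> space L. l < h x} \<longrightarrow> (\<forall>\<^sub>F n in sequentially. x \<in> {x \<in> space L. l < g n x})"
      using lim by eventually_elim (auto dest!: order_tendstoD(1))
  qed measurable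
  have "lorentz h \<le> (\<integral>\<^sup>+l. liminf (\<lambda>n. W (distr_fun L (g n) l) * indicator {0..} l) \<partial>lborel)"
    unfolding lorentz_def
    by (intro nn_integral_mono) (auto simp: indicator_def intro!: W_liminf distr)
  also have "\<dots> \<le> liminf (\<lambda>n. lorentz (g n))"
    unfolding lorentz_def by (rule nn_integral_liminf) measurable
  finally show ?thesis .
qed

text \<open>The integrand decreases in the level, so on \<open>{0..<l}\<close> it is at least its
  value at \<open>l\<close>.\<close>

lemma lorentz_Chebyshev:
  assumes [measurable]: "h \<in> borel_measurable L" and "0 \<le> l"
  shows "ennreal l * W (distr_fun L h l) \<le> lorentz h"
proof -
  have "ennreal l * W (distr_fun L h l) = (\<integral>\<^sup>+k\<in>{0..<l}. W (distr_fun L h l) \<partial>lborel)"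
    using \<open>0 \<le> l\<close> by (subst nn_integral_const_interval) (auto simp: mult.commute)
  also have "\<dots> \<le> lorentz h"
    unfolding lorentz_def
    by (intro nn_integral_mono)
      (auto simp: indicator_def intro!: mono_W antimonoD[OF antimono_distr_fun])
  finally show ?thesis .
qed

text \<open>Integrability is given only up to points \<open>t\<close> below \<open>\<gamma>\<close>,
  and \<open>m\<close> may exceed such a \<open>t\<close>. Beyond \<open>t\<close> the decreasing
  weight is at most \<open>w t\<close>, and the remaining stretch has length at most
  \<open>r\<close>.\<close>

lemma W_finite:
  assumes "m < \<infinity>"
  shows "W m < \<infinity>"
proof -
  obtain r where r: "m = ennreal r" "0 \<le> r"
    using assms by (cases m) auto
  obtain t where t: "t \<in> J"
  proof (rule J_cases)
    assume "J = {0<..}"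
    then show ?thesis
      using that[of 1] by simp
  next
    fix g :: real assume "0 < g" "J = {0<..<g}"
    then show ?thesis
      using that[of "g / 2"] by simp
  qed
  have int: "(\<integral>\<^sup>+x\<in>{0..t}. ennreal (w x) \<partial>lebesgue) < \<infinity>"
    and meas [measurable]: "(\<lambda>x. ennreal (w x) * indicator {0..t} x) \<in> borel_measurable lebesgue"
  proof -
    have "t \<in> half_open_interval \<gamma>"
      using t by (auto simp: half_open_interval_def J_def)
    then have "set_integrable lebesgue {0..t} w"
      using weight by (auto simp: weight_function_def)
    then have [measurable]: "(\<lambda>x. indicator {0..t} x *\<^sub>R w x) \<in> borel_measurable lebesgue"
      by (auto simp: set_integrable_def)
    have "(\<lambda>x. ennreal (indicator {0..t} x *\<^sub>R w x)) \<in> borel_measurable lebesgue"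
      by measurable
    also have "(\<lambda>x. ennreal (indicator {0..t} x *\<^sub>R w x)) = (\<lambda>x. ennreal (w x) * indicator {0..t} x)"
      by (auto simp: indicator_def)
    finally show "(\<lambda>x. ennreal (w x) * indicator {0..t} x) \<in> borel_measurable lebesgue" .
    have "(\<integral>\<^sup>+x. ennreal (norm (indicator {0..t} x *\<^sub>R w x)) \<partial>lebesgue) < \<infinity>"
      using \<open>set_integrable lebesgue {0..t} w\<close>
      by (simp add: set_integrable_def integrable_iff_bounded)
    moreover have "(\<integral>\<^sup>+x\<in>{0..t}. ennreal (w x) \<partial>lebesgue) \<le> (\<integral>\<^sup>+x. ennreal (norm (indicator {0..t} x *\<^sub>R w x)) \<partial>lebesgue)"
      by (intro nn_integral_mono) (auto simp: indicator_def intro: ennreal_leI)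
    ultimately show "(\<integral>\<^sup>+x\<in>{0..t}. ennreal (w x) \<partial>lebesgue) < \<infinity>"
      by simp
  qed
  have "W m = (\<integral>\<^sup>+x. ennreal (w x) * indicator {t. ennreal t < m} x * indicator J x \<partial>lebesgue)"
    unfolding W_def by (subst nn_integral_restrict_space) auto
  also have "\<dots> \<le> (\<integral>\<^sup>+x. ennreal (w x) * indicator {0..t} x + ennreal (w t) * indicator {0..r} x \<partial>lebesgue)"
  proof (intro nn_integral_mono)
    fix x
    show "ennreal (w x) * indicator {t. ennreal t < m} x * indicator J x
        \<le> ennreal (w x) * indicator {0..t} x + ennreal (w t) * indicator {0..r} x"
    proof (cases "x \<in> J \<and> ennreal x < m")
      case True
      then have "0 < x" "x \<le> r"
        using r by (auto simp: J_def ennreal_less_iff)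
      moreover have "w x \<le> w t" if "t \<le> x"
        using True that t by (intro w_decreasing) auto
      ultimately show ?thesis
        using True by (cases "x \<le> t") (auto simp: ennreal_leI)
    qed auto
  qed
  also have "\<dots> = (\<integral>\<^sup>+x\<in>{0..t}. ennreal (w x) \<partial>lebesgue) + ennreal (w t) * ennreal r"
  proof (subst nn_integral_add)
    have [measurable]: "{0..r} \<in> sets lebesgue"
      by simp
    show "(\<lambda>x. ennreal (w t) * indicator {0..r} x) \<in> borel_measurable lebesgue"
      by measurable
  qed (use r in \<open>auto simp: nn_integral_cmult_indicator\<close>)
  also have "\<dots> < \<infinity>"
    using int by (simp add: ennreal_mult_less_top)
  finally show ?thesis .
qed

lemma W_tendsto_zero:
  assumes "M \<longlonglongrightarrow> 0" "\<And>n. M n \<le> m" "m < \<infinity>"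
  shows "(\<lambda>n. W (M n)) \<longlonglongrightarrow> 0"
  unfolding W_eq_emeasure
proof (rule emeasure_tendsto_zero[where A="{t \<in> J. ennreal t < m}"])
  show "emeasure (density L (\<lambda>t. ennreal (w t))) {t \<in> J. ennreal t < m} < \<infinity>"
    using W_finite[OF assms(3)] by (simp add: W_eq_emeasure)
  show "AE x in density L (\<lambda>t. ennreal (w t)). x \<in> {t \<in> J. ennreal t < M n} \<longrightarrow> x \<in> {t \<in> J. ennreal t < m}" for n
    using assms(2)[of n] by (auto intro!: AE_I2)
  show "AE x in density L (\<lambda>t. ennreal (w t)). \<forall>\<^sub>F n in sequentially. x \<notin> {t \<in> J. ennreal t < M n}"
  proof (rule AE_I2)
    fix x assume "x \<in> space (density L (\<lambda>t. ennreal (w t)))"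
    then have "0 < ennreal x"
      by (auto simp: J_def)
    then show "\<forall>\<^sub>F n in sequentially. x \<notin> {t \<in> J. ennreal t < M n}"
      using order_tendstoD(2)[OF assms(1), of "ennreal x"] by (auto elim!: eventually_mono)
  qed
qed auto

lemma W_infinity: "\<gamma> = \<infinity> \<Longrightarrow> W \<infinity> = \<infinity>"
proof -
  assume "\<gamma> = \<infinity>"
  then have J: "J = {0<..}"
    unfolding J_def by auto
  have "W \<infinity> = (\<integral>\<^sup>+x. ennreal (w x) * indicator {0<..} x \<partial>lebesgue)"
    unfolding W_def J by (subst nn_integral_restrict_space) (auto intro!: nn_integral_cong simp: indicator_def)
  also have "\<dots> = (\<integral>\<^sup>+x. ennreal (w x) * indicator {0..} x \<partial>lebesgue)"
  proof (rule nn_integral_cong_AE)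
    have "AE x in lebesgue. x \<noteq> (0::real)"
      by (intro AE_completion AE_lborel_singleton)
    then show "AE x in lebesgue. ennreal (w x) * indicator {0<..} x = ennreal (w x) * indicator {0..} x"
      by eventually_elim (auto simp: indicator_def)
  qed
  also have "\<dots> = \<infinity>"
    using weight \<open>\<gamma> = \<infinity>\<close> by (simp add: weight_function_def)
  finally show ?thesis .
qed

text \<open>A positive weight gives mass 0 only to null sets, and the bound on \<open>m\<close>
  ensures that the initial segment has measure exactly \<open>m\<close>.\<close>

lemma W_eq_0D:
  assumes "W m = 0" "m \<le> emeasure L J"
  shows "m = 0"
proof -
  have "AE t in L. ennreal (w t) * indicator {t \<in> J. ennreal t < m} t = 0"
    using assms(1) unfolding W_def
    by (subst (asm) nn_integral_0_iff_AE) (measurable, auto simp: indicator_def elim: eventually_mono)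
  then have "AE t in L. t \<notin> {t \<in> J. ennreal t < m}"
    using w_pos by (fastforce elim!: eventually_mono simp: indicator_def AE_restrict_space_iff ennreal_eq_0_iff not_le split: if_splits)
  then have "emeasure L {t \<in> J. ennreal t < m} = 0"
    by (subst (asm) AE_iff_measurable[OF _ refl]) auto
  then show ?thesis
    using emeasure_initial_segment[OF assms(2)] by simp
qed

text \<open>If \<open>\<gamma> = \<infinity>\<close>, an infinite value would make \<open>W\<close>
  infinite, because the weight has infinite integral, and contradict
  \<open>lorentz_Chebyshev\<close>. Otherwise \<open>J\<close> itself has finite measure.\<close>

lemma distr_fun_finite:
  assumes [measurable]: "h \<in> borel_measurable L" and "lorentz h < \<infinity>" "0 < l"
  shows "distr_fun L h l < \<infinity>"
proof (rule J_cases)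
  assume "\<gamma> = \<infinity>"
  have "W (distr_fun L h l) \<noteq> \<infinity>"
    using lorentz_Chebyshev[OF assms(1), of l] assms(2,3) by (auto simp: ennreal_mult_top top_unique)
  then show ?thesis
    using W_infinity[OF \<open>\<gamma> = \<infinity>\<close>] by (metis infinity_ennreal_def top.not_eq_extremum)
next
  fix g assume "0 < g" "J = {0<..<g}"
  then have "emeasure L J < \<infinity>"
    by (subst emeasure_L) auto
  then show ?thesis
    using distr_fun_le[of h l] by (rule le_less_trans[rotated])
qed

text \<open>At every level \<open>l > 0\<close> the superlevel set of \<open>h\<close> has finite
  measure, so those of \<open>g n\<close> shrink to measure 0 and so do their
  \<open>W\<close>-values. Dominated convergence over the levels finishes; the level 0, where the
  set may have infinite measure, is negligible.\<close>

lemma lorentz_dominated: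
  assumes [measurable]: "h \<in> borel_measurable L" "\<And>n. g n \<in> borel_measurable L"
    and fin: "lorentz h < \<infinity>"
    and le: "\<And>n. AE x in L. g n x \<le> h x"
    and lim: "AE x in L. (\<lambda>n. g n x) \<longlonglongrightarrow> 0"
  shows "(\<lambda>n. lorentz (g n)) \<longlonglongrightarrow> 0"
proof -
  have W_lim: "(\<lambda>n. W (distr_fun L (g n) l)) \<longlonglongrightarrow> 0" if "0 < l" for l
  proof (rule W_tendsto_zero)
    show "distr_fun L (g n) l \<le> distr_fun L h l" for n
      by (intro distr_fun_mono_AE le) measurable
    show "distr_fun L h l < \<infinity>"
      using that fin by (intro distr_fun_finite) auto
    then show "(\<lambda>n. distr_fun L (g n) l) \<longlonglongrightarrow> 0"
      unfolding distr_fun_def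
    proof (rule emeasure_tendsto_zero[rotated 2])
      show "AE x in L. x \<in> {x \<in> space L. l < g n x} \<longrightarrow> x \<in> {x \<in> space L. l < h x}" for n
        using le[of n] by eventually_elim auto
      show "AE x in L. \<forall>\<^sub>F n in sequentially. x \<notin> {x \<in> space L. l < g n x}"
        using lim by eventually_elim (use that in \<open>auto dest!: order_tendstoD(2)[of _ _ _ l] elim!: eventually_mono\<close>)
    qed measurable
  qed
  have "(\<lambda>n. lorentz (g n)) \<longlonglongrightarrow> (\<integral>\<^sup>+l. 0 \<partial>(lborel::real measure))"
    unfolding lorentz_def
  proof (rule nn_integral_dominated_convergence[where w="\<lambda>l. W (distr_fun L h l) * indicator {0..} l"])
    show "AE l in lborel. W (distr_fun L (g n) l) * indicator {0..} l \<le> W (distr_fun L h l) * indicator {0..} l" for n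
      by (intro AE_I2 mult_right_mono mono_W distr_fun_mono_AE le) auto
    show "(\<integral>\<^sup>+l\<in>{0..}. W (distr_fun L h l) \<partial>lborel) < \<infinity>"
      using fin by (simp add: lorentz_def)
    have "AE l in lborel. l \<noteq> (0::real)"
      by (rule AE_lborel_singleton)
    then show "AE l in lborel. (\<lambda>n. W (distr_fun L (g n) l) * indicator {0..} l) \<longlonglongrightarrow> 0"
    proof eventually_elim
      fix l :: real assume "l \<noteq> 0"
      then show "(\<lambda>n. W (distr_fun L (g n) l) * indicator {0..} l) \<longlonglongrightarrow> 0"
        using W_lim[of l] by (cases "0 < l") auto
    qed
  qed measurable
  then show ?thesis
    by simp
qed

lemma lorentz_finite:
  assumes [measurable]: "h \<in> borel_measurable L" and "AE x in L. h x \<le> C" "0 \<le> C"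
    and "distr_fun L h 0 < \<infinity>"
  shows "lorentz h < \<infinity>"
proof -
  have zero: "distr_fun L h l = 0" if "C \<le> l" for l
  proof -
    have "AE x in L. \<not> l < h x"
      using assms(2) that by (auto elim!: eventually_mono)
    then show ?thesis
      unfolding distr_fun_def by (subst (asm) AE_iff_measurable[OF _ refl]) auto
  qed
  have "W 0 = 0"
    by (simp add: W_def)
  have "lorentz h \<le> (\<integral>\<^sup>+l\<in>{0..<C}. W (distr_fun L h 0) \<partial>lborel)"
    unfolding lorentz_def using zero \<open>W 0 = 0\<close>
    by (intro nn_integral_mono)
      (auto simp: indicator_def intro!: mono_W antimonoD[OF antimono_distr_fun])
  also have "\<dots> < \<infinity>"
    using W_finite[OF assms(4)] nn_integral_const_interval[OF \<open>0 \<le> C\<close>]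
    by (simp add: ennreal_mult_less_top)
  finally show ?thesis .
qed

end

section \<open>Representatives of classes of measurable functions\<close>

lemma L0_rep_measurable [measurable, simp]: "L0_rep f \<in> borel_measurable lebesgue"
  using Quotient_rep_reflp[OF Quotient_L0, of f] by (simp add: ae_equal_def)

lemma AE_L0_rep_class:
  assumes "h \<in> borel_measurable lebesgue"
  shows "AE t in lebesgue. L0_rep (L0_class h) t = h t"
  using Quotient_rep_abs[OF Quotient_L0, of h] assms by (simp add: ae_equal_def)

lemma AE_L0_rep_plus: "AE t in lebesgue. L0_rep (f + g) t = L0_rep f t + L0_rep g t"
  by (simp add: plus_L0_def AE_L0_rep_class)

lemma AE_L0_rep_minus: "AE t in lebesgue. L0_rep (f - g) t = L0_rep f t - L0_rep g t"
  by (simp add: minus_L0_def AE_L0_rep_class)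

lemma AE_L0_rep_scaleR: "AE t in lebesgue. L0_rep (c *\<^sub>R f) t = c * L0_rep f t"
  by (simp add: scaleR_L0_def AE_L0_rep_class)

lemma AE_L0_rep_abs: "AE t in lebesgue. L0_rep \<bar>f\<bar> t = \<bar>L0_rep f t\<bar>"
  by (simp add: abs_L0_def AE_L0_rep_class)

lemma AE_L0_rep_zero: "AE t in lebesgue. L0_rep 0 t = 0"
  by (simp add: zero_L0_def AE_L0_rep_class)

lemma L0_le_iff: "f \<le> g \<longleftrightarrow> (AE t in lebesgue. L0_rep f t \<le> L0_rep g t)"
  by (simp add: less_eq_L0_def)

lemma L0_eq_iff: "f = g \<longleftrightarrow> (AE t in lebesgue. L0_rep f t = L0_rep g t)"
proof
  assume "AE t in lebesgue. L0_rep f t = L0_rep g t"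
  then have "f \<le> g" "g \<le> f"
    unfolding L0_le_iff by (auto elim: eventually_mono)
  then show "f = g"
    by simp
qed simp

lemma L0_abs_le_iff: "\<bar>f\<bar> \<le> \<bar>g\<bar> \<longleftrightarrow> (AE t in lebesgue. \<bar>L0_rep f t\<bar> \<le> \<bar>L0_rep g t\<bar>)"
proof -
  have "AE t in lebesgue. L0_rep \<bar>f\<bar> t \<le> L0_rep \<bar>g\<bar> t \<longleftrightarrow> \<bar>L0_rep f t\<bar> \<le> \<bar>L0_rep g t\<bar>"
    using AE_L0_rep_abs[of f] AE_L0_rep_abs[of g] by eventually_elim simp
  then show ?thesis
    unfolding L0_le_iff by (rule eventually_subst)
qed

lemma ae_tendsto_zero_iff:
  "ae_tendsto_zero f \<longleftrightarrow> (AE t in lebesgue. (\<lambda>n. L0_rep (f n) t) \<longlonglongrightarrow> 0)"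
  by (simp add: ae_tendsto_zero_def)

lemma ae_vanishes_outside_iff:
  "ae_vanishes_outside A f \<longleftrightarrow> (AE t in lebesgue. t \<notin> A \<longrightarrow> L0_rep f t = 0)"
  by (simp add: ae_vanishes_outside_def)

text \<open>Truncating at large values alone would not lead into the order-continuous part: if \<open>\<gamma> = \<infinity>\<close> and
  \<open>\<phi>\<close> grows fast near \<open>0\<close>, the small values have to be cut off as well.\<close>

lift_definition tail :: "nat \<Rightarrow> L0 \<Rightarrow> L0 \<Rightarrow> L0"
  is "\<lambda>n h f t. if h t \<noteq> 0 \<and> (\<bar>h t\<bar> < 1 / real (Suc n) \<or> real (Suc n) < \<bar>h t\<bar>) then f t else 0"
proof -
  fix n and h1 h2 f1 f2 :: "real \<Rightarrow> real"
  assume "ae_equal h1 h2" "ae_equal f1 f2"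
  then have [measurable]: "h1 \<in> borel_measurable lebesgue" "h2 \<in> borel_measurable lebesgue"
      "f1 \<in> borel_measurable lebesgue" "f2 \<in> borel_measurable lebesgue"
    and eq: "AE t in lebesgue. h1 t = h2 t" "AE t in lebesgue. f1 t = f2 t"
    by (auto simp: ae_equal_def)
  show "ae_equal (\<lambda>t. if h1 t \<noteq> 0 \<and> (\<bar>h1 t\<bar> < 1 / real (Suc n) \<or> real (Suc n) < \<bar>h1 t\<bar>) then f1 t else 0)
      (\<lambda>t. if h2 t \<noteq> 0 \<and> (\<bar>h2 t\<bar> < 1 / real (Suc n) \<or> real (Suc n) < \<bar>h2 t\<bar>) then f2 t else 0)"
    unfolding ae_equal_def
  proof (intro conjI)
    show "AE t in lebesgue. (if h1 t \<noteq> 0 \<and> (\<bar>h1 t\<bar> < 1 / real (Suc n) \<or> real (Suc n) < \<bar>h1 t\<bar>) then f1 t else 0)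
        = (if h2 t \<noteq> 0 \<and> (\<bar>h2 t\<bar> < 1 / real (Suc n) \<or> real (Suc n) < \<bar>h2 t\<bar>) then f2 t else 0)"
      using eq by eventually_elim simp
  qed measurable
qed

text \<open>The value 0 is left out, so that every real number leaves these sets eventually.
  Consequently \<open>tail n h f\<close> tends to 0 a.e. for all \<open>h\<close> and
  \<open>f\<close>, even where \<open>h\<close> vanishes and \<open>f\<close> does not.\<close>

definition tail_set :: "nat \<Rightarrow> real set" where
  "tail_set n = {x. x \<noteq> 0 \<and> (\<bar>x\<bar> < 1 / real (Suc n) \<or> real (Suc n) < \<bar>x\<bar>)}"

lemma tail_set_mono:
  assumes "m \<le> n"
  shows "tail_set n \<subseteq> tail_set m"
proof -
  have "1 / real (Suc n) \<le> 1 / real (Suc m)" "real (Suc m) \<le> real (Suc n)"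
    using assms by (auto intro: divide_left_mono)
  then show ?thesis
    unfolding tail_set_def by (fastforce simp del: of_nat_Suc)
qed

lemma AE_L0_rep_tail: "AE t in lebesgue. L0_rep (tail n h f) t = (if L0_rep h t \<in> tail_set n then L0_rep f t else 0)"
proof -
  let ?f = "\<lambda>t. if L0_rep h t \<noteq> 0 \<and> (\<bar>L0_rep h t\<bar> < 1 / real (Suc n) \<or> real (Suc n) < \<bar>L0_rep h t\<bar>)
    then L0_rep f t else 0"
  have "tail n h f = L0_class ?f"
    unfolding tail_def map_fun_apply id_apply ..
  moreover have "AE t in lebesgue. L0_rep (L0_class ?f) t = ?f t"
    by (rule AE_L0_rep_class) measurable
  ultimately show ?thesis
    unfolding tail_set_def mem_Collect_eq by simp
qed

lemma eventually_not_in_tail_set: "eventually (\<lambda>n. x \<notin> tail_set n) sequentially"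
proof (cases "x = 0")
  case False
  obtain m :: nat where m: "\<bar>x\<bar> < real m" "1 / \<bar>x\<bar> < real m"
    using reals_Archimedean2[of "max \<bar>x\<bar> (1 / \<bar>x\<bar>)"] by auto
  have "x \<notin> tail_set n" if "m \<le> n" for n
  proof -
    have "real m < real (Suc n)"
      using that by simp
    moreover have "1 / real (Suc n) < \<bar>x\<bar>"
    proof -
      have "1 / \<bar>x\<bar> < real (Suc n)"
        using m(2) \<open>real m < real (Suc n)\<close> by linarith
      then have "1 < real (Suc n) * \<bar>x\<bar>"
        using False by (simp add: pos_divide_less_eq del: of_nat_Suc)
      then show ?thesis
        by (simp add: pos_divide_less_eq mult.commute del: of_nat_Suc)
    qed
    ultimately show ?thesis
      using m by (auto simp: tail_set_def)
  qed
  then show ?thesis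
    by (auto simp: eventually_sequentially)
qed (auto simp: tail_set_def)

section \<open>The modular of an Orlicz-Lorentz space\<close>

locale orlicz_lorentz_modular = lorentz_weight +
  fixes \<phi> :: "real \<Rightarrow> real"
  assumes orlicz: "orlicz_function \<phi>" and nondeg: "nondegenerate \<phi>"
begin

section \<open>Growth, continuity and range of the Orlicz function\<close>

lemma \<phi>_0 [simp]: "\<phi> 0 = 0"
  using orlicz by (simp add: orlicz_function_def)

lemma \<phi>_nonneg: "0 \<le> u \<Longrightarrow> 0 \<le> \<phi> u"
  using orlicz by (simp add: orlicz_function_def)

lemma \<phi>_pos: "0 < u \<Longrightarrow> 0 < \<phi> u"
  using nondeg by (simp add: nondegenerate_def)

lemma \<phi>_convex:
  assumes "0 \<le> a" "0 \<le> b" "a + b = 1" "0 \<le> x" "0 \<le> y"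
  shows "\<phi> (a * x + b * y) \<le> a * \<phi> x + b * \<phi> y"
  using orlicz assms convex_onD[of "{0..}" \<phi> b x y]
  by (simp add: orlicz_function_def) (smt (verit, best))

lemma \<phi>_scale:
  assumes "0 \<le> c" "c \<le> 1" "0 \<le> u"
  shows "\<phi> (c * u) \<le> c * \<phi> u"
  using \<phi>_convex[of c "1 - c" u 0] assms by simp

lemma \<phi>_strict_mono:
  assumes "0 \<le> x" "x < y"
  shows "\<phi> x < \<phi> y"
proof -
  have "\<phi> (x / y * y) \<le> x / y * \<phi> y"
    using assms by (intro \<phi>_scale) auto
  also have "\<dots> < 1 * \<phi> y"
    using assms \<phi>_pos[of y] by (intro mult_strict_right_mono) auto
  finally show ?thesis
    using assms by simp
qed

lemma \<phi>_mono: "0 \<le> x \<Longrightarrow> x \<le> y \<Longrightarrow> \<phi> x \<le> \<phi> y"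
  using \<phi>_strict_mono[of x y] by (cases "x = y") auto

lemma \<phi>_less_iff: "0 \<le> x \<Longrightarrow> 0 \<le> y \<Longrightarrow> \<phi> x < \<phi> y \<longleftrightarrow> x < y"
  using \<phi>_strict_mono[of x y] \<phi>_mono[of y x] by (auto simp: not_less[symmetric])

text \<open>The even extension of \<open>\<phi>\<close> is convex on the whole line, and convex
  functions are continuous on open sets. The extension thus settles continuity at the endpoint 0 as
  well.\<close>

lemma continuous_\<phi>_abs: "continuous_on UNIV (\<lambda>x. \<phi> \<bar>x\<bar>)"
proof (rule convex_on_continuous[OF open_UNIV])
  show "convex_on UNIV (\<lambda>x. \<phi> \<bar>x\<bar>)"
  proof (rule convex_onI)
    fix t x y :: real assume t: "0 < t" "t < 1"
    have "\<bar>(1 - t) *\<^sub>R x + t *\<^sub>R y\<bar> \<le> (1 - t) * \<bar>x\<bar> + t * \<bar>y\<bar>"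
      using t abs_triangle_ineq[of "(1 - t) * x" "t * y"] by (simp add: abs_mult)
    then have "\<phi> \<bar>(1 - t) *\<^sub>R x + t *\<^sub>R y\<bar> \<le> \<phi> ((1 - t) * \<bar>x\<bar> + t * \<bar>y\<bar>)"
      by (intro \<phi>_mono) auto
    also have "\<dots> \<le> (1 - t) * \<phi> \<bar>x\<bar> + t * \<phi> \<bar>y\<bar>"
      using t by (intro \<phi>_convex) auto
    finally show "\<phi> \<bar>(1 - t) *\<^sub>R x + t *\<^sub>R y\<bar> \<le> (1 - t) * \<phi> \<bar>x\<bar> + t * \<phi> \<bar>y\<bar>" .
  qed auto
qed

lemma \<phi>_abs_measurable [measurable (raw)]:
  assumes "h \<in> borel_measurable M"
  shows "(\<lambda>x. \<phi> \<bar>h x\<bar>) \<in> borel_measurable M"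
  by (rule measurable_compose[OF assms borel_measurable_continuous_onI[OF continuous_\<phi>_abs]])

text \<open>Convexity gives \<open>b * \<phi> 1 \<le> \<phi> b\<close> for \<open>b \<ge> 1\<close>,
  so \<open>\<phi>\<close> reaches beyond \<open>l\<close> at
  \<open>b = max 1 (l / \<phi> 1)\<close>, and the intermediate value theorem applies.\<close>

lemma \<phi>_surj:
  assumes "0 \<le> l"
  obtains x where "0 \<le> x" "\<phi> x = l"
proof -
  obtain b where b: "1 \<le> b" "l \<le> \<phi> b"
  proof
    define b where "b = max 1 (l / \<phi> 1)"
    show "1 \<le> b"
      by (simp add: b_def)
    have "\<phi> (1 / b * b) \<le> 1 / b * \<phi> b"
      using \<open>1 \<le> b\<close> by (intro \<phi>_scale) auto
    then have "b * \<phi> 1 \<le> \<phi> b"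
      using \<open>1 \<le> b\<close> by (simp add: field_simps)
    moreover have "l \<le> b * \<phi> 1"
      using \<phi>_pos[of 1] by (simp add: b_def max_def field_simps)
    ultimately show "l \<le> \<phi> b"
      by simp
  qed
  have "continuous_on {0..b} (\<lambda>x. \<phi> \<bar>x\<bar>)"
    by (rule continuous_on_subset[OF continuous_\<phi>_abs]) auto
  then obtain x where "0 \<le> x" "x \<le> b" "\<phi> \<bar>x\<bar> = l"
    using IVT'[of "\<lambda>x. \<phi> \<bar>x\<bar>" 0 l b] assms b by auto
  then show ?thesis
    using that[of x] by simp
qed

lemma AE_L: "AE t in lebesgue. P t \<Longrightarrow> AE t in L. P t"
  by (auto simp: AE_restrict_space_iff elim: eventually_mono)

lemma L0_rep_measurable_L [measurable, simp]: "L0_rep f \<in> borel_measurable L"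
  by (rule measurable_restrict_space1) simp

section \<open>From rearrangements to distribution functions\<close>

lemma distribution_eq: "distribution \<gamma> f x = distr_fun L (\<lambda>t. \<bar>L0_rep f t\<bar>) x"
proof -
  have "distr_fun L (\<lambda>t. \<bar>L0_rep f t\<bar>) x = emeasure lebesgue {t \<in> J. x < \<bar>L0_rep f t\<bar>}"
    unfolding distr_fun_def by (subst emeasure_L) auto
  also have "\<dots> = emeasure lebesgue {t \<in> half_open_interval \<gamma>. x < \<bar>L0_rep f t\<bar>}"
  proof (rule emeasure_eq_AE)
    have "AE t in lebesgue. t \<noteq> (0::real)"
      by (intro AE_completion AE_lborel_singleton)
    then show "AE t in lebesgue. t \<in> {t \<in> J. x < \<bar>L0_rep f t\<bar>} \<longleftrightarrow>
        t \<in> {t \<in> half_open_interval \<gamma>. x < \<bar>L0_rep f t\<bar>}"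
      by eventually_elim (auto simp: J_def half_open_interval_def)
    have J: "{t \<in> J. x < \<bar>L0_rep f t\<bar>} \<in> sets lebesgue"
    proof -
      have "{t \<in> space L. x < \<bar>L0_rep f t\<bar>} \<in> sets L"
        by measurable
      then show ?thesis
        by (simp add: sets_restrict_space_iff)
    qed
    then show "{t \<in> J. x < \<bar>L0_rep f t\<bar>} \<in> sets lebesgue" .
    have "{t \<in> half_open_interval \<gamma>. x < \<bar>L0_rep f t\<bar>} = {t \<in> J. x < \<bar>L0_rep f t\<bar>}
        \<union> {t \<in> {0}. x < \<bar>L0_rep f t\<bar>}"
      using \<gamma>_pos by (auto simp: J_def half_open_interval_def zero_ereal_def)
    moreover have "{t \<in> {0}. x < \<bar>L0_rep f t\<bar>} \<in> sets lebesgue"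
      by (cases "x < \<bar>L0_rep f 0\<bar>") (auto simp: conj_commute cong: conj_cong)
    ultimately show "{t \<in> half_open_interval \<gamma>. x < \<bar>L0_rep f t\<bar>} \<in> sets lebesgue"
      using J by auto
  qed
  finally show ?thesis
    by (simp add: distribution.rep_eq)
qed

text \<open>The rearrangement is a generalized inverse of the distribution function; the strict
  inequalities correspond exactly because the distribution function is right-continuous.\<close>

lemma less_rearrangement_iff:
  assumes "0 \<le> x"
  shows "ennreal x < rearrangement \<gamma> f t \<longleftrightarrow> ennreal t < distribution \<gamma> f x"
proof
  assume less: "ennreal x < rearrangement \<gamma> f t"
  show "ennreal t < distribution \<gamma> f x"
  proof (rule ccontr)
    assume not: "\<not> ennreal t < distribution \<gamma> f x"
    \<comment> \<open>A level strictly above \<open>x\<close> is positive even if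
      \<open>x = 0\<close>, hence admissible in the infimum that defines the rearrangement.\<close>
    obtain y where y: "x < y" "ennreal y < rearrangement \<gamma> f t"
    proof -
      obtain z where z: "ennreal x < z" "z < rearrangement \<gamma> f t"
        using dense[OF less] by blast
      then obtain y where "z = ennreal y" "0 \<le> y"
        by (cases z) auto
      then show ?thesis
        using that[of y] z assms by (simp add: ennreal_less_iff)
    qed
    have "distribution \<gamma> f y \<le> distribution \<gamma> f x"
      unfolding distribution_eq using y by (intro antimonoD[OF antimono_distr_fun]) auto
    then have "distribution \<gamma> f y \<le> ennreal t"
      using not by auto
    then have "rearrangement \<gamma> f t \<le> ennreal y"
      unfolding rearrangement_def using assms y by (intro Inf_lower) auto
    then show False
      using y by simp
  qed
next
  assume less: "ennreal t < distribution \<gamma> f x"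
  \<comment> \<open>Right-continuity at \<open>x\<close>: the superlevel sets at
    \<open>x + 1 / (n + 1)\<close> exhaust the one at \<open>x\<close>.\<close>
  have "distribution \<gamma> f x \<le> liminf (\<lambda>n. distribution \<gamma> f (x + 1 / real (Suc n)))"
    unfolding distribution_eq distr_fun_def
  proof (rule emeasure_le_liminf)
    have lim: "(\<lambda>n. x + 1 / real (Suc n)) \<longlonglongrightarrow> x"
      using tendsto_add[OF tendsto_const[of x] LIMSEQ_Suc[OF lim_1_over_n]] by simp
    show "AE t in L. t \<in> {t \<in> space L. x < \<bar>L0_rep f t\<bar>} \<longrightarrow>
        (\<forall>\<^sub>F n in sequentially. t \<in> {t \<in> space L. x + 1 / real (Suc n) < \<bar>L0_rep f t\<bar>})"
      by (auto intro!: AE_I2 dest: order_tendstoD(2)[OF lim])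
  qed measurable
  then have "eventually (\<lambda>n. ennreal t < distribution \<gamma> f (x + 1 / real (Suc n))) sequentially"
    using less by (intro less_LiminfD) auto
  then obtain n where n: "ennreal t < distribution \<gamma> f (x + 1 / real (Suc n))"
    by (auto simp: eventually_sequentially)
  have "ennreal (x + 1 / real (Suc n)) \<le> rearrangement \<gamma> f t"
    unfolding rearrangement_def
  proof (rule Inf_greatest, safe)
    fix l :: real assume l: "0 < l" "distribution \<gamma> f l \<le> ennreal t"
    show "ennreal (x + 1 / real (Suc n)) \<le> ennreal l"
    proof (rule ccontr)
      assume "\<not> ennreal (x + 1 / real (Suc n)) \<le> ennreal l"
      then have "l \<le> x + 1 / real (Suc n)"
        by (metis ennreal_leI linear)
      then have "distribution \<gamma> f (x + 1 / real (Suc n)) \<le> distribution \<gamma> f l"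
        unfolding distribution_eq by (intro antimonoD[OF antimono_distr_fun]) auto
      then show False
        using l n by simp
    qed
  qed
  moreover have "ennreal x < ennreal (x + 1 / real (Suc n))"
    using assms by (simp add: ennreal_less_iff)
  ultimately show "ennreal x < rearrangement \<gamma> f t"
    by simp
qed

text \<open>Every level \<open>l\<close> is a value \<open>\<phi> x\<close>, and
  \<open>\<phi>\<close> is strictly increasing, so the question reduces to the level
  \<open>x\<close> of \<open>f\<close> itself.\<close>

lemma less_extend_infinity_iff:
  assumes "0 \<le> l"
  shows "ennreal l < extend_infinity \<phi> (rearrangement \<gamma> f t) \<longleftrightarrow>
    ennreal t < distr_fun L (\<lambda>t. \<phi> \<bar>L0_rep f t\<bar>) l"
proof -
  obtain x where x: "0 \<le> x" "\<phi> x = l"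
    using assms by (rule \<phi>_surj)
  have "ennreal l < extend_infinity \<phi> u \<longleftrightarrow> ennreal x < u" for u
    using x by (cases u) (auto simp: extend_infinity_def ennreal_less_iff \<phi>_nonneg \<phi>_less_iff)
  moreover have "distr_fun L (\<lambda>t. \<phi> \<bar>L0_rep f t\<bar>) l = distribution \<gamma> f x"
    using x by (simp add: distribution_eq distr_fun_def \<phi>_less_iff flip: x(2))
  ultimately show ?thesis
    using x by (simp add: less_rearrangement_iff)
qed

text \<open>Layer cake formula under the measure with density \<open>w\<close>: by
  \<open>less_extend_infinity_iff\<close> each superlevel set of \<open>?F\<close> is an initial
  segment whose length is a value of the distribution function of
  \<open>\<phi> \<bar>f\<bar>\<close>, and its mass is the value of \<open>W\<close> there.
  Rearrangements do not occur after this.\<close>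

lemma modular_eq: "modular \<gamma> \<phi> w f = lorentz (\<lambda>t. \<phi> \<bar>L0_rep f t\<bar>)"
proof -
  let ?F = "\<lambda>t. extend_infinity \<phi> (rearrangement \<gamma> f t)"
  let ?M = "density L (\<lambda>t. ennreal (w t))"
  have [measurable]: "?F \<in> borel_measurable L"
  proof (rule borel_measurableI_greater)
    fix y
    show "{t \<in> space L. y < ?F t} \<in> sets L"
      by (cases y) (auto simp: less_extend_infinity_iff)
  qed
  have "modular \<gamma> \<phi> w f = (\<integral>\<^sup>+t. ?F t * ennreal (w t) * indicator J t \<partial>lebesgue)"
    unfolding modular_def
  proof (rule nn_integral_cong_AE)
    have "AE t in lebesgue. t \<noteq> (0::real)"
      by (intro AE_completion AE_lborel_singleton)
    then show "AE t in lebesgue. ?F t * ennreal (w t) * indicator (half_open_interval \<gamma>) t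
        = ?F t * ennreal (w t) * indicator J t"
      by eventually_elim (auto simp: J_def half_open_interval_def indicator_def)
  qed
  also have "\<dots> = (\<integral>\<^sup>+t. ?F t * ennreal (w t) \<partial>L)"
    by (subst nn_integral_restrict_space) auto
  also have "\<dots> = (\<integral>\<^sup>+t. ?F t \<partial>?M)"
    by (subst nn_integral_density) (auto intro!: nn_integral_cong simp: mult.commute)
  also have "\<dots> = (\<integral>\<^sup>+l\<in>{0..}. emeasure ?M {t \<in> space ?M. ennreal l < ?F t} \<partial>lborel)"
  proof (rule nn_integral_layer_cake)
    show "sigma_finite_measure ?M"
      by (subst sigma_finite_measure.sigma_finite_iff_density_finite[OF sigma_finite_L]) auto
  qed auto
  also have "\<dots> = lorentz (\<lambda>t. \<phi> \<bar>L0_rep f t\<bar>)"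
    unfolding lorentz_def
    by (intro nn_integral_cong) (auto simp: indicator_def W_eq_emeasure less_extend_infinity_iff)
  finally show ?thesis .
qed

section \<open>Order, convexity and convergence properties of the modular\<close>

abbreviation \<rho> :: "L0 \<Rightarrow> ennreal" where
  "\<rho> \<equiv> modular \<gamma> \<phi> w"

lemma modular_mono:
  assumes "\<bar>f\<bar> \<le> \<bar>g\<bar>"
  shows "\<rho> f \<le> \<rho> g"
  unfolding modular_eq
proof (rule lorentz_mono_AE)
  show "AE x in L. \<phi> \<bar>L0_rep f x\<bar> \<le> \<phi> \<bar>L0_rep g x\<bar>"
    using assms unfolding L0_abs_le_iff by (intro AE_L) (auto elim!: eventually_mono intro: \<phi>_mono)
qed measurable

lemma lorentz_zero: "lorentz (\<lambda>_. 0) = 0"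
proof -
  have "W 0 = 0"
    by (simp add: W_def)
  then have "W (distr_fun L (\<lambda>_. 0) l) * indicator {0..} l = 0" for l
    by (cases "0 \<le> l") (auto simp: distr_fun_def)
  then show ?thesis
    by (simp only: lorentz_def) simp
qed

lemma modular_zero: "\<rho> 0 = 0"
proof -
  have "\<rho> 0 \<le> lorentz (\<lambda>_. 0)"
    unfolding modular_eq
  proof (rule lorentz_mono_AE)
    show "AE x in L. \<phi> \<bar>L0_rep 0 x\<bar> \<le> 0"
      using AE_L[OF AE_L0_rep_zero] by eventually_elim simp
  qed measurable
  then show ?thesis
    by (simp add: lorentz_zero)
qed

lemma modular_convex:
  assumes "0 < a" "0 < b" "a + b = 1"
  shows "\<rho> (a *\<^sub>R f + b *\<^sub>R g) \<le> ennreal a * \<rho> f + ennreal b * \<rho> g"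
proof -
  let ?F = "\<lambda>t. \<phi> \<bar>L0_rep f t\<bar>" and ?G = "\<lambda>t. \<phi> \<bar>L0_rep g t\<bar>"
  have "\<rho> (a *\<^sub>R f + b *\<^sub>R g) \<le> lorentz (\<lambda>t. a * ?F t + b * ?G t)"
    unfolding modular_eq
  proof (rule lorentz_mono_AE)
    show "AE t in L. \<phi> \<bar>L0_rep (a *\<^sub>R f + b *\<^sub>R g) t\<bar> \<le> a * ?F t + b * ?G t"
      using AE_L[OF AE_L0_rep_plus[of "a *\<^sub>R f" "b *\<^sub>R g"]] AE_L[OF AE_L0_rep_scaleR[of a f]]
        AE_L[OF AE_L0_rep_scaleR[of b g]]
    proof eventually_elim
      fix t
      assume eq: "L0_rep (a *\<^sub>R f + b *\<^sub>R g) t = L0_rep (a *\<^sub>R f) t + L0_rep (b *\<^sub>R g) t"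
        "L0_rep (a *\<^sub>R f) t = a * L0_rep f t" "L0_rep (b *\<^sub>R g) t = b * L0_rep g t"
      have "\<bar>a * L0_rep f t + b * L0_rep g t\<bar> \<le> a * \<bar>L0_rep f t\<bar> + b * \<bar>L0_rep g t\<bar>"
        using assms abs_triangle_ineq[of "a * L0_rep f t" "b * L0_rep g t"] by (simp add: abs_mult)
      then have "\<phi> \<bar>a * L0_rep f t + b * L0_rep g t\<bar> \<le> \<phi> (a * \<bar>L0_rep f t\<bar> + b * \<bar>L0_rep g t\<bar>)"
        by (intro \<phi>_mono) auto
      also have "\<dots> \<le> a * ?F t + b * ?G t"
        using assms by (intro \<phi>_convex) auto
      finally show "\<phi> \<bar>L0_rep (a *\<^sub>R f + b *\<^sub>R g) t\<bar> \<le> a * ?F t + b * ?G t"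
        by (simp add: eq)
    qed
  qed measurable
  also have "\<dots> \<le> lorentz (\<lambda>t. a * ?F t) + lorentz (\<lambda>t. b * ?G t)"
    by (rule lorentz_add) measurable
  also have "\<dots> = ennreal a * \<rho> f + ennreal b * \<rho> g"
    using assms by (simp add: lorentz_cmult modular_eq)
  finally show ?thesis .
qed

lemma modular_disjoint:
  assumes "\<bar>f + g\<bar> = \<bar>f - g\<bar>"
  shows "\<rho> (f + g) \<le> \<rho> f + \<rho> g"
proof -
  have "\<rho> (f + g) \<le> lorentz (\<lambda>t. \<phi> \<bar>L0_rep f t\<bar> + \<phi> \<bar>L0_rep g t\<bar>)"
    unfolding modular_eq
  proof (rule lorentz_mono_AE)
    have "AE t in L. L0_rep \<bar>f + g\<bar> t = L0_rep \<bar>f - g\<bar> t"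
      using assms by simp
    then show "AE t in L. \<phi> \<bar>L0_rep (f + g) t\<bar> \<le> \<phi> \<bar>L0_rep f t\<bar> + \<phi> \<bar>L0_rep g t\<bar>"
      using AE_L[OF AE_L0_rep_plus[of f g]] AE_L[OF AE_L0_rep_minus[of f g]]
        AE_L[OF AE_L0_rep_abs[of "f + g"]] AE_L[OF AE_L0_rep_abs[of "f - g"]]
    proof eventually_elim
      fix t
      assume eq: "L0_rep \<bar>f + g\<bar> t = L0_rep \<bar>f - g\<bar> t" "L0_rep (f + g) t = L0_rep f t + L0_rep g t"
        "L0_rep (f - g) t = L0_rep f t - L0_rep g t" "L0_rep \<bar>f + g\<bar> t = \<bar>L0_rep (f + g) t\<bar>"
        "L0_rep \<bar>f - g\<bar> t = \<bar>L0_rep (f - g) t\<bar>"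
      \<comment> \<open>For real numbers, \<open>\<bar>x + y\<bar> = \<bar>x - y\<bar>\<close>
        forces \<open>x * y = 0\<close>; since \<open>\<phi> 0 = 0\<close>, the claim is then an
        equality.\<close>
      then have "L0_rep f t = 0 \<or> L0_rep g t = 0"
        by auto
      then show "\<phi> \<bar>L0_rep (f + g) t\<bar> \<le> \<phi> \<bar>L0_rep f t\<bar> + \<phi> \<bar>L0_rep g t\<bar>"
        using eq(2) by auto
    qed
  qed measurable
  also have "\<dots> \<le> \<rho> f + \<rho> g"
    unfolding modular_eq by (rule lorentz_add) measurable
  finally show ?thesis .
qed

lemma modular_Fatou:
  assumes "ae_tendsto_zero (\<lambda>n. f n - g)" "\<And>n. \<rho> (f n) \<le> c"
  shows "\<rho> g \<le> c"
proof -
  have "\<rho> g \<le> liminf (\<lambda>n. \<rho> (f n))"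
    unfolding modular_eq
  proof (rule lorentz_Fatou)
    have "AE t in lebesgue. (\<lambda>n. L0_rep (f n - g) t) \<longlonglongrightarrow> 0"
      using assms(1) by (simp add: ae_tendsto_zero_iff)
    moreover have "AE t in lebesgue. \<forall>n. L0_rep (f n - g) t = L0_rep (f n) t - L0_rep g t"
      unfolding AE_all_countable by (intro allI AE_L0_rep_minus)
    ultimately have "AE t in lebesgue. (\<lambda>n. \<phi> \<bar>L0_rep (f n) t\<bar>) \<longlonglongrightarrow> \<phi> \<bar>L0_rep g t\<bar>"
    proof eventually_elim
      fix t
      assume "(\<lambda>n. L0_rep (f n - g) t) \<longlonglongrightarrow> 0" "\<forall>n. L0_rep (f n - g) t = L0_rep (f n) t - L0_rep g t"
      then have "(\<lambda>n. L0_rep (f n) t) \<longlonglongrightarrow> L0_rep g t"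
        by (simp add: LIM_zero_iff)
      then show "(\<lambda>n. \<phi> \<bar>L0_rep (f n) t\<bar>) \<longlonglongrightarrow> \<phi> \<bar>L0_rep g t\<bar>"
        by (rule continuous_on_tendsto_compose[OF continuous_\<phi>_abs]) auto
    qed
    then show "AE t in L. (\<lambda>n. \<phi> \<bar>L0_rep (f n) t\<bar>) \<longlonglongrightarrow> \<phi> \<bar>L0_rep g t\<bar>"
      by (rule AE_L)
  qed measurable
  also have "\<dots> \<le> liminf (\<lambda>n::nat. c)"
    by (intro Liminf_mono always_eventually allI assms)
  finally show ?thesis
    by (simp add: Liminf_const)
qed

lemma modular_dominated:
  assumes "\<rho> f < \<infinity>" "\<And>n. \<bar>g n\<bar> \<le> \<bar>f\<bar>" "ae_tendsto_zero g"
  shows "(\<lambda>n. \<rho> (g n)) \<longlonglongrightarrow> 0"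
  unfolding modular_eq
proof (rule lorentz_dominated)
  show "lorentz (\<lambda>t. \<phi> \<bar>L0_rep f t\<bar>) < \<infinity>"
    using assms(1) by (simp add: modular_eq)
  show "AE t in L. \<phi> \<bar>L0_rep (g n) t\<bar> \<le> \<phi> \<bar>L0_rep f t\<bar>" for n
    using assms(2)[of n] unfolding L0_abs_le_iff by (intro AE_L) (auto elim!: eventually_mono intro: \<phi>_mono)
  have "AE t in lebesgue. (\<lambda>n. \<phi> \<bar>L0_rep (g n) t\<bar>) \<longlonglongrightarrow> \<phi> \<bar>0\<bar>"
    using assms(3) unfolding ae_tendsto_zero_iff
    by eventually_elim (rule continuous_on_tendsto_compose[OF continuous_\<phi>_abs], auto)
  then show "AE t in L. (\<lambda>n. \<phi> \<bar>L0_rep (g n) t\<bar>) \<longlonglongrightarrow> 0"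
    by (intro AE_L) simp
qed measurable

text \<open>The truncation is bounded by \<open>n + 1\<close> and lives where
  \<open>\<bar>f\<bar> \<ge> 1 / (n + 1)\<close>, a set of finite measure because a positive
  multiple of \<open>f\<close> has finite modular. Hence the factor \<open>k\<close> may be
  arbitrarily large.\<close>

lemma modular_truncation:
  assumes "0 < c" "\<rho> (c *\<^sub>R f) < \<infinity>"
  shows "\<rho> (k *\<^sub>R (f - tail n f f)) < \<infinity>"
proof -
  let ?g = "k *\<^sub>R (f - tail n f f)"
  have g: "AE t in L. L0_rep ?g t = (if L0_rep f t \<in> tail_set n then 0 else k * L0_rep f t)"
    using AE_L[OF AE_L0_rep_scaleR[of k "f - tail n f f"]] AE_L[OF AE_L0_rep_minus[of f "tail n f f"]]
      AE_L[OF AE_L0_rep_tail[of n f f]]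
    by eventually_elim auto
  show ?thesis
    unfolding modular_eq
  proof (rule lorentz_finite)
    show "AE t in L. \<phi> \<bar>L0_rep ?g t\<bar> \<le> \<phi> (\<bar>k\<bar> * real (Suc n))"
      using g
    proof eventually_elim
      fix t
      assume eq: "L0_rep ?g t = (if L0_rep f t \<in> tail_set n then 0 else k * L0_rep f t)"
      have "\<bar>L0_rep ?g t\<bar> \<le> \<bar>k\<bar> * real (Suc n)"
        unfolding eq by (auto simp: tail_set_def abs_mult intro!: mult_left_mono)
      then show "\<phi> \<bar>L0_rep ?g t\<bar> \<le> \<phi> (\<bar>k\<bar> * real (Suc n))"
        by (intro \<phi>_mono) auto
    qed
    show "0 \<le> \<phi> (\<bar>k\<bar> * real (Suc n))"
      by (intro \<phi>_nonneg) auto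
    \<comment> \<open>\<open>n + 2\<close> instead of \<open>n + 1\<close>: the distribution
      function asks for a strict inequality, while \<open>\<bar>f\<bar>\<close> may equal
      \<open>1 / (n + 1)\<close> on the support.\<close>
    let ?l = "\<phi> (c / real (Suc (Suc n)))"
    have "distr_fun L (\<lambda>t. \<phi> \<bar>L0_rep ?g t\<bar>) 0 \<le> distr_fun L (\<lambda>t. \<phi> \<bar>L0_rep (c *\<^sub>R f) t\<bar>) ?l"
      unfolding distr_fun_def
    proof (rule emeasure_mono_AE)
      show "AE t in L. t \<in> {t \<in> space L. 0 < \<phi> \<bar>L0_rep ?g t\<bar>} \<longrightarrow> t \<in> {t \<in> space L. ?l < \<phi> \<bar>L0_rep (c *\<^sub>R f) t\<bar>}"
        using g AE_L[OF AE_L0_rep_scaleR[of c f]]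
      proof eventually_elim
        fix t
        assume eq: "L0_rep ?g t = (if L0_rep f t \<in> tail_set n then 0 else k * L0_rep f t)"
          "L0_rep (c *\<^sub>R f) t = c * L0_rep f t"
        show "t \<in> {t \<in> space L. 0 < \<phi> \<bar>L0_rep ?g t\<bar>} \<longrightarrow> t \<in> {t \<in> space L. ?l < \<phi> \<bar>L0_rep (c *\<^sub>R f) t\<bar>}"
        proof
          assume t: "t \<in> {t \<in> space L. 0 < \<phi> \<bar>L0_rep ?g t\<bar>}"
          have "1 / real (Suc (Suc n)) < 1 / real (Suc n)"
            by (intro divide_strict_left_mono) auto
          also have "\<dots> \<le> \<bar>L0_rep f t\<bar>"
            using t eq by (auto simp: tail_set_def not_less simp del: of_nat_Suc split: if_splits)
          finally have "c * (1 / real (Suc (Suc n))) < c * \<bar>L0_rep f t\<bar>"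
            using assms(1) by (rule mult_strict_left_mono)
          then have "c / real (Suc (Suc n)) < \<bar>L0_rep (c *\<^sub>R f) t\<bar>"
            using assms(1) eq by (simp add: abs_mult del: of_nat_Suc)
          then show "t \<in> {t \<in> space L. ?l < \<phi> \<bar>L0_rep (c *\<^sub>R f) t\<bar>}"
            using t assms(1) by (simp add: \<phi>_strict_mono del: of_nat_Suc)
        qed
      qed
    qed measurable
    also have "\<dots> < \<infinity>"
      using assms by (intro distr_fun_finite) (auto simp: modular_eq \<phi>_pos)
    finally show "distr_fun L (\<lambda>t. \<phi> \<bar>L0_rep ?g t\<bar>) 0 < \<infinity>" .
  qed measurable
qed

lemma AE_lebesgueI:
  assumes "AE t in L. P t" "AE t in lebesgue. t \<notin> half_open_interval \<gamma> \<longrightarrow> P t"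
  shows "AE t in lebesgue. P t"
proof -
  have "AE t in lebesgue. t \<in> J \<longrightarrow> P t"
    using assms(1) by (simp add: AE_restrict_space_iff)
  moreover have "AE t in lebesgue. t \<noteq> (0::real)"
    by (intro AE_completion AE_lborel_singleton)
  ultimately show ?thesis
    using assms(2) by eventually_elim (auto simp: J_def half_open_interval_def)
qed

lemma modular_eq_0D:
  assumes "ae_vanishes_outside (half_open_interval \<gamma>) f" "\<rho> f = 0"
  shows "f = 0"
proof -
  have distr: "distr_fun L (\<lambda>t. \<phi> \<bar>L0_rep f t\<bar>) l = 0" if "0 < l" for l
  proof (rule W_eq_0D)
    have "ennreal l * W (distr_fun L (\<lambda>t. \<phi> \<bar>L0_rep f t\<bar>) l) \<le> 0"
      using lorentz_Chebyshev[of "\<lambda>t. \<phi> \<bar>L0_rep f t\<bar>" l] that assms(2) by (simp add: modular_eq)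
    then show "W (distr_fun L (\<lambda>t. \<phi> \<bar>L0_rep f t\<bar>) l) = 0"
      using that by simp
  qed (rule distr_fun_le)
  have "AE t in L. \<forall>n. \<not> 1 / real (Suc n) < \<phi> \<bar>L0_rep f t\<bar>"
    unfolding AE_all_countable
  proof
    fix n
    show "AE t in L. \<not> 1 / real (Suc n) < \<phi> \<bar>L0_rep f t\<bar>"
      using distr[of "1 / real (Suc n)"] unfolding distr_fun_def
      by (subst AE_iff_measurable[OF _ refl]) (auto simp del: of_nat_Suc)
  qed
  then have "AE t in L. L0_rep f t = 0"
  proof eventually_elim
    fix t
    assume *: "\<forall>n. \<not> 1 / real (Suc n) < \<phi> \<bar>L0_rep f t\<bar>"
    show "L0_rep f t = 0"
    proof (rule ccontr)
      assume "L0_rep f t \<noteq> 0"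
      then obtain n where "inverse (real (Suc n)) < \<phi> \<bar>L0_rep f t\<bar>"
        using reals_Archimedean[of "\<phi> \<bar>L0_rep f t\<bar>"] \<phi>_pos by auto
      then show False
        using * by (simp add: inverse_eq_divide)
    qed
  qed
  then have "AE t in lebesgue. L0_rep f t = 0"
    by (rule AE_lebesgueI) (use assms(1) in \<open>simp add: ae_vanishes_outside_iff\<close>)
  then show ?thesis
    unfolding L0_eq_iff using AE_L0_rep_zero by eventually_elim simp
qed

text \<open>\<open>E l\<close> is the set where some \<open>h n\<close> exceeds \<open>l\<close>.
  Lower semicontinuity of \<open>W\<close> and Chebyshev bound its \<open>W\<close>-mass by
  \<open>1 / l\<close>, so the set \<open>N\<close>, where the \<open>h n\<close> are unbounded, has
  mass 0 and is null. The bound is what produces a limit function in the proof of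
  completeness.\<close>

lemma modular_incseq_bounded:
  assumes "incseq s" "\<And>n. 0 \<le> s n" "\<And>n. \<rho> (s n) \<le> 1"
    and van: "\<And>n. ae_vanishes_outside (half_open_interval \<gamma>) (s n)"
  shows "\<exists>u. \<forall>n. s n \<le> u"
proof -
  define h where "h = (\<lambda>n t. \<phi> \<bar>L0_rep (s n) t\<bar>)"
  have [measurable]: "h n \<in> borel_measurable L" for n
    unfolding h_def by measurable
  define E where "E l = (\<Union>n. {t \<in> J. l < h n t})" for l
  have sets: "{t \<in> J. l < h n t} \<in> sets L" for l n
    using \<open>h n \<in> borel_measurable L\<close> by (simp add: borel_measurable_iff_greater)
  have mono: "AE t in lebesgue. \<forall>n. L0_rep (s n) t \<le> L0_rep (s (Suc n)) t \<and> 0 \<le> L0_rep (s n) t"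
    unfolding AE_all_countable
  proof
    fix n
    have "s n \<le> s (Suc n)"
      using assms(1) by (simp add: incseq_Suc_iff)
    then show "AE t in lebesgue. L0_rep (s n) t \<le> L0_rep (s (Suc n)) t \<and> 0 \<le> L0_rep (s n) t"
      using assms(2)[of n] AE_L0_rep_zero unfolding L0_le_iff by eventually_elim auto
  qed
  have W_E: "ennreal l * W (emeasure L (E l)) \<le> 1" if "0 < l" for l
  proof -
    have "emeasure L (E l) \<le> liminf (\<lambda>n. emeasure L {t \<in> J. l < h n t})"
    proof (rule emeasure_le_liminf)
      show "E l \<in> sets L"
        unfolding E_def using sets by auto
      show "AE t in L. t \<in> E l \<longrightarrow> (\<forall>\<^sub>F n in sequentially. t \<in> {t \<in> J. l < h n t})"
        using AE_L[OF mono]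
      proof eventually_elim
        fix t
        assume *: "\<forall>n. L0_rep (s n) t \<le> L0_rep (s (Suc n)) t \<and> 0 \<le> L0_rep (s n) t"
        then have "incseq (\<lambda>n. L0_rep (s n) t)"
          by (simp add: incseq_Suc_iff)
        then have "h m t \<le> h n t" if "m \<le> n" for m n
          using * that unfolding h_def by (intro \<phi>_mono) (auto dest: incseqD)
        then show "t \<in> E l \<longrightarrow> (\<forall>\<^sub>F n in sequentially. t \<in> {t \<in> J. l < h n t})"
          unfolding E_def eventually_sequentially by (auto intro: less_le_trans)
      qed
    qed (rule sets)
    then have "W (emeasure L (E l)) \<le> liminf (\<lambda>n. W (emeasure L {t \<in> J. l < h n t}))"
      by (rule W_liminf)
    also have "\<dots> \<le> liminf (\<lambda>n::nat. ennreal (1 / l))"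
    proof (intro Liminf_mono always_eventually allI)
      fix n
      have "ennreal l * W (emeasure L {t \<in> J. l < h n t}) \<le> 1"
        using lorentz_Chebyshev[of "h n" l] that assms(3)[of n]
        by (simp add: modular_eq h_def distr_fun_def)
      then show "W (emeasure L {t \<in> J. l < h n t}) \<le> ennreal (1 / l)"
        using that by (simp add: ennreal_mult_le_1_iff)
    qed
    finally show ?thesis
      using that by (simp add: ennreal_mult_le_1_iff Liminf_const)
  qed
  define N where "N = (\<Inter>k. E (real (Suc k)))"
  have N_sets: "N \<in> sets L"
    unfolding N_def E_def using sets by (intro sets.countable_INT) auto
  have "W (emeasure L N) = 0"
  proof (rule ccontr)
    assume pos: "W (emeasure L N) \<noteq> 0"
    have le: "ennreal (real (Suc k)) * W (emeasure L N) \<le> 1" for k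
    proof -
      have "emeasure L N \<le> emeasure L (E (real (Suc k)))"
        unfolding N_def E_def using sets by (intro emeasure_mono) auto
      then have "ennreal (real (Suc k)) * W (emeasure L N) \<le> ennreal (real (Suc k)) * W (emeasure L (E (real (Suc k))))"
        by (intro mult_left_mono mono_W) auto
      also have "\<dots> \<le> 1"
        by (rule W_E) simp
      finally show ?thesis .
    qed
    then obtain r where r: "W (emeasure L N) = ennreal r" "0 < r"
      using pos le[of 0] by (cases "W (emeasure L N)") (auto simp: top_unique)
    obtain k where "1 / r < real (Suc k)"
      using reals_Archimedean2[of "1 / r"] by (metis less_trans of_nat_Suc less_add_one add.commute)
    then show False
      using le[of k] r by (simp add: ennreal_mult[symmetric] field_simps del: of_nat_Suc)
  qed
  moreover have "N \<subseteq> J"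
    by (auto simp: N_def E_def)
  then have "emeasure L N \<le> emeasure L J"
    by (rule emeasure_mono) simp
  ultimately have "emeasure L N = 0"
    by (rule W_eq_0D)
  then have "AE t in L. t \<notin> N"
    using N_sets by (intro AE_not_in) auto
  then have "AE t in L. bdd_above (range (\<lambda>n. L0_rep (s n) t))"
    using AE_space
  proof eventually_elim
    fix t assume t: "t \<notin> N" "t \<in> space L"
    then obtain k where k: "\<And>n. h n t \<le> real (Suc k)"
      by (auto simp: N_def E_def not_less)
    obtain x where x: "0 \<le> x" "\<phi> x = real (Suc k)"
      by (rule \<phi>_surj[of "real (Suc k)"]) auto
    have "\<bar>L0_rep (s n) t\<bar> \<le> x" for n
      using k[of n] x \<phi>_less_iff[of x "\<bar>L0_rep (s n) t\<bar>"] by (auto simp: h_def not_less[symmetric])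
    then show "bdd_above (range (\<lambda>n. L0_rep (s n) t))"
      by (intro bdd_aboveI[of _ x]) (auto simp: abs_le_iff)
  qed
  then have bdd: "AE t in lebesgue. bdd_above (range (\<lambda>n. L0_rep (s n) t))"
  proof (rule AE_lebesgueI)
    have "AE t in lebesgue. \<forall>n. t \<notin> half_open_interval \<gamma> \<longrightarrow> L0_rep (s n) t = 0"
      unfolding AE_all_countable using van by (auto simp: ae_vanishes_outside_iff)
    then show "AE t in lebesgue. t \<notin> half_open_interval \<gamma> \<longrightarrow> bdd_above (range (\<lambda>n. L0_rep (s n) t))"
      by eventually_elim auto
  qed
  \<comment> \<open>Where the supremum is infinite, \<open>real_of_ereal\<close> returns 0; by
    \<open>bdd\<close> this concerns only a null set.\<close>
  define S where "S t = real_of_ereal (SUP n. ereal (L0_rep (s n) t))" for t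
  have S_meas: "S \<in> borel_measurable lebesgue"
    unfolding S_def by measurable
  have "s n \<le> L0_class S" for n
    unfolding L0_le_iff using bdd AE_L0_rep_class[OF S_meas]
  proof eventually_elim
    fix t
    assume "bdd_above (range (\<lambda>n. L0_rep (s n) t))" and eq: "L0_rep (L0_class S) t = S t"
    then obtain b where b: "\<And>n. L0_rep (s n) t \<le> b"
      by (auto simp: bdd_above_def)
    have "ereal (L0_rep (s n) t) \<le> (SUP n. ereal (L0_rep (s n) t))"
      by (rule SUP_upper) simp
    moreover have "(SUP n. ereal (L0_rep (s n) t)) \<le> ereal b"
      using b by (intro SUP_least) simp
    ultimately show "L0_rep (s n) t \<le> L0_rep (L0_class S) t"
      unfolding eq S_def by (cases "SUP n. ereal (L0_rep (s n) t)") auto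
  qed
  then show ?thesis
    by blast
qed

end

section \<open>Order structure on classes of measurable functions\<close>

instance L0 :: ordered_real_vector
proof
  fix a b c :: L0
  show "a \<le> b \<Longrightarrow> c + a \<le> c + b"
    by transfer (auto elim: eventually_mono)
  fix x y :: real
  show "a \<le> b \<Longrightarrow> 0 \<le> x \<Longrightarrow> x *\<^sub>R a \<le> x *\<^sub>R b"
    by transfer (auto elim: eventually_mono intro: mult_left_mono)
  show "x \<le> y \<Longrightarrow> 0 \<le> a \<Longrightarrow> x *\<^sub>R a \<le> y *\<^sub>R a"
    by transfer (auto elim: eventually_mono intro: mult_right_mono)
qed

instance L0 :: ordered_ab_group_add_abs
proof
  fix a b :: L0
  show "0 \<le> \<bar>a\<bar>" "a \<le> \<bar>a\<bar>" "\<bar>- a\<bar> = \<bar>a\<bar>" "\<bar>a + b\<bar> \<le> \<bar>a\<bar> + \<bar>b\<bar>"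
    by (transfer, auto simp: ae_equal_def)+
  show "a \<le> b \<Longrightarrow> - a \<le> b \<Longrightarrow> \<bar>a\<bar> \<le> b"
    by transfer (auto elim: eventually_elim2)
qed

section \<open>Pointwise minima and the Riesz decomposition\<close>

instantiation L0 :: inf
begin

lift_definition inf_L0 :: "L0 \<Rightarrow> L0 \<Rightarrow> L0" is "\<lambda>f g t. min (f t) (g t)"
  by (auto simp: ae_equal_def elim: eventually_elim2)

instance ..

end

lemma L0_inf_le1: "inf f g \<le> (f :: L0)"
  by transfer simp

lemma L0_inf_le2: "inf f g \<le> (g :: L0)"
  by transfer simp

lemma L0_inf_mono: "f \<le> g \<Longrightarrow> inf f h \<le> inf g (h :: L0)"
  by transfer (auto elim: eventually_mono)

lemma L0_inf_nonneg: "0 \<le> f \<Longrightarrow> 0 \<le> g \<Longrightarrow> 0 \<le> inf f (g :: L0)"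
  by transfer (auto elim: eventually_elim2)

lemma L0_minus_inf_mono: "f \<le> g \<Longrightarrow> f - inf f h \<le> g - inf g (h :: L0)"
  by transfer (auto elim: eventually_mono)

text \<open>The remainder \<open>f - inf f g\<close> is the positive part of \<open>f - g\<close>.
  Together with \<open>L0_inf_le2\<close> this splits a function below \<open>g + h\<close> into one
  below \<open>g\<close> and one below \<open>h\<close>.\<close>

lemma L0_minus_inf_le: "f \<le> g + h \<Longrightarrow> 0 \<le> h \<Longrightarrow> f - inf f g \<le> (h :: L0)"
  by transfer (auto elim: eventually_elim2)

lemma L0_abs_scaleR: "\<bar>c *\<^sub>R f\<bar> = \<bar>c\<bar> *\<^sub>R \<bar>f :: L0\<bar>"
  by transfer (auto simp: ae_equal_def abs_mult)

text \<open>\<open>p\<close> is the positive part and \<open>p - f\<close> the negative part of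
  \<open>f\<close>, expressed through the absolute value.\<close>

lemma L0_pos_part:
  fixes f :: L0
  defines "p \<equiv> (1/2) *\<^sub>R (\<bar>f\<bar> + f)"
  shows "0 \<le> p" "p \<le> \<bar>f\<bar>" "0 \<le> p - f" "p - f \<le> \<bar>f\<bar>"
  unfolding p_def by (transfer, auto)+

section \<open>Calculus of tails\<close>

lemma tail_add: "tail n h (f + g) = tail n h f + tail n h g"
  by transfer (auto simp: ae_equal_def)

lemma tail_scaleR: "tail n h (c *\<^sub>R f) = c *\<^sub>R tail n h f"
  by transfer (auto simp: ae_equal_def)

lemma tail_diff: "tail n h (f - g) = tail n h f - tail n h g"
  by transfer (auto simp: ae_equal_def)

lemma abs_tail: "\<bar>tail n h f\<bar> = tail n h \<bar>f\<bar>"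
  by transfer (auto simp: ae_equal_def)

lemma abs_tail_le: "\<bar>tail n h f\<bar> \<le> \<bar>f\<bar>"
  by transfer auto

lemma abs_minus_tail_le: "\<bar>f - tail n h f\<bar> \<le> \<bar>f\<bar>"
  by transfer auto

lemma tail_abs_mono: "\<bar>f\<bar> \<le> \<bar>g\<bar> \<Longrightarrow> tail n h \<bar>f\<bar> \<le> tail n h \<bar>g\<bar>"
  by transfer (auto elim: eventually_mono)

text \<open>Both operations multiply by an indicator function.\<close>

lemma tail_commute: "tail n h (tail m k f) = tail m k (tail n h f)"
  by transfer (auto simp: ae_equal_def intro!: AE_I2)

lemma tail_decreasing: "m \<le> n \<Longrightarrow> 0 \<le> f \<Longrightarrow> tail n h f \<le> tail m h f"
proof -
  assume "m \<le> n" "0 \<le> f"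
  have "AE t in lebesgue. 0 \<le> L0_rep f t"
    using \<open>0 \<le> f\<close> AE_L0_rep_zero unfolding L0_le_iff by eventually_elim simp
  then show ?thesis
    unfolding L0_le_iff using AE_L0_rep_tail[of n h f] AE_L0_rep_tail[of m h f]
    by eventually_elim (use tail_set_mono[OF \<open>m \<le> n\<close>] in auto)
qed

lemma abs_minus_tail_mono:
  assumes "\<bar>f\<bar> \<le> \<bar>h\<bar>"
  shows "\<bar>f - tail n h f\<bar> \<le> \<bar>h - tail n h h\<bar>"
  using assms by transfer (auto elim: eventually_mono)

lemma tail_disjoint: "\<bar>(f - tail n h f) + tail n h g\<bar> = \<bar>(f - tail n h f) - tail n h g\<bar>"
  by transfer (auto simp: ae_equal_def)

lemma tail_diff_le:
  assumes "m \<le> n"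
  shows "\<bar>tail m h f - tail n h f\<bar> \<le> tail m h \<bar>f\<bar>"
proof -
  have "AE t in lebesgue. L0_rep \<bar>tail m h f - tail n h f\<bar> t \<le> L0_rep (tail m h \<bar>f\<bar>) t"
    using AE_L0_rep_abs[of "tail m h f - tail n h f"] AE_L0_rep_minus[of "tail m h f" "tail n h f"]
      AE_L0_rep_tail[of n h f] AE_L0_rep_tail[of m h f] AE_L0_rep_tail[of m h "\<bar>f\<bar>"] AE_L0_rep_abs[of f]
    by eventually_elim (use tail_set_mono[OF assms] in auto)
  then show ?thesis
    by (simp add: L0_le_iff)
qed

text \<open>On the tail set \<open>g\<close> is removed and \<open>k\<close> inserted; off the tail
  set \<open>k\<close> is squeezed to 0 and \<open>g\<close> remains. This is the exchange used on
  an almost maximal element in \<open>dual_tail_small_nonneg\<close>.\<close>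

lemma tail_replace_le:
  assumes "0 \<le> g" "g \<le> f" "0 \<le> k" "k \<le> tail n h f"
  shows "0 \<le> g - tail n h g + k" "g - tail n h g + k \<le> f"
proof -
  have nn: "AE t in lebesgue. 0 \<le> L0_rep g t \<and> 0 \<le> L0_rep k t"
    using assms(1,3) AE_L0_rep_zero unfolding L0_le_iff by eventually_elim simp
  have le: "AE t in lebesgue. L0_rep g t \<le> L0_rep f t \<and> L0_rep k t \<le> (if L0_rep h t \<in> tail_set n then L0_rep f t else 0)"
    using assms(2,4) AE_L0_rep_tail[of n h f] unfolding L0_le_iff by eventually_elim simp
  have eq: "AE t in lebesgue. L0_rep (g - tail n h g + k) t =
      (if L0_rep h t \<in> tail_set n then L0_rep k t else L0_rep g t + L0_rep k t)"
    using AE_L0_rep_plus[of "g - tail n h g" k] AE_L0_rep_minus[of g "tail n h g"] AE_L0_rep_tail[of n h g]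
    by eventually_elim auto
  show "0 \<le> g - tail n h g + k"
    unfolding L0_le_iff using eq nn AE_L0_rep_zero by eventually_elim auto
  show "g - tail n h g + k \<le> f"
    unfolding L0_le_iff using eq nn le by eventually_elim (auto split: if_splits)
qed

section \<open>Convergence almost everywhere\<close>

lemma ae_tendsto_zero_squeeze:
  assumes "ae_tendsto_zero f" "\<And>n. \<bar>g n\<bar> \<le> \<bar>f n\<bar>"
  shows "ae_tendsto_zero g"
proof -
  have "AE t in lebesgue. \<forall>n. \<bar>L0_rep (g n) t\<bar> \<le> \<bar>L0_rep (f n) t\<bar>"
    unfolding AE_all_countable using assms(2) by (simp add: L0_abs_le_iff)
  then have "AE t in lebesgue. (\<lambda>n. L0_rep (g n) t) \<longlonglongrightarrow> 0"
    using assms(1) unfolding ae_tendsto_zero_iff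
  proof eventually_elim
    fix t
    assume "\<forall>n. \<bar>L0_rep (g n) t\<bar> \<le> \<bar>L0_rep (f n) t\<bar>" "(\<lambda>n. L0_rep (f n) t) \<longlonglongrightarrow> 0"
    then show "(\<lambda>n. L0_rep (g n) t) \<longlonglongrightarrow> 0"
      by - (rule tendsto_0_le[where K=1 and f="\<lambda>n. L0_rep (f n) t"], auto)
  qed
  then show ?thesis
    by (simp add: ae_tendsto_zero_iff)
qed

lemma ae_tendsto_zero_tail: "ae_tendsto_zero (\<lambda>n. tail n h f)"
proof -
  have "AE t in lebesgue. \<forall>n. L0_rep (tail n h f) t = (if L0_rep h t \<in> tail_set n then L0_rep f t else 0)"
    unfolding AE_all_countable by (intro allI AE_L0_rep_tail)
  then have "AE t in lebesgue. (\<lambda>n. L0_rep (tail n h f) t) \<longlonglongrightarrow> 0"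
  proof eventually_elim
    fix t
    assume "\<forall>n. L0_rep (tail n h f) t = (if L0_rep h t \<in> tail_set n then L0_rep f t else 0)"
    then show "(\<lambda>n. L0_rep (tail n h f) t) \<longlonglongrightarrow> 0"
      by (intro tendsto_eventually eventually_mono[OF eventually_not_in_tail_set[of "L0_rep h t"]]) auto
  qed
  then show ?thesis
    by (simp add: ae_tendsto_zero_iff)
qed

lemma ae_tendsto_zero_scaleR:
  assumes "ae_tendsto_zero f"
  shows "ae_tendsto_zero (\<lambda>n. c *\<^sub>R f n)"
proof -
  have "AE t in lebesgue. \<forall>n. L0_rep (c *\<^sub>R f n) t = c * L0_rep (f n) t"
    unfolding AE_all_countable by (intro allI AE_L0_rep_scaleR)
  then have "AE t in lebesgue. (\<lambda>n. L0_rep (c *\<^sub>R f n) t) \<longlonglongrightarrow> 0"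
    using assms unfolding ae_tendsto_zero_iff by eventually_elim (simp add: tendsto_mult_right_zero)
  then show ?thesis
    by (simp add: ae_tendsto_zero_iff)
qed

lemma ae_tendsto_zero_subseq:
  assumes "ae_tendsto_zero f" "filterlim r at_top sequentially"
  shows "ae_tendsto_zero (\<lambda>n. f (r n))"
  using assms(1) unfolding ae_tendsto_zero_iff
  by eventually_elim (rule filterlim_compose[OF _ assms(2)])

lemma ae_vanishes_outside_add:
  "ae_vanishes_outside A f \<Longrightarrow> ae_vanishes_outside A g \<Longrightarrow> ae_vanishes_outside A (f + g)"
  by transfer (auto elim: eventually_elim2)

lemma ae_vanishes_outside_zero: "ae_vanishes_outside A 0"
  by transfer simp

lemma ae_vanishes_outside_scaleR: "ae_vanishes_outside A f \<Longrightarrow> ae_vanishes_outside A (c *\<^sub>R f)"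
  by transfer (auto elim: eventually_mono)

lemma ae_vanishes_outside_dominated:
  "ae_vanishes_outside A g \<Longrightarrow> \<bar>f\<bar> \<le> \<bar>g\<bar> \<Longrightarrow> ae_vanishes_outside A f"
  by transfer (auto elim: eventually_elim2)

lemma ae_vanishes_outside_limit:
  assumes "ae_tendsto_zero (\<lambda>n. f n - g)" "\<And>n. ae_vanishes_outside A (f n)"
  shows "ae_vanishes_outside A g"
proof -
  have "AE t in lebesgue. \<forall>n. t \<notin> A \<longrightarrow> L0_rep (f n) t = 0"
    unfolding AE_all_countable using assms(2) by (simp add: ae_vanishes_outside_iff)
  moreover have "AE t in lebesgue. \<forall>n. L0_rep (f n - g) t = L0_rep (f n) t - L0_rep g t"
    unfolding AE_all_countable by (intro allI AE_L0_rep_minus)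
  ultimately show ?thesis
    using assms(1) unfolding ae_tendsto_zero_iff ae_vanishes_outside_iff
  proof eventually_elim
    fix t
    assume *: "\<forall>n. t \<notin> A \<longrightarrow> L0_rep (f n) t = 0" "\<forall>n. L0_rep (f n - g) t = L0_rep (f n) t - L0_rep g t"
      "(\<lambda>n. L0_rep (f n - g) t) \<longlonglongrightarrow> 0"
    show "t \<notin> A \<longrightarrow> L0_rep g t = 0"
      using * by (auto simp: LIMSEQ_const_iff)
  qed
qed

text \<open>The representative of \<open>u\<close> has real values, so at almost every point it
  bounds the partial sums and the series converges absolutely.\<close>

lemma L0_abs_summable:
  assumes "\<And>n. (\<Sum>k<n. \<bar>d k\<bar>) \<le> u"
  shows "\<exists>v. ae_tendsto_zero (\<lambda>n. (\<Sum>k<n. d k) - v)"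
proof -
  have rep_sum: "AE t in lebesgue. L0_rep (\<Sum>k<n. e k) t = (\<Sum>k<n. L0_rep (e k) t)" for n and e :: "nat \<Rightarrow> L0"
  proof (induction n)
    case 0
    then show ?case
      using AE_L0_rep_zero by simp
  next
    case (Suc n)
    then show ?case
      using AE_L0_rep_plus[of "\<Sum>k<n. e k" "e n"] by eventually_elim simp
  qed
  define v where "v t = (\<Sum>k. L0_rep (d k) t)" for t
  have v: "v \<in> borel_measurable lebesgue"
    unfolding v_def by measurable
  have sums: "AE t in lebesgue. \<forall>n. L0_rep (\<Sum>k<n. d k) t = (\<Sum>k<n. L0_rep (d k) t)"
    unfolding AE_all_countable by (intro allI rep_sum)
  have abs: "AE t in lebesgue. \<forall>n. L0_rep (\<Sum>k<n. \<bar>d k\<bar>) t = (\<Sum>k<n. L0_rep \<bar>d k\<bar> t)"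
    unfolding AE_all_countable by (intro allI rep_sum)
  have abs': "AE t in lebesgue. \<forall>n. L0_rep \<bar>d n\<bar> t = \<bar>L0_rep (d n) t\<bar>"
    unfolding AE_all_countable by (intro allI AE_L0_rep_abs)
  have le: "AE t in lebesgue. \<forall>n. L0_rep (\<Sum>k<n. \<bar>d k\<bar>) t \<le> L0_rep u t"
    unfolding AE_all_countable using assms by (simp add: L0_le_iff)
  have diff: "AE t in lebesgue. \<forall>n. L0_rep ((\<Sum>k<n. d k) - L0_class v) t = L0_rep (\<Sum>k<n. d k) t - L0_rep (L0_class v) t"
    unfolding AE_all_countable by (intro allI AE_L0_rep_minus)
  have "ae_tendsto_zero (\<lambda>n. (\<Sum>k<n. d k) - L0_class v)"
    unfolding ae_tendsto_zero_iff
    using sums abs abs' le diff AE_L0_rep_class[OF v]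
  proof eventually_elim
    fix t
    assume *: "\<forall>n. L0_rep (\<Sum>k<n. d k) t = (\<Sum>k<n. L0_rep (d k) t)"
      "\<forall>n. L0_rep (\<Sum>k<n. \<bar>d k\<bar>) t = (\<Sum>k<n. L0_rep \<bar>d k\<bar> t)"
      "\<forall>n. L0_rep \<bar>d n\<bar> t = \<bar>L0_rep (d n) t\<bar>"
      "\<forall>n. L0_rep (\<Sum>k<n. \<bar>d k\<bar>) t \<le> L0_rep u t"
      "\<forall>n. L0_rep ((\<Sum>k<n. d k) - L0_class v) t = L0_rep (\<Sum>k<n. d k) t - L0_rep (L0_class v) t"
      "L0_rep (L0_class v) t = v t"
    have le: "(\<Sum>k<n. \<bar>L0_rep (d k) t\<bar>) \<le> L0_rep u t" for n
      using * by simp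
    have "summable (\<lambda>k. \<bar>L0_rep (d k) t\<bar>)"
    proof (rule bounded_imp_summable)
      show "(\<Sum>k\<le>n. \<bar>L0_rep (d k) t\<bar>) \<le> L0_rep u t" for n
        using le[of "Suc n"] by (simp only: lessThan_Suc_atMost)
    qed simp
    then have "summable (\<lambda>k. L0_rep (d k) t)"
      by (rule summable_rabs_cancel)
    then have "(\<lambda>n. \<Sum>k<n. L0_rep (d k) t) \<longlonglongrightarrow> v t"
      unfolding v_def by (rule summable_LIMSEQ)
    then show "(\<lambda>n. L0_rep ((\<Sum>k<n. d k) - L0_class v) t) \<longlonglongrightarrow> 0"
      using * by (simp add: LIM_zero)
  qed
  then show ?thesis
    by blast
qed

section \<open>Modular function spaces\<close>

text \<open>In \<open>disjoint\<close>, the equation \<open>\<bar>f + g\<bar> = \<bar>f - g\<bar>\<close> says that \<open>f g = 0\<close> a.e.\<close>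

locale modular_function_space =
  fixes S :: "real set" and \<rho> :: "L0 \<Rightarrow> ennreal"
  assumes mono: "\<bar>f\<bar> \<le> \<bar>g\<bar> \<Longrightarrow> \<rho> f \<le> \<rho> g"
    and zero: "\<rho> 0 = 0"
    and convex: "\<lbrakk>0 < a; 0 < b; a + b = 1\<rbrakk> \<Longrightarrow> \<rho> (a *\<^sub>R f + b *\<^sub>R g) \<le> ennreal a * \<rho> f + ennreal b * \<rho> g"
    and disjoint: "\<bar>f + g\<bar> = \<bar>f - g\<bar> \<Longrightarrow> \<rho> (f + g) \<le> \<rho> f + \<rho> g"
    and Fatou: "\<lbrakk>ae_tendsto_zero (\<lambda>n. f' n - g); \<And>n. \<rho> (f' n) \<le> c\<rbrakk> \<Longrightarrow> \<rho> g \<le> c"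
    and dominated: "\<lbrakk>\<rho> f < \<infinity>; \<And>n. \<bar>g' n\<bar> \<le> \<bar>f\<bar>; ae_tendsto_zero g'\<rbrakk> \<Longrightarrow> (\<lambda>n. \<rho> (g' n)) \<longlonglongrightarrow> 0"
    and truncation: "\<lbrakk>0 < a; \<rho> (a *\<^sub>R f) < \<infinity>\<rbrakk> \<Longrightarrow> \<rho> (k *\<^sub>R (f - tail n f f)) < \<infinity>"
    and definite: "\<lbrakk>ae_vanishes_outside S f; \<rho> f = 0\<rbrakk> \<Longrightarrow> f = 0"
    and order_bounded: "\<lbrakk>incseq f'; \<And>n. 0 \<le> f' n; \<And>n. \<rho> (f' n) \<le> 1; \<And>n. ae_vanishes_outside S (f' n)\<rbrakk>
      \<Longrightarrow> \<exists>u. \<forall>n. f' n \<le> u"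
begin

definition X :: "L0 set" where
  "X = {f. ae_vanishes_outside S f \<and> (\<exists>k>0. \<rho> (k *\<^sub>R f) < \<infinity>)}"

definition N :: "L0 \<Rightarrow> real" where
  "N f = Inf {\<epsilon>. 0 < \<epsilon> \<and> \<rho> (f /\<^sub>R \<epsilon>) \<le> 1}"

abbreviation Y :: "L0 set" where
  "Y \<equiv> order_continuous_part X N"

section \<open>The Luxemburg norm and completeness\<close>

lemma scale_le:
  assumes "0 \<le> c" "c \<le> 1"
  shows "\<rho> (c *\<^sub>R f) \<le> ennreal c * \<rho> f"
proof -
  consider "c = 0" | "c = 1" | "0 < c" "c < 1"
    using assms by linarith
  then show ?thesis
    by cases (use convex[of c "1 - c" f 0] zero in auto)
qed

lemma mono_scale:
  assumes "\<bar>a\<bar> \<le> \<bar>b\<bar>"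
  shows "\<rho> (a *\<^sub>R f) \<le> \<rho> (b *\<^sub>R f)"
  using assms by (intro mono) (simp add: L0_abs_scaleR scaleR_right_mono)

lemma XI:
  assumes "ae_vanishes_outside S f" "0 < e" "\<rho> (f /\<^sub>R e) \<le> 1"
  shows "f \<in> X"
  unfolding X_def using assms by (auto intro!: exI[of _ "inverse e"] intro: le_less_trans)

lemma XE:
  assumes "f \<in> X"
  obtains e where "0 < e" "\<rho> (f /\<^sub>R e) \<le> 1"
proof -
  obtain k where k: "0 < k" "\<rho> (k *\<^sub>R f) < \<infinity>"
    using assms by (auto simp: X_def)
  then obtain r where r: "\<rho> (k *\<^sub>R f) = ennreal r" "0 \<le> r"
    by (cases "\<rho> (k *\<^sub>R f)") auto
  \<comment> \<open>By convexity this factor lowers the modular from \<open>r\<close> to at most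
    \<open>r / (r + 1)\<close>; it is positive and at most 1 also for \<open>r = 0\<close>.\<close>
  define c where "c = 1 / (r + 1)"
  have c: "0 < c" "c \<le> 1"
    using r by (auto simp: c_def)
  have "\<rho> (c *\<^sub>R k *\<^sub>R f) \<le> ennreal c * ennreal r"
    using scale_le[of c "k *\<^sub>R f"] c r by simp
  also have "\<dots> \<le> 1"
    using c r by (simp add: ennreal_mult[symmetric] ennreal_le_1 c_def field_simps)
  finally have "\<rho> (f /\<^sub>R (1 / (c * k))) \<le> 1"
    by simp
  then show ?thesis
    using that[of "1 / (c * k)"] c k by simp
qed

lemma X_vanishes: "f \<in> X \<Longrightarrow> ae_vanishes_outside S f"
  by (simp add: X_def)

lemma N_le: "0 < e \<Longrightarrow> \<rho> (f /\<^sub>R e) \<le> 1 \<Longrightarrow> N f \<le> e"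
  unfolding N_def by (rule cInf_lower) (auto intro: bdd_belowI[of _ 0])

lemma N_nonneg: "f \<in> X \<Longrightarrow> 0 \<le> N f"
  unfolding N_def by (rule cInf_greatest) (auto elim: XE)

text \<open>Some admissible \<open>e'\<close> lies below \<open>e\<close>, and dividing by a larger
  number only decreases the modular. The inequality is strict because the infimum is not shown to be
  attained.\<close>

lemma N_lessD:
  assumes "f \<in> X" "N f < e"
  shows "\<rho> (f /\<^sub>R e) \<le> 1"
proof -
  have "{\<epsilon>. 0 < \<epsilon> \<and> \<rho> (f /\<^sub>R \<epsilon>) \<le> 1} \<noteq> {}"
    using assms(1) by (auto elim: XE)
  then obtain e' where e': "0 < e'" "\<rho> (f /\<^sub>R e') \<le> 1" "e' < e"
    using assms(2) cInf_lessD[of "{\<epsilon>. 0 < \<epsilon> \<and> \<rho> (f /\<^sub>R \<epsilon>) \<le> 1}" e] unfolding N_def by auto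
  have "\<rho> (f /\<^sub>R e) \<le> \<rho> (f /\<^sub>R e')"
    using e' by (intro mono_scale) (simp add: le_imp_inverse_le)
  then show ?thesis
    using e' by simp
qed

text \<open>The quotient is a convex combination of \<open>f /\<^sub>R a\<close> and
  \<open>g /\<^sub>R b\<close> with weights \<open>a / (a + b)\<close> and
  \<open>b / (a + b)\<close>. Closure of \<open>X\<close> under addition and the triangle inequality
  both come from this.\<close>

lemma modular_add_le:
  assumes "0 < a" "0 < b" "\<rho> (f /\<^sub>R a) \<le> 1" "\<rho> (g /\<^sub>R b) \<le> 1"
  shows "\<rho> ((f + g) /\<^sub>R (a + b)) \<le> 1"
proof -
  have "(f + g) /\<^sub>R (a + b) = (a / (a + b)) *\<^sub>R (f /\<^sub>R a) + (b / (a + b)) *\<^sub>R (g /\<^sub>R b)"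
  proof -
    have "a / (a + b) * inverse a = inverse (a + b)" "b / (a + b) * inverse b = inverse (a + b)"
      using assms by (simp_all add: divide_simps)
    then show ?thesis
      by (simp only: scaleR_scaleR scaleR_add_right)
  qed
  then have "\<rho> ((f + g) /\<^sub>R (a + b)) \<le> ennreal (a / (a + b)) * \<rho> (f /\<^sub>R a) + ennreal (b / (a + b)) * \<rho> (g /\<^sub>R b)"
    using assms convex[of "a / (a + b)" "b / (a + b)" "f /\<^sub>R a" "g /\<^sub>R b"]
    by (simp add: add_divide_distrib[symmetric])
  also have "\<dots> \<le> ennreal (a / (a + b)) * 1 + ennreal (b / (a + b)) * 1"
    by (intro add_mono mult_left_mono assms) auto
  also have "\<dots> = 1"
    using assms by (simp add: ennreal_plus[symmetric] add_divide_distrib[symmetric] del: ennreal_plus)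
  finally show ?thesis .
qed

lemma X_zero: "0 \<in> X"
  by (rule XI[of 0 1]) (auto simp: zero ae_vanishes_outside_zero)

lemma X_add:
  assumes "f \<in> X" "g \<in> X"
  shows "f + g \<in> X"
proof -
  obtain a where a: "0 < a" "\<rho> (f /\<^sub>R a) \<le> 1"
    using assms(1) by (rule XE)
  obtain b where b: "0 < b" "\<rho> (g /\<^sub>R b) \<le> 1"
    using assms(2) by (rule XE)
  show ?thesis
  proof (rule XI)
    show "ae_vanishes_outside S (f + g)"
      using assms by (intro ae_vanishes_outside_add X_vanishes)
    show "\<rho> ((f + g) /\<^sub>R (a + b)) \<le> 1"
      by (rule modular_add_le[OF a(1) b(1) a(2) b(2)])
  qed (use a b in simp)
qed

lemma modular_scaled_le:
  assumes "c \<noteq> 0"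
  shows "\<rho> ((c *\<^sub>R f) /\<^sub>R (\<bar>c\<bar> * e)) \<le> \<rho> (f /\<^sub>R e)"
proof (rule mono)
  have "\<bar>inverse (\<bar>c\<bar> * e) * c\<bar> = \<bar>inverse e\<bar>"
    using assms by (simp add: abs_mult)
  then show "\<bar>(c *\<^sub>R f) /\<^sub>R (\<bar>c\<bar> * e)\<bar> \<le> \<bar>f /\<^sub>R e\<bar>"
    by (simp only: scaleR_scaleR L0_abs_scaleR order_refl)
qed

lemma X_scaleR:
  assumes "f \<in> X"
  shows "c *\<^sub>R f \<in> X"
proof (cases "c = 0")
  case False
  obtain e where e: "0 < e" "\<rho> (f /\<^sub>R e) \<le> 1"
    using assms by (rule XE)
  have "\<rho> ((c *\<^sub>R f) /\<^sub>R (\<bar>c\<bar> * e)) \<le> \<rho> (f /\<^sub>R e)"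
    using False by (rule modular_scaled_le)
  then have "\<rho> ((c *\<^sub>R f) /\<^sub>R (\<bar>c\<bar> * e)) \<le> 1"
    using e(2) by (rule order_trans)
  then show ?thesis
    using e(1) False by (intro XI[OF ae_vanishes_outside_scaleR[OF X_vanishes[OF assms]], where e="\<bar>c\<bar> * e"]) auto
qed (simp add: X_zero)

lemma subspace_X: "subspace X"
  by (simp add: subspace_def X_zero X_add X_scaleR)

lemma X_diff: "f \<in> X \<Longrightarrow> g \<in> X \<Longrightarrow> f - g \<in> X"
  by (rule subspace_diff[OF subspace_X])

lemma N_less_dominated:
  assumes "g \<in> X" "\<bar>f\<bar> \<le> \<bar>g\<bar>" "N g < e"
  shows "\<rho> (f /\<^sub>R e) \<le> 1"
proof -
  have "\<rho> (f /\<^sub>R e) \<le> \<rho> (g /\<^sub>R e)"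
    using assms by (intro mono) (simp add: L0_abs_scaleR scaleR_left_mono)
  then show ?thesis
    using N_lessD[OF assms(1,3)] by simp
qed

lemma X_dominated:
  assumes "g \<in> X" "\<bar>f\<bar> \<le> \<bar>g\<bar>"
  shows "f \<in> X"
  using N_nonneg[OF assms(1)] N_less_dominated[OF assms, of "N g + 1"]
  by (intro XI[OF ae_vanishes_outside_dominated[OF X_vanishes[OF assms(1)] assms(2)], where e="N g + 1"]) auto

lemma N_mono:
  assumes "g \<in> X" "\<bar>f\<bar> \<le> \<bar>g\<bar>"
  shows "N f \<le> N g"
proof (rule dense_ge)
  fix e assume "N g < e"
  then show "N f \<le> e"
    using N_nonneg[OF assms(1)] N_less_dominated[OF assms] by (intro N_le) auto
qed

lemma abs_X: "f \<in> X \<Longrightarrow> \<bar>f\<bar> \<in> X"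
  by (erule X_dominated) simp

lemma N_abs: "f \<in> X \<Longrightarrow> N \<bar>f\<bar> = N f"
  by (rule antisym; rule N_mono) (auto intro: abs_X)

lemma N_triangle:
  assumes "f \<in> X" "g \<in> X"
  shows "N (f + g) \<le> N f + N g"
proof (rule field_le_epsilon)
  fix e :: real assume "0 < e"
  have "N (f + g) \<le> (N f + e / 2) + (N g + e / 2)"
  proof (rule N_le[OF _ modular_add_le])
    show "\<rho> (f /\<^sub>R (N f + e / 2)) \<le> 1" "\<rho> (g /\<^sub>R (N g + e / 2)) \<le> 1"
      using \<open>0 < e\<close> by (auto intro!: N_lessD assms)
  qed (use \<open>0 < e\<close> N_nonneg[OF assms(1)] N_nonneg[OF assms(2)] in auto)
  then show "N (f + g) \<le> N f + N g + e"
    by simp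
qed

lemma N_zero: "N 0 = 0"
proof (rule antisym)
  show "N 0 \<le> 0"
    by (rule dense_ge) (auto intro!: N_le simp: zero)
qed (rule N_nonneg[OF X_zero])

lemma N_scaleR_le:
  assumes "f \<in> X" "c \<noteq> 0"
  shows "N (c *\<^sub>R f) \<le> \<bar>c\<bar> * N f"
proof -
  have "N (c *\<^sub>R f) / \<bar>c\<bar> \<le> e" if "N f < e" for e
  proof -
    have "0 < e"
      using that N_nonneg[OF assms(1)] by simp
    moreover have "\<rho> ((c *\<^sub>R f) /\<^sub>R (\<bar>c\<bar> * e)) \<le> \<rho> (f /\<^sub>R e)"
      using assms(2) by (rule modular_scaled_le)
    ultimately have "N (c *\<^sub>R f) \<le> \<bar>c\<bar> * e"
      using N_lessD[OF assms(1) that] assms(2) by (intro N_le) auto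
    then show ?thesis
      using assms(2) by (simp add: field_simps)
  qed
  then have "N (c *\<^sub>R f) / \<bar>c\<bar> \<le> N f"
    by (rule dense_ge)
  then show ?thesis
    using assms(2) by (simp add: field_simps)
qed

lemma N_scaleR:
  assumes "f \<in> X"
  shows "N (c *\<^sub>R f) = \<bar>c\<bar> * N f"
proof (cases "c = 0")
  case False
  have "N (inverse c *\<^sub>R c *\<^sub>R f) \<le> \<bar>inverse c\<bar> * N (c *\<^sub>R f)"
    using False assms by (intro N_scaleR_le X_scaleR) auto
  then have "\<bar>c\<bar> * N f \<le> N (c *\<^sub>R f)"
    using False by (simp add: field_simps)
  then show ?thesis
    using N_scaleR_le[OF assms False] by simp
qed (simp add: N_zero)

lemma N_minus_commute:
  assumes "f \<in> X" "g \<in> X"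
  shows "N (f - g) = N (g - f)"
  using N_scaleR[OF X_diff[OF assms], of "-1"] by simp

lemma N_eq_0D:
  assumes "f \<in> X" "N f = 0"
  shows "f = 0"
proof (rule definite)
  \<comment> \<open>As \<open>N f = 0\<close>, the modular of \<open>f /\<^sub>R e\<close> is at
    most 1 for every such \<open>e\<close>, and convexity gains the factor \<open>e\<close>.\<close>
  have "\<rho> f \<le> ennreal e" if e: "0 < e" "e \<le> 1" for e
  proof -
    have "\<rho> (e *\<^sub>R (f /\<^sub>R e)) \<le> ennreal e * \<rho> (f /\<^sub>R e)"
      using e by (intro scale_le) auto
    also have "\<dots> \<le> ennreal e * 1"
      using assms e by (intro mult_left_mono N_lessD) auto
    finally show ?thesis
      using e by simp
  qed
  note le = this
  show "\<rho> f = 0"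
  proof (rule ccontr)
    assume "\<rho> f \<noteq> 0"
    then obtain r where r: "\<rho> f = ennreal r" "0 < r"
      using le[of 1] by (cases "\<rho> f") (auto simp: top_unique)
    then have "ennreal r \<le> ennreal (min 1 (r / 2))"
      using le[of "min 1 (r / 2)"] by auto
    then have "r \<le> min 1 (r / 2)"
      using r by (subst (asm) ennreal_le_iff) auto
    then show False
      using r by simp
  qed
qed (rule X_vanishes[OF assms(1)])

lemma N_sum_le:
  assumes "\<And>k::nat. d k \<in> X"
  shows "(\<Sum>k<n. d k) \<in> X" "N (\<Sum>k<n. d k) \<le> (\<Sum>k<n. N (d k))"
proof -
  have "(\<Sum>k<n. d k) \<in> X \<and> N (\<Sum>k<n. d k) \<le> (\<Sum>k<n. N (d k))"
  proof (induction n)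
    case (Suc n)
    then show ?case
      using N_triangle[of "\<Sum>k<n. d k" "d n"] assms[of n] X_add by auto
  qed (simp add: X_zero N_zero)
  then show "(\<Sum>k<n. d k) \<in> X" "N (\<Sum>k<n. d k) \<le> (\<Sum>k<n. N (d k))"
    by auto
qed

text \<open>Along a fast subsequence the absolute increments have order-bounded partial sums, so the
  subsequence converges a.e.; \<open>Fatou\<close> turns this into norm convergence of the whole
  sequence.\<close>

lemma complete:
  assumes u: "\<And>n::nat. u n \<in> X"
    and Cauchy: "\<And>e. 0 < e \<Longrightarrow> \<exists>k. \<forall>m\<ge>k. \<forall>n\<ge>k. N (u m - u n) < e"
  shows "\<exists>x\<in>X. (\<lambda>n. N (u n - x)) \<longlonglongrightarrow> 0"
proof -
  \<comment> \<open>With the exponent \<open>Suc k\<close> the bounds on the increments sum to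
    \<open>1 - (1/2) ^ n\<close>, strictly below 1 as \<open>N_lessD\<close> demands.\<close>
  obtain R where R: "\<And>k m n. R k \<le> m \<Longrightarrow> R k \<le> n \<Longrightarrow> N (u m - u n) < (1/2) ^ Suc k"
    using Cauchy[of "(1/2) ^ Suc k" for k] by (metis zero_less_divide_1_iff zero_less_numeral zero_less_power)
  \<comment> \<open>Adding up the thresholds makes \<open>r\<close> monotone and at least
    \<open>R k\<close>; the summand \<open>k\<close> sends it to infinity.\<close>
  define r where "r k = k + (\<Sum>i\<le>k. R i)" for k
  have r_ge: "R k \<le> r k" "k \<le> r k" "r k \<le> r (Suc k)" for k
    by (auto simp: r_def intro: member_le_sum trans_le_add2)
  have r_at_top: "filterlim r at_top sequentially"
    by (rule filterlim_at_top_mono[OF filterlim_ident]) (use r_ge in auto)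
  define d where "d k = u (r (Suc k)) - u (r k)" for k
  have d_X: "d k \<in> X" for k
    unfolding d_def by (intro X_diff u)
  have d_N: "N \<bar>d k\<bar> \<le> (1/2) ^ Suc k" for k
    using R[of k "r (Suc k)" "r k"] r_ge[of k] by (simp add: N_abs d_X) (simp add: d_def)
  have "\<rho> (\<Sum>k<n. \<bar>d k\<bar>) \<le> 1" for n
  proof -
    have "N (\<Sum>k<n. \<bar>d k\<bar>) \<le> (\<Sum>k<n. N \<bar>d k\<bar>)"
      by (rule N_sum_le) (intro abs_X d_X)
    also have "\<dots> \<le> (\<Sum>k<n. (1/2) ^ Suc k)"
      by (intro sum_mono d_N)
    also have "\<dots> = 1 - (1/2) ^ n"
      by (simp add: sum_gp_strict flip: sum_distrib_left sum_divide_distrib)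
    also have "\<dots> < 1"
      by simp
    finally show ?thesis
      using N_lessD[of "\<Sum>k<n. \<bar>d k\<bar>" 1] N_sum_le(1)[of "\<lambda>k. \<bar>d k\<bar>"] abs_X d_X by simp
  qed
  then have "\<exists>U. \<forall>n. (\<Sum>k<n. \<bar>d k\<bar>) \<le> U"
    using N_sum_le(1)[of "\<lambda>k. \<bar>d k\<bar>"] abs_X d_X
    by (intro order_bounded) (auto simp: incseq_Suc_iff intro!: sum_nonneg X_vanishes)
  then obtain v where v: "ae_tendsto_zero (\<lambda>n. (\<Sum>k<n. d k) - v)"
    using L0_abs_summable by blast
  define x where "x = u (r 0) + v"
  have "(\<Sum>k<n. d k) - v = u (r n) - x" for n
    unfolding d_def x_def using sum_lessThan_telescope[of "\<lambda>k. u (r k)" n] by (simp add: algebra_simps)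
  then have lim: "ae_tendsto_zero (\<lambda>n. u (r n) - x)"
    using v by simp
  have van: "ae_vanishes_outside S x"
    by (rule ae_vanishes_outside_limit[OF lim]) (intro X_vanishes u)
  \<comment> \<open>For fixed \<open>n\<close> the second index runs along the subsequence, and the
    a.e. limit inherits the modular bound. Shifting by \<open>k\<close> keeps that index beyond the
    Cauchy threshold.\<close>
  have *: "\<exists>k. \<forall>n\<ge>k. \<rho> ((u n - x) /\<^sub>R e) \<le> 1" if e: "0 < e" for e
  proof -
    obtain k where k: "\<And>m n. k \<le> m \<Longrightarrow> k \<le> n \<Longrightarrow> N (u m - u n) < e"
      using Cauchy[OF e] by blast
    have "\<rho> ((u n - x) /\<^sub>R e) \<le> 1" if n: "k \<le> n" for n
    proof (rule Fatou)
      show "\<rho> ((u n - u (r (j + k))) /\<^sub>R e) \<le> 1" for j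
        using n r_ge(2)[of "j + k"] by (intro N_lessD X_diff u k) auto
      have "ae_tendsto_zero (\<lambda>j. (- inverse e) *\<^sub>R (u (r (j + k)) - x))"
        by (intro ae_tendsto_zero_scaleR ae_tendsto_zero_subseq[OF lim, of "\<lambda>j. j + k"] filterlim_add_const_nat_at_top)
      moreover have "(- inverse e) *\<^sub>R (u (r (j + k)) - x) = (u n - u (r (j + k))) /\<^sub>R e - (u n - x) /\<^sub>R e" for j
        by (simp add: algebra_simps)
      ultimately show "ae_tendsto_zero (\<lambda>j. (u n - u (r (j + k))) /\<^sub>R e - (u n - x) /\<^sub>R e)"
        by simp
    qed
    then show ?thesis
      by blast
  qed
  have "u n - x \<in> X" if "\<rho> ((u n - x) /\<^sub>R e) \<le> 1" "0 < e" for n e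
  proof (rule XI[OF _ that(2,1)])
    show "ae_vanishes_outside S (u n - x)"
      using ae_vanishes_outside_add[OF X_vanishes[OF u] ae_vanishes_outside_scaleR[OF van, of "-1"]] by simp
  qed
  note diff_X = this
  have x_X: "x \<in> X"
  proof -
    obtain n where "\<rho> ((u n - x) /\<^sub>R 1) \<le> 1"
      using *[of 1] by auto
    then have "u n - (u n - x) \<in> X"
      by (rule X_diff[OF u diff_X]) simp
    then show ?thesis
      by simp
  qed
  moreover have "(\<lambda>n. N (u n - x)) \<longlonglongrightarrow> 0"
  proof (rule LIMSEQ_I)
    fix e :: real assume "0 < e"
    then obtain k where "\<forall>n\<ge>k. \<rho> ((u n - x) /\<^sub>R (e / 2)) \<le> 1"
      using *[of "e / 2"] by auto
    then have "N (u n - x) \<le> e / 2" if "k \<le> n" for n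
      using that \<open>0 < e\<close> by (intro N_le) auto
    then show "\<exists>k. \<forall>n\<ge>k. norm (N (u n - x) - 0) < e"
      using \<open>0 < e\<close> N_nonneg[OF X_diff[OF u x_X]] by (intro exI[of _ k]) fastforce
  qed
  ultimately show ?thesis
    by blast
qed

lemma banach_X: "banach_on X N"
  unfolding banach_on_def
  using subspace_X N_nonneg N_zero N_eq_0D N_scaleR N_triangle complete by auto

end

section \<open>The order-continuous part\<close>

context modular_function_space
begin

lemma Y_iff:
  "f \<in> Y \<longleftrightarrow> f \<in> X \<and> (\<forall>g. (\<forall>n. 0 \<le> g n \<and> g n \<le> \<bar>f\<bar>) \<and> decseq g \<and> ae_tendsto_zero g
    \<longrightarrow> (\<lambda>n. N (g n)) \<longlonglongrightarrow> 0)"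
proof -
  have "decseq (\<lambda>n. N (g n))" if "f \<in> X" "\<And>n. 0 \<le> g n" "\<And>n. g n \<le> \<bar>f\<bar>" "decseq g" for g
  proof (rule decseq_SucI)
    fix n
    have "g n \<in> X"
      using that by (intro X_dominated[OF that(1)]) simp
    then show "N (g (Suc n)) \<le> N (g n)"
      using that by (intro N_mono) (auto simp: decseq_Suc_iff)
  qed
  then show ?thesis
    unfolding order_continuous_part_def by blast
qed

lemma YD:
  assumes "f \<in> Y" "\<And>n. 0 \<le> g n" "\<And>n. g n \<le> \<bar>f\<bar>" "decseq g" "ae_tendsto_zero g"
  shows "(\<lambda>n. N (g n)) \<longlonglongrightarrow> 0"
  using assms unfolding Y_iff by blast

lemma Y_X: "f \<in> Y \<Longrightarrow> f \<in> X"
  by (simp add: Y_iff)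

lemma Y_dominated:
  assumes "f \<in> Y" "\<bar>g\<bar> \<le> \<bar>f\<bar>"
  shows "g \<in> Y"
  unfolding Y_iff
proof (intro conjI allI impI)
  show "g \<in> X"
    by (rule X_dominated[OF Y_X[OF assms(1)] assms(2)])
  fix h
  assume "(\<forall>n. 0 \<le> h n \<and> h n \<le> \<bar>g\<bar>) \<and> decseq h \<and> ae_tendsto_zero h"
  then show "(\<lambda>n. N (h n)) \<longlonglongrightarrow> 0"
    using assms(2) by (intro YD[OF assms(1)]) (auto intro: order_trans)
qed

text \<open>Riesz decomposition of a sequence decreasing to 0: order continuity of \<open>f\<close>
  handles the part below \<open>\<bar>f\<bar>\<close>, and the remainder is again a sequence
  decreasing to 0, now below \<open>k\<close>.\<close>

lemma Y_split:
  assumes "f \<in> Y" "0 \<le> k" "\<And>n. 0 \<le> h n" "\<And>n. h n \<le> \<bar>f\<bar> + k" "decseq h" "ae_tendsto_zero h"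
  shows "(\<lambda>n. N (inf (h n) \<bar>f\<bar>)) \<longlonglongrightarrow> 0" "\<And>n. 0 \<le> h n - inf (h n) \<bar>f\<bar>" "\<And>n. h n - inf (h n) \<bar>f\<bar> \<le> k"
    "decseq (\<lambda>n. h n - inf (h n) \<bar>f\<bar>)" "ae_tendsto_zero (\<lambda>n. h n - inf (h n) \<bar>f\<bar>)"
proof -
  show nn: "0 \<le> h n - inf (h n) \<bar>f\<bar>" for n
    using L0_inf_le1[of "h n" "\<bar>f\<bar>"] by simp
  show "h n - inf (h n) \<bar>f\<bar> \<le> k" for n
    using assms by (intro L0_minus_inf_le)
  show "decseq (\<lambda>n. h n - inf (h n) \<bar>f\<bar>)"
    using assms(5) by (intro decseq_SucI L0_minus_inf_mono) (simp add: decseq_Suc_iff)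
  have inf_nn: "0 \<le> inf (h n) \<bar>f\<bar>" for n
    using assms(3) by (intro L0_inf_nonneg) auto
  show "ae_tendsto_zero (\<lambda>n. h n - inf (h n) \<bar>f\<bar>)"
    by (rule ae_tendsto_zero_squeeze[OF assms(6)]) (use nn inf_nn assms(3) in simp)
  show "(\<lambda>n. N (inf (h n) \<bar>f\<bar>)) \<longlonglongrightarrow> 0"
  proof (rule YD[OF assms(1)])
    show "decseq (\<lambda>n. inf (h n) \<bar>f\<bar>)"
      using assms(5) by (intro decseq_SucI L0_inf_mono) (simp add: decseq_Suc_iff)
    show "ae_tendsto_zero (\<lambda>n. inf (h n) \<bar>f\<bar>)"
      by (rule ae_tendsto_zero_squeeze[OF assms(6)]) (use inf_nn assms(3) L0_inf_le1 in simp)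
  qed (use inf_nn L0_inf_le2 in auto)
qed

lemma N_split_le:
  assumes "f \<in> X" "\<bar>k\<bar> \<le> \<bar>f\<bar>" "h \<in> X"
  shows "N h \<le> N k + N (h - k)"
  using N_triangle[of k "h - k"] X_dominated[OF assms(1,2)] X_diff[OF assms(3)] by simp

lemma Y_add:
  assumes "f \<in> Y" "g \<in> Y"
  shows "f + g \<in> Y"
  unfolding Y_iff
proof (intro conjI allI impI)
  show fg: "f + g \<in> X"
    by (intro X_add Y_X assms)
  fix h
  assume h: "(\<forall>n. 0 \<le> h n \<and> h n \<le> \<bar>f + g\<bar>) \<and> decseq h \<and> ae_tendsto_zero h"
  have hX: "h n \<in> X" for n
    using h by (intro X_dominated[OF fg]) simp
  have "h n \<le> \<bar>f\<bar> + \<bar>g\<bar>" for n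
    using h abs_triangle_ineq[of f g] by (blast intro: order_trans)
  then have s: "(\<lambda>n. N (inf (h n) \<bar>f\<bar>)) \<longlonglongrightarrow> 0" "\<And>n. 0 \<le> h n - inf (h n) \<bar>f\<bar>" "\<And>n. h n - inf (h n) \<bar>f\<bar> \<le> \<bar>g\<bar>"
    "decseq (\<lambda>n. h n - inf (h n) \<bar>f\<bar>)" "ae_tendsto_zero (\<lambda>n. h n - inf (h n) \<bar>f\<bar>)"
    using Y_split[OF assms(1), of "\<bar>g\<bar>" h] h by auto
  have "(\<lambda>n. N (h n - inf (h n) \<bar>f\<bar>)) \<longlonglongrightarrow> 0"
    by (rule YD[OF assms(2) s(2-5)])
  then have lim: "(\<lambda>n. N (inf (h n) \<bar>f\<bar>) + N (h n - inf (h n) \<bar>f\<bar>)) \<longlonglongrightarrow> 0"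
    using tendsto_add[OF s(1)] by simp
  have inf_le: "\<bar>inf (h n) \<bar>f\<bar>\<bar> \<le> \<bar>f\<bar>" for n
    using h L0_inf_le2[of "h n" "\<bar>f\<bar>"] L0_inf_nonneg[of "h n" "\<bar>f\<bar>"] by simp
  show "(\<lambda>n. N (h n)) \<longlonglongrightarrow> 0"
  proof (rule tendsto_sandwich[OF _ _ tendsto_const lim])
    show "eventually (\<lambda>n. N (h n) \<le> N (inf (h n) \<bar>f\<bar>) + N (h n - inf (h n) \<bar>f\<bar>)) sequentially"
      by (intro always_eventually allI N_split_le[OF Y_X[OF assms(1)] inf_le hX])
  qed (simp add: N_nonneg hX)
qed

text \<open>Doubling is an addition, so \<open>Y\<close> contains all multiples by powers of 2; one
  of these dominates the given multiple.\<close>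

lemma Y_scaleR:
  assumes "f \<in> Y"
  shows "c *\<^sub>R f \<in> Y"
proof -
  have pow: "(2 ^ n) *\<^sub>R f \<in> Y" for n :: nat
  proof (induction n)
    case (Suc n)
    have "(2 ^ n) *\<^sub>R f + (2 ^ n) *\<^sub>R f \<in> Y"
      by (rule Y_add[OF Suc Suc])
    then show ?case
      by (simp flip: scaleR_add_left)
  qed (use assms in simp)
  obtain n where "\<bar>c\<bar> < 2 ^ n"
    using real_arch_pow[of 2 "\<bar>c\<bar>"] by auto
  then show ?thesis
    by (intro Y_dominated[OF pow[of n]]) (simp add: L0_abs_scaleR scaleR_right_mono)
qed

lemma subspace_Y: "subspace Y"
proof -
  have "0 \<in> Y"
    unfolding Y_iff
  proof (intro conjI allI impI)
    fix h :: "nat \<Rightarrow> L0"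
    assume "(\<forall>n. 0 \<le> h n \<and> h n \<le> \<bar>0\<bar>) \<and> decseq h \<and> ae_tendsto_zero h"
    then have "h n = 0" for n
      by (metis abs_zero order_antisym)
    then show "(\<lambda>n. N (h n)) \<longlonglongrightarrow> 0"
      by (simp add: N_zero)
  qed (rule X_zero)
  then show ?thesis
    by (simp add: subspace_def Y_add Y_scaleR)
qed

lemma Y_diff: "f \<in> Y \<Longrightarrow> g \<in> Y \<Longrightarrow> f - g \<in> Y"
  by (rule subspace_diff[OF subspace_Y])

text \<open>Splitting along \<open>\<bar>u m\<bar>\<close> leaves a remainder below
  \<open>\<bar>x - u m\<bar>\<close>, whose norm is small uniformly in \<open>n\<close>.\<close>

lemma Y_closed:
  assumes "\<And>n::nat. u n \<in> Y" "x \<in> X" "(\<lambda>n. N (u n - x)) \<longlonglongrightarrow> 0"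
  shows "x \<in> Y"
  unfolding Y_iff
proof (intro conjI allI impI)
  fix h
  assume h: "(\<forall>n. 0 \<le> h n \<and> h n \<le> \<bar>x\<bar>) \<and> decseq h \<and> ae_tendsto_zero h"
  have hX: "h n \<in> X" for n
    using h by (intro X_dominated[OF assms(2)]) simp
  show "(\<lambda>n. N (h n)) \<longlonglongrightarrow> 0"
  proof (rule LIMSEQ_I)
    fix e :: real assume "0 < e"
    then have "eventually (\<lambda>n. N (u n - x) < e / 2) sequentially"
      using order_tendstoD(2)[OF assms(3), of "e / 2"] by simp
    then obtain m where m: "N (u m - x) < e / 2"
      by (auto simp: eventually_sequentially)
    let ?f = "u m" and ?k = "\<bar>x - u m\<bar>"
    have "h n \<le> \<bar>?f\<bar> + ?k" for n
      using h abs_triangle_ineq[of "u m" "x - u m"] by (auto intro: order_trans)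
    then have s: "(\<lambda>n. N (inf (h n) \<bar>?f\<bar>)) \<longlonglongrightarrow> 0" "\<And>n. 0 \<le> h n - inf (h n) \<bar>?f\<bar>" "\<And>n. h n - inf (h n) \<bar>?f\<bar> \<le> ?k"
      using Y_split[OF assms(1)[of m], of ?k h] h by auto
    have inf_le: "\<bar>inf (h n) \<bar>?f\<bar>\<bar> \<le> \<bar>?f\<bar>" for n
      using h L0_inf_le2[of "h n" "\<bar>?f\<bar>"] L0_inf_nonneg[of "h n" "\<bar>?f\<bar>"] by simp
    have xu: "x - u m \<in> X"
      by (intro X_diff Y_X assms)
    have "eventually (\<lambda>n. N (inf (h n) \<bar>?f\<bar>) < e / 2) sequentially"
      using order_tendstoD(2)[OF s(1), of "e / 2"] \<open>0 < e\<close> by simp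
    then obtain n0 where n0: "\<And>n. n0 \<le> n \<Longrightarrow> N (inf (h n) \<bar>?f\<bar>) < e / 2"
      by (auto simp: eventually_sequentially)
    have "N (h n) < e" if "n0 \<le> n" for n
    proof -
      have "N (h n) \<le> N (inf (h n) \<bar>?f\<bar>) + N (h n - inf (h n) \<bar>?f\<bar>)"
        by (rule N_split_le[OF Y_X[OF assms(1)] inf_le hX])
      also have "N (h n - inf (h n) \<bar>?f\<bar>) \<le> N (x - u m)"
        using s(2,3) by (intro N_mono xu) simp
      also have "\<dots> = N (u m - x)"
        by (intro N_minus_commute Y_X assms)
      finally show ?thesis
        using n0[OF that] m by simp
    qed
    then show "\<exists>n0. \<forall>n\<ge>n0. norm (N (h n) - 0) < e"
      using N_nonneg[OF hX] by auto
  qed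
qed (rule assms(2))

lemma closed_Y: "closed_subspace_on X N Y"
  unfolding closed_subspace_on_def using subspace_Y Y_X Y_closed by blast

text \<open>By solidity it suffices to treat \<open>h\<close> itself. All multiples of its
  truncation have finite modular, so dominated convergence of the modular applies at every scale
  \<open>e / 2\<close>, which amounts to norm convergence.\<close>

lemma minus_tail_Y:
  assumes "h \<in> X" "\<bar>f\<bar> \<le> \<bar>h\<bar>"
  shows "f - tail n h f \<in> Y"
proof (rule Y_dominated[OF _ abs_minus_tail_mono[OF assms(2)]])
  let ?g = "h - tail n h h"
  show "?g \<in> Y"
    unfolding Y_iff
  proof (intro conjI allI impI)
    show "?g \<in> X"
      by (rule X_dominated[OF assms(1) abs_minus_tail_le])
    then have gX: "k \<in> X" if "0 \<le> k" "k \<le> \<bar>?g\<bar>" for k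
      using that by (intro X_dominated[OF \<open>?g \<in> X\<close>]) simp
    fix u :: "nat \<Rightarrow> L0"
    assume u: "(\<forall>n. 0 \<le> u n \<and> u n \<le> \<bar>?g\<bar>) \<and> decseq u \<and> ae_tendsto_zero u"
    obtain a where a: "0 < a" "\<rho> (a *\<^sub>R h) < \<infinity>"
      using assms(1) by (auto simp: X_def)
    show "(\<lambda>n. N (u n)) \<longlonglongrightarrow> 0"
    proof (rule LIMSEQ_I)
      fix e :: real assume "0 < e"
      have "(\<lambda>n. \<rho> (u n /\<^sub>R (e / 2))) \<longlonglongrightarrow> 0"
      proof (rule dominated)
        show "\<rho> (?g /\<^sub>R (e / 2)) < \<infinity>"
          by (rule truncation[OF a])
        show "\<bar>u n /\<^sub>R (e / 2)\<bar> \<le> \<bar>?g /\<^sub>R (e / 2)\<bar>" for n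
          using u by (simp only: L0_abs_scaleR) (intro scaleR_left_mono, auto)
        show "ae_tendsto_zero (\<lambda>n. u n /\<^sub>R (e / 2))"
          using u by (intro ae_tendsto_zero_scaleR) simp
      qed
      then have "eventually (\<lambda>n. \<rho> (u n /\<^sub>R (e / 2)) < 1) sequentially"
        by (rule order_tendstoD) simp
      then obtain n0 where n0: "\<And>n. n0 \<le> n \<Longrightarrow> \<rho> (u n /\<^sub>R (e / 2)) < 1"
        by (auto simp: eventually_sequentially)
      have "norm (N (u n) - 0) < e" if "n0 \<le> n" for n
        using N_le[of "e / 2" "u n"] less_imp_le[OF n0[OF that]] N_nonneg[OF gX, of "u n"] u \<open>0 < e\<close> by simp
      then show "\<exists>n0. \<forall>n\<ge>n0. norm (N (u n) - 0) < e"
        by blast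
    qed
  qed
qed

text \<open>The tails of \<open>\<bar>f\<bar>\<close> decrease to 0 a.e. along the tail sets of any
  \<open>h\<close>, so order continuity of \<open>f\<close> applies directly.\<close>

lemma N_tail_tendsto_zero:
  assumes "f \<in> Y"
  shows "(\<lambda>n. N (tail n h f)) \<longlonglongrightarrow> 0"
proof -
  have "(\<lambda>n. N (tail n h \<bar>f\<bar>)) \<longlonglongrightarrow> 0"
  proof (rule YD[OF assms])
    show "0 \<le> tail n h \<bar>f\<bar>" for n
      by (simp flip: abs_tail)
    show "tail n h \<bar>f\<bar> \<le> \<bar>f\<bar>" for n
      using abs_tail_le[of n h f] by (simp add: abs_tail)
    show "decseq (\<lambda>n. tail n h \<bar>f\<bar>)"
      by (intro decseq_SucI tail_decreasing) auto
  qed (rule ae_tendsto_zero_tail)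
  moreover have "N (tail n h \<bar>f\<bar>) = N (tail n h f)" for n
    using N_abs[OF X_dominated[OF Y_X[OF assms] abs_tail_le]] by (simp add: abs_tail)
  ultimately show ?thesis
    by simp
qed

text \<open>Only the modular at scale 1 is controlled. The norms of these tails need not tend to 0,
  which leaves room for a nonzero singular part.\<close>

lemma modular_tail_tendsto_zero:
  assumes "\<rho> f < \<infinity>"
  shows "(\<lambda>n. \<rho> (tail n h f)) \<longlonglongrightarrow> 0"
  by (rule dominated[OF assms abs_tail_le ae_tendsto_zero_tail])

section \<open>The order-continuous part of a functional\<close>

text \<open>For \<open>f \<in> X\<close> the truncations lie in \<open>Y\<close>, so only the values
  of \<open>F\<close> on \<open>Y\<close> matter. Convergence for functionals in the dual is
  \<open>convergent_minus_tail\<close>; off \<open>X\<close> the value of \<open>lim\<close> carries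
  no meaning.\<close>

definition oc_part :: "(L0 \<Rightarrow> real) \<Rightarrow> L0 \<Rightarrow> real" where
  "oc_part F f = lim (\<lambda>n. F (f - tail n f f))"

section \<open>Bounded functionals and their values on tails\<close>

lemma dual_add: "F \<in> dual_on X N \<Longrightarrow> x \<in> X \<Longrightarrow> y \<in> X \<Longrightarrow> F (x + y) = F x + F y"
  by (simp add: dual_on_def)

lemma dual_scaleR: "F \<in> dual_on X N \<Longrightarrow> x \<in> X \<Longrightarrow> F (c *\<^sub>R x) = c * F x"
  by (simp add: dual_on_def)

lemma dual_outside: "F \<in> dual_on X N \<Longrightarrow> x \<notin> X \<Longrightarrow> F x = 0"
  by (simp add: dual_on_def)

lemma dual_diff:
  assumes "F \<in> dual_on X N" "x \<in> X" "y \<in> X"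
  shows "F (x - y) = F x - F y"
  using dual_add[OF assms(1), of "x - y" y] X_diff[OF assms(2,3)] assms(3) by simp

lemma dual_bound:
  assumes "F \<in> dual_on X N"
  obtains C where "0 \<le> C" "\<And>x. x \<in> X \<Longrightarrow> \<bar>F x\<bar> \<le> C * N x"
proof -
  obtain C where C: "\<And>x. x \<in> X \<Longrightarrow> \<bar>F x\<bar> \<le> C * N x"
    using assms unfolding dual_on_def by blast
  have "\<bar>F x\<bar> \<le> max C 0 * N x" if "x \<in> X" for x
    using C[OF that] N_nonneg[OF that] mult_right_mono[of C "max C 0" "N x"] by simp
  then show ?thesis
    using that[of "max C 0"] by simp
qed

lemma dual_lincomb:
  assumes F: "F \<in> dual_on X N" and G: "G \<in> dual_on X N"
  shows "(\<lambda>x. a * F x + b * G x) \<in> dual_on X N"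
proof -
  obtain C where C: "\<And>x. x \<in> X \<Longrightarrow> \<bar>F x\<bar> \<le> C * N x"
    using dual_bound[OF F] by blast
  obtain D where D: "\<And>x. x \<in> X \<Longrightarrow> \<bar>G x\<bar> \<le> D * N x"
    using dual_bound[OF G] by blast
  have "\<bar>a * F x + b * G x\<bar> \<le> (\<bar>a\<bar> * C + \<bar>b\<bar> * D) * N x" if "x \<in> X" for x
  proof -
    have "\<bar>a * F x + b * G x\<bar> \<le> \<bar>a\<bar> * \<bar>F x\<bar> + \<bar>b\<bar> * \<bar>G x\<bar>"
      using abs_triangle_ineq[of "a * F x" "b * G x"] by (simp add: abs_mult)
    also have "\<dots> \<le> \<bar>a\<bar> * (C * N x) + \<bar>b\<bar> * (D * N x)"
      by (intro add_mono mult_left_mono C D that) auto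
    finally show ?thesis
      by (simp add: algebra_simps)
  qed
  then have "\<exists>K. \<forall>x\<in>X. \<bar>a * F x + b * G x\<bar> \<le> K * N x"
    by blast
  then show ?thesis
    using F G by (auto simp: dual_on_def algebra_simps)
qed

text \<open>A nearly optimal \<open>g\<^sub>0\<close> in the supremum of \<open>F\<close> over \<open>{g \<in> Y. 0 \<le> g \<le> f}\<close> cannot be improved
  on the tail set, which bounds \<open>F\<close> there.\<close>

lemma dual_tail_small_nonneg:
  assumes F: "F \<in> dual_on X N" and f: "f \<in> X" "0 \<le> f" and "0 < e"
  shows "\<exists>n0. \<forall>n\<ge>n0. \<forall>g\<in>Y. 0 \<le> g \<and> g \<le> tail n h f \<longrightarrow> F g \<le> e"
proof -
  obtain C where C: "0 \<le> C" "\<And>x. x \<in> X \<Longrightarrow> \<bar>F x\<bar> \<le> C * N x"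
    using dual_bound[OF F] by blast
  define A where "A = F ` {g \<in> Y. 0 \<le> g \<and> g \<le> f}"
  have bdd: "bdd_above A"
  proof (rule bdd_aboveI)
    fix a assume "a \<in> A"
    then obtain g where g: "a = F g" "g \<in> Y" "0 \<le> g" "g \<le> f"
      by (auto simp: A_def)
    have "a \<le> C * N g"
      using C(2)[OF Y_X[OF g(2)]] g(1) by simp
    also have "\<dots> \<le> C * N f"
      using g f by (intro mult_left_mono N_mono C) auto
    finally show "a \<le> C * N f" .
  qed
  have "F 0 \<in> A"
    unfolding A_def using f subspace_0[OF subspace_Y] by auto
  then have "Sup A - e / 2 < Sup A" "A \<noteq> {}"
    using \<open>0 < e\<close> by auto
  then obtain g0 where g0: "g0 \<in> Y" "0 \<le> g0" "g0 \<le> f" "Sup A - e / 2 < F g0"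
    using less_cSup_iff[OF _ bdd, of "Sup A - e / 2"] by (auto simp: A_def)
  \<comment> \<open>Because \<open>g0\<close> is order-continuous, removing its tail costs less than
    \<open>e / 2\<close>; the other half of \<open>e\<close> is the distance of \<open>F g0\<close>
    from the supremum.\<close>
  have "(\<lambda>n. C * N (tail n h g0)) \<longlonglongrightarrow> C * 0"
    by (intro tendsto_mult_left N_tail_tendsto_zero g0)
  then have "eventually (\<lambda>n. C * N (tail n h g0) < e / 2) sequentially"
    using \<open>0 < e\<close> by (intro order_tendstoD(2)) auto
  then obtain n0 where n0: "\<And>n. n0 \<le> n \<Longrightarrow> C * N (tail n h g0) < e / 2"
    by (auto simp: eventually_sequentially)
  have "F g \<le> e" if n: "n0 \<le> n" and g: "g \<in> Y" "0 \<le> g" "g \<le> tail n h f" for n g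
  proof -
    have tY: "tail n h g0 \<in> Y"
      by (rule Y_dominated[OF g0(1) abs_tail_le])
    have mY: "g0 - tail n h g0 \<in> Y"
      by (intro Y_diff g0 tY)
    have "F (g0 - tail n h g0 + g) \<in> A"
      unfolding A_def using tail_replace_le[OF g0(2,3) g(2,3)] Y_add[OF mY g(1)] by auto
    then have "F (g0 - tail n h g0 + g) \<le> Sup A"
      by (rule cSup_upper[OF _ bdd])
    moreover have "F (g0 - tail n h g0 + g) = F g0 - F (tail n h g0) + F g"
      using g0 g tY mY by (simp add: dual_add[OF F] dual_diff[OF F] Y_X)
    moreover have "F (tail n h g0) \<le> C * N (tail n h g0)"
      using C(2)[OF Y_X[OF tY]] by simp
    ultimately show ?thesis
      using n0[OF n] g0(4) by simp
  qed
  then show ?thesis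
    by blast
qed

text \<open>The one-sided estimate is applied to \<open>F\<close> and to its negative, on the
  positive and on the negative part of \<open>g\<close>; each part accounts for
  \<open>e / 2\<close>.\<close>

lemma dual_tail_small:
  assumes F: "F \<in> dual_on X N" and f: "f \<in> X" and "0 < e"
  shows "\<exists>n0. \<forall>n\<ge>n0. \<forall>g\<in>Y. \<bar>g\<bar> \<le> tail n h \<bar>f\<bar> \<longrightarrow> \<bar>F g\<bar> \<le> e"
proof -
  have F': "(\<lambda>x. - F x) \<in> dual_on X N"
    using dual_lincomb[OF F F, of "-1" 0] by simp
  obtain n1 where n1: "\<forall>n\<ge>n1. \<forall>g\<in>Y. 0 \<le> g \<and> g \<le> tail n h \<bar>f\<bar> \<longrightarrow> F g \<le> e / 2"
    using dual_tail_small_nonneg[OF F abs_X[OF f], of "e / 2"] \<open>0 < e\<close> by auto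
  obtain n2 where n2: "\<forall>n\<ge>n2. \<forall>g\<in>Y. 0 \<le> g \<and> g \<le> tail n h \<bar>f\<bar> \<longrightarrow> - F g \<le> e / 2"
    using dual_tail_small_nonneg[OF F' abs_X[OF f], of "e / 2"] \<open>0 < e\<close> by auto
  have "\<bar>F g\<bar> \<le> e" if n: "max n1 n2 \<le> n" and g: "g \<in> Y" "\<bar>g\<bar> \<le> tail n h \<bar>f\<bar>" for n g
  proof -
    define p where "p = (1/2) *\<^sub>R (\<bar>g\<bar> + g)"
    note p = L0_pos_part[of g, folded p_def]
    have pY: "p \<in> Y" "p - g \<in> Y"
      using p by (auto intro!: Y_dominated[OF g(1)])
    have "F p \<le> e / 2" "- F p \<le> e / 2" "F (p - g) \<le> e / 2" "- F (p - g) \<le> e / 2"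
      using n1 n2 n pY p g(2) by (auto intro: order_trans)
    moreover have "F (p - g) = F p - F g"
      by (intro dual_diff[OF F] Y_X pY g)
    ultimately show ?thesis
      by linarith
  qed
  then show ?thesis
    by blast
qed

lemma tail_X: "f \<in> X \<Longrightarrow> tail n h f \<in> X"
  by (erule X_dominated) (rule abs_tail_le)

lemma minus_tail_X: "f \<in> X \<Longrightarrow> f - tail n h f \<in> X"
  by (erule X_dominated) (rule abs_minus_tail_le)

text \<open>Truncations need not converge in norm. Two of them differ by an element of
  \<open>Y\<close> within the earlier tail of \<open>\<bar>f\<bar>\<close>, and there
  \<open>dual_tail_small\<close> makes \<open>F\<close> uniformly small.\<close>

lemma convergent_minus_tail:
  assumes F: "F \<in> dual_on X N" and fh: "f \<in> X" "h \<in> X" "\<bar>f\<bar> \<le> \<bar>h\<bar>"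
  shows "convergent (\<lambda>n. F (f - tail n h f))"
proof -
  have "Cauchy (\<lambda>n. F (f - tail n h f))"
  proof (rule CauchyI')
    fix e :: real assume "0 < e"
    then obtain n0 where n0: "\<forall>n\<ge>n0. \<forall>g\<in>Y. \<bar>g\<bar> \<le> tail n h \<bar>f\<bar> \<longrightarrow> \<bar>F g\<bar> \<le> e / 2"
      using dual_tail_small[OF F fh(1), of "e / 2" h] by auto
    have "dist (F (f - tail m h f)) (F (f - tail n h f)) < e" if "n0 \<le> m" "m < n" for m n
    proof -
      have "(f - tail n h f) - (f - tail m h f) \<in> Y"
        by (intro Y_diff minus_tail_Y fh)
      then have Y: "tail m h f - tail n h f \<in> Y"
        by simp
      have "\<bar>F (tail m h f - tail n h f)\<bar> \<le> e / 2"
        using n0 that Y tail_diff_le[of m n h f] by simp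
      moreover have "F (tail m h f - tail n h f) = F (f - tail n h f) - F (f - tail m h f)"
        using fh by (simp add: dual_diff[OF F] tail_X)
      ultimately show ?thesis
        using \<open>0 < e\<close> by (simp add: dist_real_def abs_minus_commute)
    qed
    then show "\<exists>M. \<forall>m\<ge>M. \<forall>n>m. dist (F (f - tail m h f)) (F (f - tail n h f)) < e"
      by blast
  qed
  then show ?thesis
    by (rule Cauchy_convergent)
qed

text \<open>Independence of \<open>h\<close> is what makes \<open>oc_part F\<close> linear: two elements can be cut down to the
  same sets.\<close>

lemma oc_part_tendsto:
  assumes F: "F \<in> dual_on X N" and fh: "f \<in> X" "h \<in> X" "\<bar>f\<bar> \<le> \<bar>h\<bar>"
  shows "(\<lambda>n. F (f - tail n h f)) \<longlonglongrightarrow> oc_part F f"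
proof -
  have f: "(\<lambda>n. F (f - tail n f f)) \<longlonglongrightarrow> oc_part F f"
    using convergent_minus_tail[OF F fh(1) fh(1)] unfolding oc_part_def by (simp add: convergent_LIMSEQ_iff)
  have "(\<lambda>n. F (f - tail n h f) - F (f - tail n f f)) \<longlonglongrightarrow> 0"
  proof (rule LIMSEQ_I)
    fix e :: real assume "0 < e"
    then obtain n1 where n1: "\<forall>n\<ge>n1. \<forall>g\<in>Y. \<bar>g\<bar> \<le> tail n h \<bar>f\<bar> \<longrightarrow> \<bar>F g\<bar> \<le> e / 4"
      using dual_tail_small[OF F fh(1), of "e / 4" h] by auto
    obtain n2 where n2: "\<forall>n\<ge>n2. \<forall>g\<in>Y. \<bar>g\<bar> \<le> tail n f \<bar>f\<bar> \<longrightarrow> \<bar>F g\<bar> \<le> e / 4"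
      using dual_tail_small[OF F fh(1), of "e / 4" f] \<open>0 < e\<close> by auto
    have "norm (F (f - tail n h f) - F (f - tail n f f) - 0) < e" if n: "max n1 n2 \<le> n" for n
    proof -
      \<comment> \<open>These are the pieces of \<open>f\<close> that exactly one of the two
        truncations removes: \<open>?a\<close> lives on the tail set of \<open>f\<close> outside
        that of \<open>h\<close>, and \<open>?b\<close> the other way round.\<close>
      let ?a = "tail n f (f - tail n h f)" and ?b = "tail n h (f - tail n f f)"
      have Y: "?a \<in> Y" "?b \<in> Y"
        by (rule Y_dominated[OF minus_tail_Y abs_tail_le], use fh in auto)+
      have "\<bar>?a\<bar> \<le> tail n f \<bar>f\<bar>" "\<bar>?b\<bar> \<le> tail n h \<bar>f\<bar>"
        by (simp_all only: abs_tail tail_abs_mono abs_minus_tail_le)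
      then have "\<bar>F ?a\<bar> \<le> e / 4" "\<bar>F ?b\<bar> \<le> e / 4"
        using n1 n2 n Y by auto
      moreover have "(f - tail n h f) - (f - tail n f f) = ?a - ?b"
        by (simp add: tail_diff tail_commute[of n f n h])
      then have "F (f - tail n h f) - F (f - tail n f f) = F ?a - F ?b"
        using fh Y by (metis dual_diff[OF F] minus_tail_X Y_X)
      ultimately show ?thesis
        using \<open>0 < e\<close> by simp
    qed
    then show "\<exists>n0. \<forall>n\<ge>n0. norm (F (f - tail n h f) - F (f - tail n f f) - 0) < e"
      by blast
  qed
  from tendsto_add[OF this f] show ?thesis
    by simp
qed

lemma oc_part_bound:
  assumes F: "F \<in> dual_on X N" and f: "f \<in> X" and C: "0 \<le> C" "\<And>x. x \<in> X \<Longrightarrow> \<bar>F x\<bar> \<le> C * N x"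
  shows "\<bar>oc_part F f\<bar> \<le> C * N f"
proof (rule Lim_bounded)
  show "(\<lambda>n. \<bar>F (f - tail n f f)\<bar>) \<longlonglongrightarrow> \<bar>oc_part F f\<bar>"
    by (intro tendsto_rabs oc_part_tendsto F f) simp
  show "\<forall>n\<ge>0. \<bar>F (f - tail n f f)\<bar> \<le> C * N f"
  proof (intro allI impI)
    fix n
    have "\<bar>F (f - tail n f f)\<bar> \<le> C * N (f - tail n f f)"
      by (intro C minus_tail_X f)
    also have "\<dots> \<le> C * N f"
      by (intro mult_left_mono N_mono f abs_minus_tail_le C)
    finally show "\<bar>F (f - tail n f f)\<bar> \<le> C * N f" .
  qed
qed

lemma oc_part_add:
  assumes F: "F \<in> dual_on X N" and fg: "f \<in> X" "g \<in> X"
  shows "oc_part F (f + g) = oc_part F f + oc_part F g"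
proof -
  let ?h = "\<bar>f\<bar> + \<bar>g\<bar>"
  have h: "?h \<in> X"
    by (intro X_add abs_X fg)
  have le: "\<bar>f + g\<bar> \<le> \<bar>?h\<bar>" "\<bar>f\<bar> \<le> \<bar>?h\<bar>" "\<bar>g\<bar> \<le> \<bar>?h\<bar>"
    by (simp_all add: abs_triangle_ineq)
  have "(\<lambda>n. F ((f + g) - tail n ?h (f + g))) \<longlonglongrightarrow> oc_part F (f + g)"
    by (intro oc_part_tendsto F X_add fg h le)
  moreover have "(\<lambda>n. F (f - tail n ?h f) + F (g - tail n ?h g)) \<longlonglongrightarrow> oc_part F f + oc_part F g"
    by (intro tendsto_add oc_part_tendsto F fg h le)
  moreover have "F ((f + g) - tail n ?h (f + g)) = F (f - tail n ?h f) + F (g - tail n ?h g)" for n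
    using fg by (simp add: dual_add[OF F, symmetric] minus_tail_X tail_add algebra_simps)
  ultimately show ?thesis
    using LIMSEQ_unique by simp
qed

lemma oc_part_scaleR:
  assumes F: "F \<in> dual_on X N" and f: "f \<in> X"
  shows "oc_part F (c *\<^sub>R f) = c * oc_part F f"
proof -
  \<comment> \<open>A common majorant of \<open>f\<close> and \<open>c *\<^sub>R f\<close>, so that
    both limits run along the same tail sets.\<close>
  let ?h = "(1 + \<bar>c\<bar>) *\<^sub>R f"
  have le: "\<bar>c *\<^sub>R f\<bar> \<le> \<bar>?h\<bar>" "\<bar>f\<bar> \<le> \<bar>?h\<bar>"
    using scaleR_right_mono[of "\<bar>c\<bar>" "1 + \<bar>c\<bar>" "\<bar>f\<bar>"] scaleR_right_mono[of 1 "1 + \<bar>c\<bar>" "\<bar>f\<bar>"]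
    by (simp_all add: L0_abs_scaleR)
  have "(\<lambda>n. F (c *\<^sub>R f - tail n ?h (c *\<^sub>R f))) \<longlonglongrightarrow> oc_part F (c *\<^sub>R f)"
    by (intro oc_part_tendsto F X_scaleR f le)
  moreover have "(\<lambda>n. c * F (f - tail n ?h f)) \<longlonglongrightarrow> c * oc_part F f"
    by (intro tendsto_mult_left oc_part_tendsto F X_scaleR f le)
  moreover have "F (c *\<^sub>R f - tail n ?h (c *\<^sub>R f)) = c * F (f - tail n ?h f)" for n
    using f by (simp only: dual_scaleR[OF F, symmetric] minus_tail_X tail_scaleR scaleR_diff_right)
  ultimately show ?thesis
    using LIMSEQ_unique by simp
qed

lemma oc_part_Y:
  assumes F: "F \<in> dual_on X N" and f: "f \<in> Y"
  shows "oc_part F f = F f"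
proof -
  obtain C where C: "0 \<le> C" "\<And>x. x \<in> X \<Longrightarrow> \<bar>F x\<bar> \<le> C * N x"
    using dual_bound[OF F] by blast
  have X: "f \<in> X"
    using f by (rule Y_X)
  have "(\<lambda>n. C * N (tail n f f)) \<longlonglongrightarrow> C * 0"
    by (intro tendsto_mult_left N_tail_tendsto_zero f)
  then have "(\<lambda>n. C * N (tail n f f)) \<longlonglongrightarrow> 0"
    by simp
  then have "(\<lambda>n. F (tail n f f)) \<longlonglongrightarrow> 0"
    by (rule Lim_null_comparison[rotated]) (use C(2)[OF tail_X[OF X]] in simp)
  then have "(\<lambda>n. F f - F (tail n f f)) \<longlonglongrightarrow> F f - 0"
    by (intro tendsto_diff tendsto_const)
  moreover have "F f - F (tail n f f) = F (f - tail n f f)" for n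
    using X by (simp add: dual_diff[OF F] tail_X)
  ultimately show ?thesis
    using oc_part_tendsto[OF F X X order_refl] LIMSEQ_unique by simp
qed

section \<open>The M-ideal property\<close>

text \<open>All truncations of \<open>f\<close> lie in \<open>Y\<close>. Hence a functional that
  annihilates \<open>Y\<close> is its own singular part, which makes the projection idempotent and
  its range the whole annihilator.\<close>

lemma oc_part_eq_0:
  assumes "\<And>y. y \<in> Y \<Longrightarrow> F y = 0" "f \<in> X"
  shows "oc_part F f = 0"
  using assms minus_tail_Y[of f f] by (simp add: oc_part_def)

text \<open>The projection onto the annihilator. The value 0 off \<open>X\<close> is the convention
  for functionals, which \<open>oc_part F\<close> need not obey.\<close>

definition singular_part :: "(L0 \<Rightarrow> real) \<Rightarrow> L0 \<Rightarrow> real" where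
  "singular_part F x = (if x \<in> X then F x - oc_part F x else 0)"

lemma oc_part_lincomb:
  assumes "F \<in> dual_on X N" "G \<in> dual_on X N" "x \<in> X"
  shows "oc_part (\<lambda>x. a * F x + b * G x) x = a * oc_part F x + b * oc_part G x"
proof -
  have "(\<lambda>n. a * F (x - tail n x x) + b * G (x - tail n x x)) \<longlonglongrightarrow> a * oc_part F x + b * oc_part G x"
    by (intro tendsto_intros oc_part_tendsto assms order_refl)
  then show ?thesis
    unfolding oc_part_def[of "\<lambda>x. a * F x + b * G x"] by (rule limI)
qed

lemma singular_part_lincomb:
  assumes "F \<in> dual_on X N" "G \<in> dual_on X N"
  shows "singular_part (\<lambda>x. a * F x + b * G x) = (\<lambda>x. a * singular_part F x + b * singular_part G x)"
  using oc_part_lincomb[OF assms, of _ a b] by (auto simp: singular_part_def fun_eq_iff algebra_simps)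

lemma singular_part_dual:
  assumes F: "F \<in> dual_on X N"
  shows "singular_part F \<in> dual_on X N"
proof -
  obtain C where C: "0 \<le> C" "\<And>x. x \<in> X \<Longrightarrow> \<bar>F x\<bar> \<le> C * N x"
    using dual_bound[OF F] by blast
  have "\<bar>singular_part F x\<bar> \<le> (2 * C) * N x" if "x \<in> X" for x
    using C(2)[OF that] oc_part_bound[OF F that C] that by (simp add: singular_part_def)
  then have "\<exists>K. \<forall>x\<in>X. \<bar>singular_part F x\<bar> \<le> K * N x"
    by blast
  moreover have "singular_part F (x + y) = singular_part F x + singular_part F y" if "x \<in> X" "y \<in> X" for x y
    using that by (simp add: singular_part_def X_add dual_add[OF F] oc_part_add[OF F])
  moreover have "singular_part F (c *\<^sub>R x) = c * singular_part F x" if "x \<in> X" for x c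
    using that by (simp add: singular_part_def X_scaleR dual_scaleR[OF F] oc_part_scaleR[OF F] algebra_simps)
  ultimately show ?thesis
    by (auto simp: dual_on_def singular_part_def)
qed

lemma singular_part_annihilator:
  assumes F: "F \<in> dual_on X N"
  shows "singular_part F \<in> annihilator_on X N Y"
  using singular_part_dual[OF F] oc_part_Y[OF F] by (auto simp: annihilator_on_def singular_part_def Y_X)

lemma singular_part_id:
  assumes "F \<in> annihilator_on X N Y"
  shows "singular_part F = F"
  using assms oc_part_eq_0[of F] dual_outside[of F]
  by (auto simp: annihilator_on_def singular_part_def fun_eq_iff)

section \<open>Additivity of the dual norm\<close>

lemma dual_norm_upper:
  assumes "F \<in> dual_on X N" "x \<in> X" "N x \<le> 1"
  shows "\<bar>F x\<bar> \<le> dual_norm_on X N F"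
proof -
  obtain C where C: "0 \<le> C" "\<And>x. x \<in> X \<Longrightarrow> \<bar>F x\<bar> \<le> C * N x"
    using dual_bound[OF assms(1)] by blast
  have "bdd_above ((\<lambda>x. \<bar>F x\<bar>) ` {x \<in> X. N x \<le> 1})"
  proof (rule bdd_aboveI2)
    fix x assume "x \<in> {x \<in> X. N x \<le> 1}"
    then show "\<bar>F x\<bar> \<le> C"
      using C(2)[of x] mult_left_mono[of "N x" 1 C] C(1) by simp
  qed
  then show ?thesis
    unfolding dual_norm_on_def using assms by (intro cSUP_upper) auto
qed

lemma dual_norm_least:
  assumes "\<And>x. x \<in> X \<Longrightarrow> N x \<le> 1 \<Longrightarrow> \<bar>F x\<bar> \<le> c"
  shows "dual_norm_on X N F \<le> c"
  unfolding dual_norm_on_def using assms X_zero N_zero by (intro cSUP_least) (auto intro!: exI[of _ 0])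

text \<open>The elements \<open>c f\<close> cut down to a set where \<open>g\<close> is neither small nor large, and \<open>g\<close> restricted to
  the complement of that set, are disjoint, and the modular of the latter is small. Their sum
  is in the unit ball and tests \<open>F\<close> on its order-continuous and singular part at once.\<close>

lemma dual_norm_pointwise:
  assumes F: "F \<in> dual_on X N" and f: "f \<in> X" "\<rho> f \<le> 1" and g: "g \<in> X" "\<rho> g \<le> 1"
  shows "oc_part F f + (F g - oc_part F g) \<le> dual_norm_on X N F"
proof -
  \<comment> \<open>The factor \<open>c < 1\<close> leaves room \<open>1 - c\<close> for the modular
    of a tail of \<open>g\<close>, and the truncation at \<open>m\<close> makes the first element
    order-continuous. Both restrictions are removed by limits afterwards.\<close>
  have step: "c * F (f - tail m f f) + (F g - oc_part F g) \<le> dual_norm_on X N F"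
    if c: "0 < c" "c < 1" for c m
  proof -
    define f' where "f' = c *\<^sub>R (f - tail m f f)"
    have f'Y: "f' \<in> Y"
      unfolding f'_def by (intro Y_scaleR minus_tail_Y f order_refl)
    have f'X: "f' \<in> X"
      by (rule Y_X[OF f'Y])
    define x where "x n = (f' - tail n g f') + tail n g g" for n
    have xX: "x n \<in> X" for n
      unfolding x_def by (intro X_add minus_tail_X tail_X f'X g)
    have x_le: "\<rho> (x n) \<le> ennreal c + \<rho> (tail n g g)" for n
    proof -
      have "\<rho> (f' - tail n g f') \<le> \<rho> f'"
        by (rule mono[OF abs_minus_tail_le])
      also have "\<dots> \<le> ennreal c * \<rho> (f - tail m f f)"
        unfolding f'_def using c by (intro scale_le) auto
      also have "\<dots> \<le> ennreal c * 1"
        using mono[OF abs_minus_tail_le, of f m f] f(2) by (intro mult_left_mono) (auto intro: order_trans)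
      finally have "\<rho> (f' - tail n g f') \<le> ennreal c"
        by simp
      then show ?thesis
        unfolding x_def using disjoint[OF tail_disjoint, of f' n g g] add_right_mono order_trans by blast
    qed
    have "\<rho> g < \<infinity>"
      using g(2) by (rule le_less_trans) simp
    then have "(\<lambda>n. \<rho> (tail n g g)) \<longlonglongrightarrow> 0"
      by (rule modular_tail_tendsto_zero)
    then have "eventually (\<lambda>n. \<rho> (tail n g g) < ennreal (1 - c)) sequentially"
      using c by (intro order_tendstoD(2)) auto
    then have "eventually (\<lambda>n. F (x n) \<le> dual_norm_on X N F) sequentially"
    proof eventually_elim
      fix n assume n: "\<rho> (tail n g g) < ennreal (1 - c)"
      have "\<rho> (x n) \<le> ennreal c + ennreal (1 - c)"
        using x_le[of n] n by (intro order_trans[OF x_le] add_left_mono) simp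
      also have "\<dots> = 1"
        using c by (simp add: ennreal_plus[symmetric] del: ennreal_plus)
      finally have "N (x n) \<le> 1"
        by (intro N_le) auto
      then show "F (x n) \<le> dual_norm_on X N F"
        using dual_norm_upper[OF F xX] by (simp add: abs_le_iff)
    qed
    moreover have "(\<lambda>n. F (x n)) \<longlonglongrightarrow> F f' + (F g - oc_part F g)"
    proof -
      have f'_lim: "(\<lambda>n. F (f' - tail n g f')) \<longlonglongrightarrow> F f'"
      proof -
        obtain C where C: "0 \<le> C" "\<And>x. x \<in> X \<Longrightarrow> \<bar>F x\<bar> \<le> C * N x"
          using dual_bound[OF F] by blast
        have "(\<lambda>n. C * N (tail n g f')) \<longlonglongrightarrow> C * 0"
          by (intro tendsto_mult_left N_tail_tendsto_zero f'Y)
        then have "(\<lambda>n. C * N (tail n g f')) \<longlonglongrightarrow> 0"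
          by simp
        then have "(\<lambda>n. F (tail n g f')) \<longlonglongrightarrow> 0"
          by (rule Lim_null_comparison[rotated]) (use C(2)[OF tail_X[OF f'X]] in simp)
        then have "(\<lambda>n. F f' - F (tail n g f')) \<longlonglongrightarrow> F f' - 0"
          by (intro tendsto_diff tendsto_const)
        then show ?thesis
          using f'X by (simp add: dual_diff[OF F] tail_X)
      qed
      \<comment> \<open>\<open>F (tail n g g)\<close> is rewritten as
        \<open>F g - F (g - tail n g g)\<close>, whose limit is the singular part at
        \<open>g\<close>.\<close>
      have "(\<lambda>n. F (f' - tail n g f') + (F g - F (g - tail n g g))) \<longlonglongrightarrow> F f' + (F g - oc_part F g)"
        by (intro tendsto_add tendsto_diff tendsto_const f'_lim oc_part_tendsto F g order_refl)
      moreover have "F (f' - tail n g f') + (F g - F (g - tail n g g)) = F (x n)" for n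
        unfolding x_def using f'X g by (simp add: dual_add[OF F] dual_diff[OF F] tail_X minus_tail_X)
      ultimately show ?thesis
        by simp
    qed
    ultimately have "F f' + (F g - oc_part F g) \<le> dual_norm_on X N F"
      by (intro tendsto_upperbound) auto
    then show ?thesis
      unfolding f'_def using f(1) by (simp add: dual_scaleR[OF F] minus_tail_X)
  qed
  have "c * oc_part F f + (F g - oc_part F g) \<le> dual_norm_on X N F" if c: "0 < c" "c < 1" for c
  proof (rule Lim_bounded)
    show "(\<lambda>m. c * F (f - tail m f f) + (F g - oc_part F g)) \<longlonglongrightarrow> c * oc_part F f + (F g - oc_part F g)"
      by (intro tendsto_intros oc_part_tendsto F f order_refl)
  qed (use step[OF c] in blast)
  note le = this
  \<comment> \<open>The denominators start at 2, which keeps the factors strictly between 0 and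
    1.\<close>
  have "(\<lambda>n. (1 - 1 / real (Suc (Suc n))) * oc_part F f + (F g - oc_part F g))
      \<longlonglongrightarrow> (1 - 0) * oc_part F f + (F g - oc_part F g)"
    by (intro tendsto_intros LIMSEQ_Suc[OF LIMSEQ_Suc[OF lim_1_over_n]])
  then have "(1 - 0) * oc_part F f + (F g - oc_part F g) \<le> dual_norm_on X N F"
    by (rule Lim_bounded) (auto intro!: le simp del: of_nat_Suc)
  then show ?thesis
    by simp
qed

text \<open>Since \<open>f\<close> and \<open>g\<close> are independent, their signs can be chosen
  separately, which yields both absolute values. The factor \<open>c < 1\<close> passes from norm at
  most 1 to modular at most 1 and tends to 1 at the end.\<close>

lemma dual_norm_pointwise_abs:
  assumes F: "F \<in> dual_on X N" and f: "f \<in> X" "N f \<le> 1" and g: "g \<in> X" "N g \<le> 1"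
  shows "\<bar>oc_part F f\<bar> + \<bar>singular_part F g\<bar> \<le> dual_norm_on X N F"
proof -
  have le: "c * (\<bar>oc_part F f\<bar> + \<bar>singular_part F g\<bar>) \<le> dual_norm_on X N F" if c: "0 < c" "c < 1" for c
  proof -
    define a where "a = c * sgn (oc_part F f)"
    define b where "b = c * sgn (singular_part F g)"
    have unit: "\<rho> (r *\<^sub>R x) \<le> 1" if "x \<in> X" "N x \<le> 1" "\<bar>r\<bar> \<le> c" for r x
    proof -
      have "\<bar>r\<bar> * N x \<le> c * 1"
        using that N_nonneg c by (intro mult_mono) auto
      then have "N (r *\<^sub>R x) < 1"
        using c that by (simp add: N_scaleR)
      then show ?thesis
        using N_lessD[OF X_scaleR[OF that(1)], of r 1] by simp
    qed
    have "\<bar>a\<bar> \<le> c" "\<bar>b\<bar> \<le> c"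
      using c by (auto simp: a_def b_def abs_mult abs_sgn_eq)
    then have "oc_part F (a *\<^sub>R f) + (F (b *\<^sub>R g) - oc_part F (b *\<^sub>R g)) \<le> dual_norm_on X N F"
      by (intro dual_norm_pointwise F X_scaleR unit f g)
    also have "oc_part F (a *\<^sub>R f) + (F (b *\<^sub>R g) - oc_part F (b *\<^sub>R g)) = a * oc_part F f + b * singular_part F g"
      using f g by (simp add: oc_part_scaleR[OF F] dual_scaleR[OF F] singular_part_def algebra_simps)
    also have "\<dots> = c * (\<bar>oc_part F f\<bar> + \<bar>singular_part F g\<bar>)"
      unfolding a_def b_def by (simp add: algebra_simps abs_sgn mult.commute)
    finally show ?thesis .
  qed
  have "(\<lambda>n. (1 - 1 / real (Suc (Suc n))) * (\<bar>oc_part F f\<bar> + \<bar>singular_part F g\<bar>))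
      \<longlonglongrightarrow> (1 - 0) * (\<bar>oc_part F f\<bar> + \<bar>singular_part F g\<bar>)"
    by (intro tendsto_intros LIMSEQ_Suc[OF LIMSEQ_Suc[OF lim_1_over_n]])
  then have "(1 - 0) * (\<bar>oc_part F f\<bar> + \<bar>singular_part F g\<bar>) \<le> dual_norm_on X N F"
    by (rule Lim_bounded) (auto intro!: le simp del: of_nat_Suc)
  then show ?thesis
    by simp
qed

lemma minus_singular_part:
  assumes "F \<in> dual_on X N"
  shows "F x - singular_part F x = (if x \<in> X then oc_part F x else 0)"
  using dual_outside[OF assms] by (simp add: singular_part_def)

lemma dual_norm_split:
  assumes F: "F \<in> dual_on X N"
  shows "dual_norm_on X N F = dual_norm_on X N (singular_part F) + dual_norm_on X N (\<lambda>x. F x - singular_part F x)"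
proof (rule antisym)
  have oc: "(\<lambda>x. F x - singular_part F x) \<in> dual_on X N"
    using dual_lincomb[OF F singular_part_dual[OF F], of 1 "-1"] by simp
  show "dual_norm_on X N F \<le> dual_norm_on X N (singular_part F) + dual_norm_on X N (\<lambda>x. F x - singular_part F x)"
  proof (rule dual_norm_least)
    fix x assume "x \<in> X" "N x \<le> 1"
    then show "\<bar>F x\<bar> \<le> dual_norm_on X N (singular_part F) + dual_norm_on X N (\<lambda>x. F x - singular_part F x)"
      using dual_norm_upper[OF singular_part_dual[OF F], of x] dual_norm_upper[OF oc, of x] by linarith
  qed
  \<comment> \<open>The estimate holds for all pairs \<open>f\<close>, \<open>g\<close>, so the
    supremum is taken over \<open>g\<close> with \<open>f\<close> fixed, and then over
    \<open>f\<close>.\<close>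
  have "dual_norm_on X N (\<lambda>x. F x - singular_part F x) \<le> dual_norm_on X N F - dual_norm_on X N (singular_part F)"
  proof (rule dual_norm_least)
    fix f assume f: "f \<in> X" "N f \<le> 1"
    have "dual_norm_on X N (singular_part F) \<le> dual_norm_on X N F - \<bar>oc_part F f\<bar>"
    proof (rule dual_norm_least)
      fix g assume "g \<in> X" "N g \<le> 1"
      from dual_norm_pointwise_abs[OF F f this]
      show "\<bar>singular_part F g\<bar> \<le> dual_norm_on X N F - \<bar>oc_part F f\<bar>"
        by simp
    qed
    then show "\<bar>F f - singular_part F f\<bar> \<le> dual_norm_on X N F - dual_norm_on X N (singular_part F)"
      using f by (simp add: minus_singular_part[OF F])
  qed
  then show "dual_norm_on X N (singular_part F) + dual_norm_on X N (\<lambda>x. F x - singular_part F x) \<le> dual_norm_on X N F"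
    by simp
qed

lemma dual_norm_nonneg:
  assumes "F \<in> dual_on X N"
  shows "0 \<le> dual_norm_on X N F"
proof -
  have "\<bar>F 0\<bar> \<le> dual_norm_on X N F"
    using N_zero by (intro dual_norm_upper[OF assms X_zero]) simp
  then show ?thesis
    using abs_ge_zero[of "F 0"] by linarith
qed

theorem M_ideal_order_continuous_part: "M_ideal X N Y"
  unfolding M_ideal_def
proof (intro conjI exI[of _ singular_part])
  show "bounded_projection_on X N singular_part"
    unfolding bounded_projection_on_def
  proof (intro conjI ballI allI exI[of _ 1])
    fix F assume F: "F \<in> dual_on X N"
    show "singular_part F \<in> dual_on X N"
      by (rule singular_part_dual[OF F])
    show "singular_part (singular_part F) = singular_part F"
      by (rule singular_part_id[OF singular_part_annihilator[OF F]])
    show "singular_part (\<lambda>x. c * F x) = (\<lambda>x. c * singular_part F x)" for c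
      using singular_part_lincomb[OF F F, of c 0] by simp
    \<comment> \<open>The projection has bound 1 because the other summand in
      \<open>dual_norm_split\<close> is nonnegative.\<close>
    have "(\<lambda>x. F x - singular_part F x) \<in> dual_on X N"
      using dual_lincomb[OF F singular_part_dual[OF F], of 1 "-1"] by simp
    then show "dual_norm_on X N (singular_part F) \<le> 1 * dual_norm_on X N F"
      using dual_norm_split[OF F] dual_norm_nonneg by simp
    fix G assume G: "G \<in> dual_on X N"
    show "singular_part (\<lambda>x. F x + G x) = (\<lambda>x. singular_part F x + singular_part G x)"
      using singular_part_lincomb[OF F G, of 1 1] by simp
  qed
  have "F \<in> singular_part ` dual_on X N" if "F \<in> annihilator_on X N Y" for F
    using singular_part_id[OF that] that by (auto simp: annihilator_on_def intro: image_eqI[of F singular_part F])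
  then show "singular_part ` dual_on X N = annihilator_on X N Y"
    using singular_part_annihilator by auto
qed (auto simp: banach_X closed_Y dual_norm_split)

end

theorem theorem3p10:
  fixes \<gamma> :: ereal and \<phi> w :: "real \<Rightarrow> real"
  assumes "0 < \<gamma>"
    and "orlicz_function \<phi>" and "nondegenerate \<phi>"
    and "weight_function \<gamma> w"
  shows "M_ideal (orlicz_lorentz \<gamma> \<phi> w) (luxemburg_norm \<gamma> \<phi> w)
           (order_continuous_part (orlicz_lorentz \<gamma> \<phi> w) (luxemburg_norm \<gamma> \<phi> w))"
proof -
  interpret M: orlicz_lorentz_modular \<gamma> w \<phi>
    using assms by unfold_locales
  interpret modular_function_space "half_open_interval \<gamma>" "modular \<gamma> \<phi> w"
  proof
    show "\<bar>f\<bar> \<le> \<bar>g\<bar> \<Longrightarrow> modular \<gamma> \<phi> w f \<le> modular \<gamma> \<phi> w g" for f g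
      by (rule M.modular_mono)
    show "modular \<gamma> \<phi> w 0 = 0"
      by (rule M.modular_zero)
    show "\<lbrakk>0 < a; 0 < b; a + b = 1\<rbrakk> \<Longrightarrow> modular \<gamma> \<phi> w (a *\<^sub>R f + b *\<^sub>R g)
        \<le> ennreal a * modular \<gamma> \<phi> w f + ennreal b * modular \<gamma> \<phi> w g" for a b f g
      by (rule M.modular_convex)
    show "\<bar>f + g\<bar> = \<bar>f - g\<bar> \<Longrightarrow> modular \<gamma> \<phi> w (f + g) \<le> modular \<gamma> \<phi> w f + modular \<gamma> \<phi> w g" for f g
      by (rule M.modular_disjoint)
    show "\<lbrakk>ae_tendsto_zero (\<lambda>n. f n - g); \<And>n. modular \<gamma> \<phi> w (f n) \<le> c\<rbrakk> \<Longrightarrow> modular \<gamma> \<phi> w g \<le> c" for f g c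
      by (rule M.modular_Fatou)
    show "\<lbrakk>modular \<gamma> \<phi> w f < \<infinity>; \<And>n. \<bar>g n\<bar> \<le> \<bar>f\<bar>; ae_tendsto_zero g\<rbrakk>
        \<Longrightarrow> (\<lambda>n. modular \<gamma> \<phi> w (g n)) \<longlonglongrightarrow> 0" for f g
      by (rule M.modular_dominated)
    show "\<lbrakk>0 < a; modular \<gamma> \<phi> w (a *\<^sub>R f) < \<infinity>\<rbrakk> \<Longrightarrow> modular \<gamma> \<phi> w (k *\<^sub>R (f - tail n f f)) < \<infinity>" for a f k n
      by (rule M.modular_truncation)
    show "\<lbrakk>ae_vanishes_outside (half_open_interval \<gamma>) f; modular \<gamma> \<phi> w f = 0\<rbrakk> \<Longrightarrow> f = 0" for f
      by (rule M.modular_eq_0D)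
    show "\<lbrakk>incseq f; \<And>n. 0 \<le> f n; \<And>n. modular \<gamma> \<phi> w (f n) \<le> 1;
        \<And>n. ae_vanishes_outside (half_open_interval \<gamma>) (f n)\<rbrakk> \<Longrightarrow> \<exists>u. \<forall>n. f n \<le> u" for f
      by (rule M.modular_incseq_bounded)
  qed
  have "orlicz_lorentz \<gamma> \<phi> w = X"
    unfolding orlicz_lorentz_def X_def ..
  moreover have "luxemburg_norm \<gamma> \<phi> w = N"
    unfolding luxemburg_norm_def N_def ..
  ultimately show ?thesis
    using M_ideal_order_continuous_part by simp
qed

end
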